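(* Let $\phi\in L^\infty(\mathbb{T})$ and let $u$ be an inner function having a zero in $\mathbb{D}$. Then the following statements are equivalent: (a) $T_\phi$ is $C_{\alpha,u}$-symmetric for some $\alpha\in\mathscr{M}$. (b) $T_\phi$ is $C_{\lambda,u}$-symmetric for some $\lambda\in\mathbb{T}$. (c) $\phi=f\circ u+\overline{C_\lambda(f)\circ u}$ for some $\lambda\in\mathbb{T}$ and some $f\in H^2$.
   Context: $\mathbb{D}$ is the open unit disk in $\mathbb{C}$, $\mathbb{T}$ its boundary with normalized Haar measure $\sigma$, $L^2=L^2(\mathbb{T},\sigma)$. $H^2$ is the Hardy space of $\mathbb{D}$, identified via boundary functions with a closed subspace of $L^2$, with inner product $\langle f,g\rangle=\int_{\mathbb{T}} f\bar g\,d\sigma$; $P:L^2\to H^2$ is the orthogonal projection. For $\phi\in L^\infty(\mathbb{T})$, the Toeplitz operator $T_\phi$ on $H^2$ is $T_\phi f=P(\phi f)$. $H^\infty$ is the space of bounded analytic functions on $\mathbb{D}$; $u\in H^\infty$ is inner if $|u|=1$ a.e. on $\mathbb{T}$. Equalities between symbols hold a.e. on $\mathbb{T}$. A conjugation on a Hilbert space $\mathcal{H}$ is a conjugate-linear map $C:\mathcal{H}\to\mathcal{H}$ with $C^2=I$ and $\langle Cx,Cy\rangle=\langle y,x\rangle$ for all $x,y$. A bounded operator $T$ is $C$-symmetric if $CTC=T^*$. For $\lambda\in\mathbb{T}$, $C_\lambda$ is the conjugation (on $L^2$ and on $H^2$) $C_\lambda h(z)=\overline{h(\lambda\bar z)}$,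 $z\in\mathbb{T}$; equivalently $C_\lambda\big(\sum c_nz^n\big)=\sum\overline{c_n}\,\overline{\lambda^n}z^n$. $\mathscr{M}$ is the set of all sequences $\alpha=(\alpha_0,\alpha_1,\alpha_2,\dots)$ with every $\alpha_n\in\mathbb{T}$. For $\alpha\in\mathscr{M}$, a nonconstant inner function $u$, and an orthonormal basis $E=\{e_j:j\in\Lambda\}$ of $H^2\ominus uH^2$, the set $\{u^me_j: j\in\Lambda,\ m\ge 0\}$ is an orthonormal basis of $H^2$, and $C_{\alpha,u,E}$ is the conjugation on $H^2$ defined by $C_{\alpha,u,E}\big(\sum_{m,j}\mu_{m,j}u^me_j\big)=\sum_{m,j}\overline{\mu_{m,j}}\,\alpha_m u^me_j$. An operator $T$ on $H^2$ is called $C_{\alpha,u}$-symmetric if it is $C_{\alpha,u,E}$-symmetric for every orthonormal basis $E$ of $H^2\ominus uH^2$. For $\lambda\in\mathbb{T}$, $C_{\lambda,u}$-symmetric means $C_{\alpha,u}$-symmetric for the geometric sequence $\alpha_m=\bar\lambda^m$, $m\ge0$. *)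

theory Defs
  imports "HOL-Complex_Analysis.Complex_Analysis" "HOL-Probability.Probability"
begin

section \<open>The Hilbert space \<open>L\<^sup>2\<close> of the unit circle\<close>

definition circle_measure :: "complex measure" where
  "circle_measure =
     distr (uniform_measure lborel {0..<2 * pi}) (restrict_space borel (sphere 0 1)) cis"

definition square_integrable :: "(complex \<Rightarrow> complex) \<Rightarrow> bool" where
  "square_integrable f \<longleftrightarrow>
     f \<in> borel_measurable circle_measure \<and> integrable circle_measure (\<lambda>z. (cmod (f z))\<^sup>2)"

definition L2_rel :: "(complex \<Rightarrow> complex) \<Rightarrow> (complex \<Rightarrow> complex) \<Rightarrow> bool" where
  "L2_rel f g \<longleftrightarrow>
     square_integrable f \<and> square_integrable g \<and> (AE z in circle_measure. f z = g z)"

lemma square_integrable_zero: "square_integrable (\<lambda>z. 0)"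
  by (simp add: square_integrable_def)

lemma square_integrable_add:
  assumes "square_integrable f" "square_integrable g"
  shows "square_integrable (\<lambda>z. f z + g z)"
proof -
  have m: "f \<in> borel_measurable circle_measure" "g \<in> borel_measurable circle_measure"
    and i: "integrable circle_measure (\<lambda>z. 2 * (cmod (f z))\<^sup>2 + 2 * (cmod (g z))\<^sup>2)"
    using assms by (auto simp: square_integrable_def)
  have "(cmod (f z + g z))\<^sup>2 \<le> 2 * (cmod (f z))\<^sup>2 + 2 * (cmod (g z))\<^sup>2" for z
  proof -
    have "(cmod (f z + g z))\<^sup>2 \<le> (cmod (f z) + cmod (g z))\<^sup>2"
      by (intro power_mono norm_triangle_ineq) auto
    also have "\<dots> \<le> 2 * (cmod (f z))\<^sup>2 + 2 * (cmod (g z))\<^sup>2"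
      using sum_squares_bound[of "cmod (f z)" "cmod (g z)"] by (simp add: power2_sum)
    finally show ?thesis .
  qed
  then have "integrable circle_measure (\<lambda>z. (cmod (f z + g z))\<^sup>2)"
    using m by (intro Bochner_Integration.integrable_bound[OF i]) auto
  with m show ?thesis by (simp add: square_integrable_def)
qed

lemma square_integrable_cmult:
  assumes "square_integrable f"
  shows "square_integrable (\<lambda>z. c * f z)"
  using assms by (auto simp: square_integrable_def norm_mult power_mult_distrib)

lemma integrable_mult_cnj:
  assumes "square_integrable f" "square_integrable g"
  shows "integrable circle_measure (\<lambda>z. f z * cnj (g z))"
proof -
  have m: "f \<in> borel_measurable circle_measure" "g \<in> borel_measurable circle_measure"
    and i: "integrable circle_measure (\<lambda>z. (cmod (f z))\<^sup>2 + (cmod (g z))\<^sup>2)"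
    using assms by (auto simp: square_integrable_def)
  have "(\<lambda>z. cnj (g z)) \<in> borel_measurable circle_measure"
    using m(2) by (rule measurable_compose) (intro borel_measurable_continuous_onI continuous_intros)
  moreover have "cmod (f z * cnj (g z)) \<le> (cmod (f z))\<^sup>2 + (cmod (g z))\<^sup>2" for z
  proof -
    have "0 \<le> cmod (f z) * cmod (g z)"
      by simp
    then show ?thesis
      using sum_squares_bound[of "cmod (f z)" "cmod (g z)"] by (simp only: norm_mult complex_mod_cnj)
  qed
  ultimately show ?thesis
    using m by (intro Bochner_Integration.integrable_bound[OF i]) auto
qed

quotient_type L2 = "complex \<Rightarrow> complex" / partial: L2_rel
  morphisms fun_of L2_of
proof (rule part_equivpI)
  show "\<exists>f. L2_rel f f"
    using square_integrable_zero by (auto simp: L2_rel_def)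
  show "symp L2_rel"
    by (auto simp: symp_def L2_rel_def)
  show "transp L2_rel"
    unfolding transp_def L2_rel_def by (auto elim: AE_mp)
qed

lift_definition cscale :: "complex \<Rightarrow> L2 \<Rightarrow> L2" (infixr "*\<^sub>C" 75)
  is "\<lambda>c f z. c * f z"
  by (auto simp: L2_rel_def square_integrable_cmult)

lift_definition cinner :: "L2 \<Rightarrow> L2 \<Rightarrow> complex"
  is "\<lambda>f g. integral\<^sup>L circle_measure (\<lambda>z. f z * cnj (g z))"
  unfolding L2_rel_def
  by (intro integral_cong_AE borel_measurable_integrable integrable_mult_cnj) auto

instantiation L2 :: ab_group_add
begin

lift_definition zero_L2 :: L2 is "\<lambda>z. 0"
  by (simp add: L2_rel_def square_integrable_zero)

lift_definition plus_L2 :: "L2 \<Rightarrow> L2 \<Rightarrow> L2" is "\<lambda>f g z. f z + g z"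
  by (auto simp: L2_rel_def square_integrable_add)

lift_definition uminus_L2 :: "L2 \<Rightarrow> L2" is "\<lambda>f z. - f z"
  using square_integrable_cmult[of _ "-1"] by (auto simp: L2_rel_def)

definition minus_L2 :: "L2 \<Rightarrow> L2 \<Rightarrow> L2" where "f - g = f + - g" for f g :: L2

instance
proof
  fix f g h :: L2
  show "f + g + h = f + (g + h)"
    by transfer (auto simp: L2_rel_def square_integrable_add add.assoc)
  show "f + g = g + f"
    by transfer (auto simp: L2_rel_def square_integrable_add add.commute)
  show "0 + f = f"
    by transfer (auto simp: L2_rel_def)
  show "- f + f = 0"
    by transfer (auto simp: L2_rel_def square_integrable_zero)
  show "f - g = f + - g"
    by (rule minus_L2_def)
qed

end

interpretation L2: vector_space cscale
proof
  fix a b :: complex and f g :: L2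
  show "a *\<^sub>C (f + g) = a *\<^sub>C f + a *\<^sub>C g"
    by transfer (auto simp: L2_rel_def distrib_left intro!: square_integrable_add square_integrable_cmult)
  show "(a + b) *\<^sub>C f = a *\<^sub>C f + b *\<^sub>C f"
    by transfer (auto simp: L2_rel_def distrib_right intro!: square_integrable_add square_integrable_cmult)
  show "a *\<^sub>C b *\<^sub>C f = (a * b) *\<^sub>C f"
    by transfer (auto simp: L2_rel_def mult.assoc intro!: square_integrable_cmult)
  show "1 *\<^sub>C f = f"
    by transfer (auto simp: L2_rel_def)
qed

lemma cinner_commute: "cinner f g = cnj (cinner g f)"
  by transfer (simp only: Bochner_Integration.integral_cnj[symmetric] complex_cnj_mult complex_cnj_cnj mult.commute)

lemma cinner_add_left: "cinner (f + g) h = cinner f h + cinner g h"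
  by transfer (simp add: L2_rel_def distrib_right integrable_mult_cnj)

lemma cinner_cscale_left: "cinner (c *\<^sub>C f) g = c * cinner f g"
  by transfer (simp add: L2_rel_def mult.assoc)

lemma cinner_self:
  shows "Re (cinner f f) \<ge> 0" and "Re (cinner f f) = 0 \<longleftrightarrow> f = 0"
proof -
  have *: "Re (integral\<^sup>L circle_measure (\<lambda>z. f z * cnj (f z))) =
      integral\<^sup>L circle_measure (\<lambda>z. (cmod (f z))\<^sup>2)" for f :: "complex \<Rightarrow> complex"
    by (simp only: complex_norm_square[symmetric] integral_complex_of_real Re_complex_of_real)
  show "Re (cinner f f) \<ge> 0"
    by transfer (simp add: *)
  show "Re (cinner f f) = 0 \<longleftrightarrow> f = 0"
    by transfer
      (simp add: * L2_rel_def square_integrable_zero integral_nonneg_eq_0_iff_AE,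
       auto simp: square_integrable_def integral_nonneg_eq_0_iff_AE)
qed

instantiation L2 :: real_vector
begin

definition scaleR_L2 :: "real \<Rightarrow> L2 \<Rightarrow> L2" where "r *\<^sub>R f = complex_of_real r *\<^sub>C f"

instance
  by standard (simp_all add: scaleR_L2_def L2.scale_right_distrib L2.scale_left_distrib)

end

instantiation L2 :: real_inner
begin

definition inner_L2 :: "L2 \<Rightarrow> L2 \<Rightarrow> real" where "f \<bullet> g = Re (cinner f g)"
definition norm_L2 :: "L2 \<Rightarrow> real" where "norm f = sqrt (f \<bullet> f)" for f :: L2
definition sgn_L2 :: "L2 \<Rightarrow> L2" where "sgn f = f /\<^sub>R norm f" for f :: L2
definition dist_L2 :: "L2 \<Rightarrow> L2 \<Rightarrow> real" where "dist f g = norm (f - g)" for f g :: L2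
definition uniformity_L2 :: "(L2 \<times> L2) filter" where
  "uniformity_L2 = (INF e\<in>{0<..}. principal {(f, g). dist f g < e})"
definition open_L2 :: "L2 set \<Rightarrow> bool" where
  "open_L2 U \<longleftrightarrow> (\<forall>f\<in>U. \<forall>\<^sub>F (f', g) in uniformity. f' = f \<longrightarrow> g \<in> U)"

instance
proof
  fix r :: real and f g h :: L2 and U :: "L2 set"
  show "dist f g = norm (f - g)" by (rule dist_L2_def)
  show "sgn f = f /\<^sub>R norm f" by (rule sgn_L2_def)
  show "uniformity = (INF e\<in>{0<..}. principal {(f :: L2, g). dist f g < e})"
    by (rule uniformity_L2_def)
  show "open U \<longleftrightarrow> (\<forall>f\<in>U. \<forall>\<^sub>F (f', g) in uniformity. f' = f \<longrightarrow> g \<in> U)"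
    by (rule open_L2_def)
  show "f \<bullet> g = g \<bullet> f"
    by (subst (2) inner_L2_def, subst cinner_commute) (simp add: inner_L2_def)
  show "(f + g) \<bullet> h = f \<bullet> h + g \<bullet> h"
    by (simp add: inner_L2_def cinner_add_left)
  show "(r *\<^sub>R f) \<bullet> g = r * (f \<bullet> g)"
    by (simp add: inner_L2_def scaleR_L2_def cinner_cscale_left)
  show "0 \<le> f \<bullet> f" "f \<bullet> f = 0 \<longleftrightarrow> f = 0"
    by (simp_all add: inner_L2_def cinner_self)
  show "norm f = sqrt (f \<bullet> f)" by (rule norm_L2_def)
qed

end


section \<open>Hardy spaces and inner functions\<close>

text \<open>
  The boundary function of an analytic function \<open>F\<close> on the disc is the limit in \<open>L\<^sup>2\<close> of its
  dilates \<open>z \<mapsto> F (r z)\<close> as \<open>r\<close> increases to 1. It exists for \<open>F\<close> in the Hardy space, and by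
  Fatou's theorem it agrees almost everywhere with the radial limit of \<open>F\<close>.
\<close>

definition boundary :: "(complex \<Rightarrow> complex) \<Rightarrow> L2" where
  "boundary F = Lim (at_left (1 :: real)) (\<lambda>r. L2_of (\<lambda>z. F (of_real r * z)))"

definition hardy_disc :: "(complex \<Rightarrow> complex) set" where
  "hardy_disc = {F. F holomorphic_on ball 0 1 \<and>
     bdd_above ((\<lambda>r. LINT z|circle_measure. (cmod (F (of_real r * z)))\<^sup>2) ` {0..<1})}"

definition H2 :: "L2 set" where
  "H2 = boundary ` hardy_disc"

definition bounded_analytic :: "(complex \<Rightarrow> complex) \<Rightarrow> bool" where
  "bounded_analytic u \<longleftrightarrow> u holomorphic_on ball 0 1 \<and> bounded (u ` ball 0 1)"

definition inner_function :: "(complex \<Rightarrow> complex) \<Rightarrow> bool" where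
  "inner_function u \<longleftrightarrow>
     bounded_analytic u \<and> (AE z in circle_measure. cmod (fun_of (boundary u) z) = 1)"

definition essentially_bounded :: "(complex \<Rightarrow> complex) \<Rightarrow> bool" where
  "essentially_bounded \<phi> \<longleftrightarrow>
     \<phi> \<in> borel_measurable circle_measure \<and> (\<exists>M. AE z in circle_measure. cmod (\<phi> z) \<le> M)"


section \<open>Toeplitz operators\<close>

definition mult_op :: "(complex \<Rightarrow> complex) \<Rightarrow> L2 \<Rightarrow> L2" where
  "mult_op \<phi> f = L2_of (\<lambda>z. \<phi> z * fun_of f z)"

definition hardy_projection :: "L2 \<Rightarrow> L2" where
  "hardy_projection f = (THE g. g \<in> H2 \<and> (\<forall>h\<in>H2. cinner (f - g) h = 0))"

definition toeplitz :: "(complex \<Rightarrow> complex) \<Rightarrow> L2 \<Rightarrow> L2" where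
  "toeplitz \<phi> f = hardy_projection (mult_op \<phi> f)"


section \<open>Conjugations and complex symmetry\<close>

text \<open>
  Operators on \<open>H\<^sup>2\<close> are represented by functions on all of \<open>L\<^sup>2\<close> whose values outside
  \<open>H\<^sup>2\<close> are irrelevant.
\<close>

definition adjoint_H2 :: "(L2 \<Rightarrow> L2) \<Rightarrow> L2 \<Rightarrow> L2" where
  "adjoint_H2 T g = (THE k. k \<in> H2 \<and> (\<forall>f\<in>H2. cinner (T f) g = cinner f k))"

definition symmetric_wrt :: "(L2 \<Rightarrow> L2) \<Rightarrow> (L2 \<Rightarrow> L2) \<Rightarrow> bool" where
  "symmetric_wrt C T \<longleftrightarrow> (\<forall>f\<in>H2. C (T (C f)) = adjoint_H2 T f)"

definition C_rot :: "complex \<Rightarrow> L2 \<Rightarrow> L2" where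
  "C_rot \<zeta> h = L2_of (\<lambda>z. cnj (fun_of h (\<zeta> * cnj z)))"

definition orthonormal_basis :: "L2 set \<Rightarrow> L2 set \<Rightarrow> bool" where
  "orthonormal_basis E S \<longleftrightarrow>
     (\<forall>e\<in>E. \<forall>e'\<in>E. cinner e e' = (if e = e' then 1 else 0)) \<and> closure (L2.span E) = S"

definition boundary_power :: "(complex \<Rightarrow> complex) \<Rightarrow> nat \<Rightarrow> L2 \<Rightarrow> L2" where
  "boundary_power u m = mult_op (\<lambda>z. fun_of (boundary u) z ^ m)"

definition model_space :: "(complex \<Rightarrow> complex) \<Rightarrow> L2 set" where
  "model_space u = {f \<in> H2. \<forall>g\<in>H2. cinner f (boundary_power u 1 g) = 0}"

text \<open>
  For an orthonormal basis \<open>E\<close> of the model space, the vectors \<open>u\<^sup>m e\<close> form an orthonormal basis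
  of \<open>H\<^sup>2\<close>, so every \<open>h\<close> in \<open>H\<^sup>2\<close> has exactly one coefficient family \<open>\<mu>\<close> (on \<open>UNIV \<times> E\<close>)
  and the description below determines one \<open>g\<close>.
\<close>

definition C_basis :: "(nat \<Rightarrow> complex) \<Rightarrow> (complex \<Rightarrow> complex) \<Rightarrow> L2 set \<Rightarrow> L2 \<Rightarrow> L2" where
  "C_basis \<alpha> u E h = (THE g. \<exists>\<mu>.
     ((\<lambda>(m, e). \<mu> m e *\<^sub>C boundary_power u m e) has_sum h) (UNIV \<times> E) \<and>
     ((\<lambda>(m, e). (cnj (\<mu> m e) * \<alpha> m) *\<^sub>C boundary_power u m e) has_sum g) (UNIV \<times> E))"

definition C_symmetric ::
    "(nat \<Rightarrow> complex) \<Rightarrow> (complex \<Rightarrow> complex) \<Rightarrow> (L2 \<Rightarrow> L2) \<Rightarrow> bool" where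
  "C_symmetric \<alpha> u T \<longleftrightarrow>
     (\<forall>E. orthonormal_basis E (model_space u) \<longrightarrow> symmetric_wrt (C_basis \<alpha> u E) T)"

definition C_geometric_symmetric ::
    "complex \<Rightarrow> (complex \<Rightarrow> complex) \<Rightarrow> (L2 \<Rightarrow> L2) \<Rightarrow> bool" where
  "C_geometric_symmetric \<zeta> u = C_symmetric (\<lambda>m. cnj \<zeta> ^ m) u"

text \<open>
  The composition \<open>f \<circ> u\<close> as a function on the circle. Since the boundary map of a
  nonconstant inner function pulls null sets back to null sets, changing the representatives
  of \<open>f\<close> and of the boundary function of \<open>u\<close> changes it only on a null set.
\<close>

definition comp_boundary :: "L2 \<Rightarrow> (complex \<Rightarrow> complex) \<Rightarrow> complex \<Rightarrow> complex" where
  "comp_boundary f u z = fun_of f (fun_of (boundary u) z)"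

end

theory Submission
  imports Defs
begin

text \<open>
  Fix a nonconstant inner function \<open>u\<close> and the model space \<open>K = H\<^sup>2 \<ominus> u H\<^sup>2\<close>. Since
  \<open>H\<^sup>2\<close> is the orthogonal sum of the spaces \<open>u\<^sup>m K\<close>, an operator on \<open>H\<^sup>2\<close> is described by
  the numbers \<open>\<langle>T u\<^sup>m e, u\<^sup>n e'\<rangle>\<close> with \<open>e\<close>, \<open>e'\<close> in an orthonormal basis \<open>E\<close> of \<open>K\<close>, and
  symmetry under the conjugation given by \<open>\<alpha>\<close> and \<open>E\<close> becomes the identity
  \<open>\<alpha>\<^sub>m cnj \<alpha>\<^sub>n \<langle>T u\<^sup>m e, u\<^sup>n e'\<rangle> = \<langle>T u\<^sup>n e', u\<^sup>m e\<rangle>\<close> (\<open>symmetric_wrt_C_basis_iff\<close>).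

  Everything rests on one change of variables. For \<open>e\<close> in \<open>K\<close> the integrals of
  \<open>u\<^sup>k \<bar>e\<bar>\<^sup>2\<close> with \<open>k \<ge> 1\<close> vanish, because \<open>e\<close> is orthogonal to \<open>u\<^sup>k e\<close>; as a measure on the
  circle is determined by these moments and its mass, \<open>u\<close> transports \<open>\<bar>e\<bar>\<^sup>2 \<sigma>\<close> to \<open>\<parallel>e\<parallel>\<^sup>2 \<sigma>\<close>
  (\<open>pushforward_measure\<close>). Hence, if \<open>\<phi> = h \<circ> u\<close>, then \<open>\<langle>T\<^sub>\<phi> u\<^sup>m e, u\<^sup>n e'\<rangle>\<close> equals
  \<open>c\<^bsub>n-m\<^esub> \<langle>e, e'\<rangle>\<close>, where the \<open>c\<^sub>k\<close> are the Fourier coefficients of \<open>h\<close>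
  (\<open>cinner_mult_op_composition\<close>). For \<open>h = f + cnj (C\<^sub>\<zeta> f)\<close> these coefficients satisfy
  \<open>c\<^bsub>-k\<^esub> = \<zeta>\<^sup>k c\<^sub>k\<close>, which is exactly the criterion for \<open>\<alpha>\<^sub>m = cnj \<zeta>\<^sup>m\<close>. This is the
  implication from (c) to (b), and (b) is a special case of (a).

  For the implication from (a) to (c), the zero \<open>a\<close> of \<open>u\<close> puts the Szego kernel
  \<open>1 / (1 - cnj a z)\<close> into \<open>K\<close>. Let \<open>e\<close> be its multiple of norm one. Comparing a basis that
  contains \<open>e\<close> with the basis in which \<open>e\<close> is replaced by \<open>\<i> e\<close>, the criterion shows that
  \<open>T\<^sub>\<phi> e\<close> and the adjoint image of \<open>e\<close> involve only the vectors \<open>u\<^sup>n e\<close>. So they have the form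
  \<open>(G \<circ> u) e\<close> and \<open>(F \<circ> u) e\<close> with \<open>F\<close> and \<open>G\<close> in \<open>H\<^sup>2\<close>. Division by \<open>e\<close>, that is,
  multiplication by a polynomial of degree at most one, shows that \<open>\<phi> - G \<circ> u\<close> and
  \<open>cnj \<phi> - F \<circ> u\<close> have no Fourier coefficients of positive index
  (\<open>symbol_minus_composition_coanalytic\<close>). Therefore \<open>\<phi> - G \<circ> u - cnj (F \<circ> u)\<close> is constant and
  \<open>\<phi> = h \<circ> u\<close> with \<open>h\<close> in \<open>L\<^sup>2\<close> (\<open>symbol_is_composition\<close>). The criterion now says
  \<open>c\<^sub>k = \<alpha>\<^bsub>n+k\<^esub> cnj \<alpha>\<^sub>n c\<^bsub>-k\<^esub>\<close> for all \<open>n\<close>. Each \<open>k\<close> with \<open>c\<^sub>k \<noteq> 0\<close> is thus a period of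
  \<open>\<alpha>\<close> up to a factor; all such periods are multiples of the smallest one, and a root of its
  factor supplies \<open>\<zeta>\<close> (\<open>geometric_symmetry\<close>).

  The analysis behind this is the completeness of \<open>L\<^sup>2\<close>, the identification of \<open>H\<^sup>2\<close> with the
  functions whose Fourier coefficients of negative index vanish (\<open>H2_eq_analytic\<close>), and the
  decomposition of \<open>H\<^sup>2\<close> into the spaces \<open>u\<^sup>m K\<close> (\<open>orthonormal_basis_Upow\<close>).
\<close>


section \<open>Measures on the circle are determined by their moments\<close>

abbreviation (input) sigma :: "complex measure" (\<open>\<sigma>\<close>) where "\<sigma> \<equiv> circle_measure"

lemma sets_circle_measure: "sets \<sigma> = sets (restrict_space borel (sphere 0 1))"
  by (simp add: circle_measure_def)

lemma space_circle_measure [simp]: "space \<sigma> = sphere 0 1"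
  by (simp add: circle_measure_def space_restrict_space)

lemma cis_measurable_circle:
  "cis \<in> uniform_measure lborel {0..<2 * pi} \<rightarrow>\<^sub>M restrict_space borel (sphere 0 1)"
proof (rule measurable_restrict_space2)
  have "cis \<in> borel \<rightarrow>\<^sub>M borel"
    by (intro borel_measurable_continuous_onI continuous_intros)
  then show "cis \<in> uniform_measure lborel {0..<2 * pi} \<rightarrow>\<^sub>M borel"
    by (simp add: measurable_def)
qed auto

interpretation circle: prob_space \<sigma>
  unfolding circle_measure_def
  by (intro prob_space.prob_space_distr prob_space_uniform_measure cis_measurable_circle) auto

lemma continuous_circle_measurable:
  fixes f :: "complex \<Rightarrow> 'a::topological_space"
  assumes "continuous_on (sphere 0 1) f"
  shows "f \<in> borel_measurable \<sigma>"
  using borel_measurable_continuous_on_restrict[OF assms]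
  by (simp add: measurable_cong_sets[OF sets_circle_measure refl])

lemma integral_circle_power:
  "(LINT z|\<sigma>. z ^ n) = (if n = 0 then 1 else 0)"
proof (cases "n = 0")
  case True
  then show ?thesis using circle.prob_space by simp
next
  case False
  have meas: "(\<lambda>z::complex. z ^ n) \<in> borel_measurable (restrict_space borel (sphere 0 1))"
    by (intro borel_measurable_continuous_on_restrict continuous_intros)
  have "(LINT z|\<sigma>. z ^ n)
      = integral\<^sup>L (uniform_measure lborel {0..<2 * pi}) (\<lambda>t. cis t ^ n)"
    unfolding circle_measure_def by (rule integral_distr[OF cis_measurable_circle meas])
  also have "\<dots> = (\<integral>t. (indicator {0..<2 * pi} t / (2 * pi)) *\<^sub>R cis t ^ n \<partial>lborel)"
  proof -
    have "uniform_measure lborel {0..<2 * pi}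
        = density lborel (\<lambda>t. ennreal (indicator {0..<2 * pi} t / (2 * pi)))"
      unfolding uniform_measure_def
      by (rule arg_cong[where f = "density lborel"])
         (auto simp: fun_eq_iff indicator_def simp flip: divide_ennreal)
    moreover have "(\<lambda>t. cis t ^ n) \<in> borel_measurable lborel"
      by (simp, intro borel_measurable_continuous_onI continuous_intros)
    ultimately show ?thesis
      by (simp add: integral_density)
  qed
  also have "\<dots> = (\<integral>t. indicator {0..2 * pi} t *\<^sub>R (cis t ^ n /\<^sub>R (2 * pi)) \<partial>lborel)"
  proof (rule integral_cong_AE)
    show "AE t in lborel. (indicator {0..<2 * pi} t / (2 * pi)) *\<^sub>R cis t ^ n
        = indicator {0..2 * pi} t *\<^sub>R (cis t ^ n /\<^sub>R (2 * pi))"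
      using AE_lborel_singleton[of "2 * pi"]
    proof eventually_elim
      case (elim t)
      then have "t \<in> {0..<2 * pi} \<longleftrightarrow> t \<in> {0..2 * pi}" by auto
      then have "indicator {0..<2 * pi} t = (indicator {0..2 * pi} t :: real)" by (simp only: indicator_def)
      then show ?case by (simp only: divide_inverse scaleR_scaleR)
    qed
    have "continuous_on UNIV (\<lambda>t. cis t ^ n)"
      by (rule continuous_on_power, rule continuous_on_cis, rule continuous_on_id)
    then have [measurable]: "(\<lambda>t. cis t ^ n) \<in> borel_measurable borel"
      by (rule borel_measurable_continuous_onI)
    show "(\<lambda>t. (indicator {0..<2 * pi} t / (2 * pi)) *\<^sub>R cis t ^ n) \<in> borel_measurable lborel"
        "(\<lambda>t. indicator {0..2 * pi} t *\<^sub>R (cis t ^ n /\<^sub>R (2 * pi))) \<in> borel_measurable lborel"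
      by measurable
  qed
  also have "\<dots> = cis (n * (2 * pi)) / (\<i> * n * (2 * pi)) - cis (real n * 0) / (\<i> * n * (2 * pi))"
  proof (rule integral_FTC_Icc[where F = "\<lambda>t. cis (real n * t) / (\<i> * n * (2 * pi))"])
    fix x :: real
    define c where "c = \<i> * of_nat n"
    have "c \<noteq> 0" using False by (simp add: c_def)
    have "((\<lambda>w. exp (c * w) / (c * of_real (2 * pi))) has_field_derivative
        (exp (c * of_real x) * c) / (c * of_real (2 * pi))) (at (of_real x))"
      by (rule DERIV_cdivide) (auto intro!: derivative_eq_intros)
    then have "((\<lambda>t. exp (c * of_real t) / (c * of_real (2 * pi))) has_vector_derivative
        (exp (c * of_real x) * c) / (c * of_real (2 * pi))) (at x within {0..2 * pi})"
      by (rule has_vector_derivative_real_field)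
    moreover have exp_eq: "exp (c * of_real t) = cis (real n * t)" for t :: real
      by (simp add: cis_conv_exp c_def mult.assoc)
    moreover have "exp (c * of_real x) * c / (c * of_real (2 * pi)) = cis x ^ n /\<^sub>R (2 * pi)"
      using \<open>c \<noteq> 0\<close> by (simp add: exp_eq Complex.DeMoivre scaleR_conv_of_real field_simps)
    ultimately show "((\<lambda>t. cis (n * t) / (\<i> * n * (2 * pi))) has_vector_derivative cis x ^ n /\<^sub>R (2 * pi))
        (at x within {0..2 * pi})"
      by (simp only: exp_eq c_def[symmetric])
  next
    show "continuous_on {0..2 * pi} (\<lambda>t. cis t ^ n /\<^sub>R (2 * pi))"
      by (rule continuous_on_scaleR, rule continuous_on_const, rule continuous_on_power,
          rule continuous_on_cis, rule continuous_on_id)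
  qed simp
  also have "\<dots> = 0"
    using cis_multiple_2pi[of n] by (simp add: mult.commute)
  finally show ?thesis using False by simp
qed

text \<open>
  On the circle \<open>cnj z\<close> is the inverse of \<open>z\<close>, so collecting all negative powers into one factor
  \<open>cnj z ^ N\<close> leaves an ordinary polynomial; in this form sums and products are easy to exhibit.
\<close>

definition trig_polynomial_on_circle :: "(complex \<Rightarrow> complex) \<Rightarrow> bool" where
  "trig_polynomial_on_circle f \<longleftrightarrow> (\<exists>N p. \<forall>z\<in>sphere 0 1. f z = cnj z ^ N * poly p z)"

lemma trig_polynomial_add:
  assumes "trig_polynomial_on_circle f" "trig_polynomial_on_circle g"
  shows "trig_polynomial_on_circle (\<lambda>z. f z + g z)"
proof -
  obtain M p N q where f: "\<And>z. z \<in> sphere 0 1 \<Longrightarrow> f z = cnj z ^ M * poly p z"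
    and g: "\<And>z. z \<in> sphere 0 1 \<Longrightarrow> g z = cnj z ^ N * poly q z"
    using assms unfolding trig_polynomial_on_circle_def by metis
  have "f z + g z = cnj z ^ (M + N) * poly (monom 1 N * p + monom 1 M * q) z"
    if z: "z \<in> sphere 0 1" for z
  proof -
    have 1: "cnj z * z = 1" using z by (simp add: complex_norm_square[symmetric] mult.commute)
    have pow: "cnj z ^ k * z ^ k = 1" for k
      using 1 power_mult_distrib[of "cnj z" z k] by simp
    have "cnj z ^ (M + N) * (z ^ N * poly p z + z ^ M * poly q z)
      = cnj z ^ M * poly p z * (cnj z ^ N * z ^ N) + cnj z ^ N * poly q z * (cnj z ^ M * z ^ M)"
      by (simp only: power_add algebra_simps)
    then have "cnj z ^ (M + N) * (z ^ N * poly p z + z ^ M * poly q z)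
      = cnj z ^ M * poly p z + cnj z ^ N * poly q z"
      by (simp only: pow mult_1_right)
    then show ?thesis by (simp add: f[OF z] g[OF z] poly_monom)
  qed
  then show ?thesis unfolding trig_polynomial_on_circle_def by blast
qed

lemma trig_polynomial_mult:
  assumes "trig_polynomial_on_circle f" "trig_polynomial_on_circle g"
  shows "trig_polynomial_on_circle (\<lambda>z. f z * g z)"
proof -
  obtain M p N q where f: "\<And>z. z \<in> sphere 0 1 \<Longrightarrow> f z = cnj z ^ M * poly p z"
    and g: "\<And>z. z \<in> sphere 0 1 \<Longrightarrow> g z = cnj z ^ N * poly q z"
    using assms unfolding trig_polynomial_on_circle_def by metis
  have "f z * g z = cnj z ^ (M + N) * poly (p * q) z" if z: "z \<in> sphere 0 1" for z
    by (simp add: f[OF z] g[OF z] power_add)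
  then show ?thesis unfolding trig_polynomial_on_circle_def by blast
qed

text \<open>
  The Stone-Weierstrass theorem of the library approximates by polynomials in the real and the
  imaginary part. On the circle these are trigonometric polynomials, because the real and the
  imaginary part are combinations of \<open>z\<close> and \<open>cnj z\<close>.
\<close>

lemma trig_polynomial_of_real_polynomial_function:
  fixes g :: "complex \<Rightarrow> real"
  assumes "real_polynomial_function g"
  shows "trig_polynomial_on_circle (\<lambda>z. of_real (g z))"
  using assms
proof (induction rule: real_polynomial_function.induct)
  case (linear f)
  interpret bounded_linear f by fact
  have f: "complex_of_real (f z)
      = cnj z ^ 1 * poly [:of_real (f 1) / 2 + \<i> * of_real (f \<i>) / 2, 0, of_real (f 1) / 2 - \<i> * of_real (f \<i>) / 2:] z"
    if z: "z \<in> sphere 0 1" for z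
  proof -
    have 1: "cnj z * (z * z) = z"
      using z by (metis complex_norm_square mem_sphere_0 mult.assoc mult.commute mult_1 of_real_1 power_one)
    have "z = Re z *\<^sub>R 1 + Im z *\<^sub>R \<i>"
      by (simp add: complex_eq_iff)
    then have "f z = f (Re z *\<^sub>R 1 + Im z *\<^sub>R \<i>)" by simp
    then have "f z = Re z * f 1 + Im z * f \<i>" by (simp only: add scale) simp
    moreover have "complex_of_real (Re z) = (z + cnj z) / 2" "complex_of_real (Im z) = - \<i> * (z - cnj z) / 2"
      by (simp_all add: complex_eq_iff)
    ultimately have "complex_of_real (f z) = of_real (f 1) * ((z + cnj z) / 2) + of_real (f \<i>) * (- \<i> * (z - cnj z) / 2)"
      by (simp only: of_real_add of_real_mult mult.commute)
    also have "\<dots> = (of_real (f 1) / 2 + \<i> * of_real (f \<i>) / 2) * cnj z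
        + (of_real (f 1) / 2 - \<i> * of_real (f \<i>) / 2) * (cnj z * (z * z))"
      unfolding 1 by (simp add: field_simps)
    finally show ?thesis by (simp add: field_simps)
  qed
  then show ?case unfolding trig_polynomial_on_circle_def by blast
next
  case (const c)
  have "\<forall>z\<in>sphere 0 1. complex_of_real c = cnj z ^ 0 * poly [:of_real c:] z" by simp
  then show ?case unfolding trig_polynomial_on_circle_def by blast
qed (auto intro: trig_polynomial_add trig_polynomial_mult)

text \<open>
  Only the moments of nonnegative index have to agree: the others are their conjugates, since the
  measures are real.
\<close>

lemma integral_trig_polynomial_eqI:
  assumes M: "finite_measure M" "sets M = sets \<sigma>"
    and N: "finite_measure N" "sets N = sets \<sigma>"
    and moments: "\<And>n::nat. integral\<^sup>L M (\<lambda>z. z ^ n) = integral\<^sup>L N (\<lambda>z. z ^ n)"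
    and f: "trig_polynomial_on_circle f"
  shows "integral\<^sup>L M f = integral\<^sup>L N f"
proof -
  obtain K p where p: "\<And>z. z \<in> sphere 0 1 \<Longrightarrow> f z = cnj z ^ K * poly p z"
    using f unfolding trig_polynomial_on_circle_def by metis
  \<comment> \<open>On the circle, \<open>h i\<close> is \<open>z\<close> to the power
    \<open>i - K\<close>, which may be negative.\<close>
  define h where "h = (\<lambda>i (z::complex). if K \<le> i then z ^ (i - K) else cnj (z ^ (K - i)))"
  have f_eq: "f z = (\<Sum>i\<le>degree p. coeff p i * h i z)" if z: "z \<in> sphere 0 1" for z
  proof -
    have 1: "cnj z * z = 1" using z by (simp add: complex_norm_square[symmetric] mult.commute)
    have "cnj z ^ K * z ^ i = h i z" for i
    proof (cases "K \<le> i")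
      case True
      then have "cnj z ^ K * z ^ i = (cnj z * z) ^ K * z ^ (i - K)"
        by (simp add: power_mult_distrib mult.assoc flip: power_add)
      then show ?thesis using True by (simp add: h_def 1)
    next
      case False
      then have "cnj z ^ K * z ^ i = (cnj z * z) ^ i * cnj z ^ (K - i)"
        by (simp add: power_mult_distrib mult.assoc mult.left_commute flip: power_add)
      then show ?thesis using False by (simp add: h_def 1)
    qed
    then have "cnj z ^ K * poly p z = (\<Sum>i\<le>degree p. coeff p i * h i z)"
      by (simp add: poly_altdef sum_distrib_left mult.left_commute)
    then show ?thesis by (simp add: p[OF z])
  qed
  have integral_f: "integral\<^sup>L L f = (\<Sum>i\<le>degree p. coeff p i * integral\<^sup>L L (h i))"
    if L: "finite_measure L" "sets L = sets \<sigma>" for L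
  proof -
    interpret finite_measure L by fact
    have space: "space L = sphere 0 1" using sets_eq_imp_space_eq[OF L(2)] by simp
    have meas: "h i \<in> borel_measurable L" for i
      unfolding measurable_cong_sets[OF L(2) refl]
      by (rule continuous_circle_measurable, cases "K \<le> i") (auto simp: h_def intro!: continuous_intros)
    have "integrable L (h i)" for i
      using meas by (intro integrable_const_bound[of _ 1]) (auto simp: space h_def norm_power)
    then have "integral\<^sup>L L (\<lambda>z. \<Sum>i\<le>degree p. coeff p i * h i z) = (\<Sum>i\<le>degree p. coeff p i * integral\<^sup>L L (h i))"
      by (subst Bochner_Integration.integral_sum) auto
    moreover have "integral\<^sup>L L f = integral\<^sup>L L (\<lambda>z. \<Sum>i\<le>degree p. coeff p i * h i z)"
      by (rule Bochner_Integration.integral_cong) (auto simp: space f_eq)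
    ultimately show ?thesis by simp
  qed
  have "integral\<^sup>L M (h i) = integral\<^sup>L N (h i)" for i
  proof (cases "K \<le> i")
    case False
    then show ?thesis
      unfolding h_def by (simp only: if_False Bochner_Integration.integral_cnj moments)
  qed (simp add: h_def moments)
  then show ?thesis using integral_f[OF M] integral_f[OF N] by simp
qed

lemma integral_continuous_eqI:
  fixes f :: "complex \<Rightarrow> real"
  assumes M: "finite_measure M" "sets M = sets \<sigma>"
    and N: "finite_measure N" "sets N = sets \<sigma>"
    and moments: "\<And>n::nat. integral\<^sup>L M (\<lambda>z. z ^ n) = integral\<^sup>L N (\<lambda>z. z ^ n)"
    and f: "continuous_on (sphere 0 1) f"
  shows "integral\<^sup>L M f = integral\<^sup>L N f"
proof (rule ccontr)
  assume "integral\<^sup>L M f \<noteq> integral\<^sup>L N f"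
  define d where "d = \<bar>integral\<^sup>L M f - integral\<^sup>L N f\<bar>"
  \<comment> \<open>The summand 1 makes \<open>c\<close> positive and the final estimate strict.\<close>
  define c where "c = measure M (space M) + measure N (space N) + 1"
  have "d > 0" "c > 0" using \<open>_ \<noteq> _\<close> by (auto simp: d_def c_def add_nonneg_pos)
  obtain g where g: "real_polynomial_function g" and fg: "\<And>z. z \<in> sphere 0 1 \<Longrightarrow> \<bar>f z - g z\<bar> < d / c"
    using Stone_Weierstrass_real_polynomial_function[OF compact_sphere f, of "d / c"] \<open>d > 0\<close> \<open>c > 0\<close> by auto
  have g_cont: "continuous_on (sphere 0 1) g"
    using g by (intro continuous_on_polymonial_function) (simp add: real_polynomial_function_eq)
  have bound: "\<bar>integral\<^sup>L L f - integral\<^sup>L L g\<bar> \<le> d / c * measure L (space L) \<and>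
      integral\<^sup>L L (\<lambda>z. complex_of_real (g z)) = of_real (integral\<^sup>L L g)"
    if L: "finite_measure L" "sets L = sets \<sigma>" for L
  proof -
    interpret finite_measure L by fact
    have space: "space L = sphere 0 1" using sets_eq_imp_space_eq[OF L(2)] by simp
    have int: "integrable L h" if h: "continuous_on (sphere 0 1) h" for h :: "complex \<Rightarrow> real"
    proof -
      obtain B where "\<And>z. z \<in> sphere 0 1 \<Longrightarrow> norm (h z) \<le> B"
        using compact_imp_bounded[OF compact_continuous_image[OF h compact_sphere]]
        unfolding bounded_iff by blast
      then show ?thesis
        using continuous_circle_measurable[OF h]
        by (intro integrable_const_bound[of _ B]) (auto simp: space measurable_cong_sets[OF L(2) refl])
    qed
    have "\<bar>integral\<^sup>L L f - integral\<^sup>L L g\<bar> = \<bar>integral\<^sup>L L (\<lambda>z. f z - g z)\<bar>"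
      using int[OF f] int[OF g_cont] by simp
    also have "\<dots> \<le> integral\<^sup>L L (\<lambda>z. \<bar>f z - g z\<bar>)"
      by (rule integral_abs_bound)
    also have "\<dots> \<le> integral\<^sup>L L (\<lambda>z. d / c)"
      using int[OF f] int[OF g_cont] fg by (intro integral_mono) (auto simp: space less_imp_le)
    finally show ?thesis by (simp add: mult.commute)
  qed
  have "integral\<^sup>L M g = integral\<^sup>L N g"
    using integral_trig_polynomial_eqI[OF M N moments trig_polynomial_of_real_polynomial_function[OF g]]
      bound[OF M] bound[OF N] by simp
  then have "d \<le> d / c * measure M (space M) + d / c * measure N (space N)"
    using bound[OF M] bound[OF N] unfolding d_def by linarith
  also have "\<dots> = d / c * (c - 1)"
  proof -
    have "measure M (space M) + measure N (space N) = c - 1" by (simp add: c_def)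
    then show ?thesis by (simp only: flip: distrib_left)
  qed
  also have "\<dots> < d" using \<open>d > 0\<close> \<open>c > 0\<close> by (simp add: field_simps)
  finally show False by simp
qed

text \<open>
  Equal moments give equal integrals of continuous functions, and indicators of closed sets are
  pointwise limits of bounded continuous functions. The closed sets generate the Borel sets and
  are stable under intersection.
\<close>

lemma measure_eq_if_moments_eq:
  assumes M: "finite_measure M" "sets M = sets \<sigma>"
    and N: "finite_measure N" "sets N = sets \<sigma>"
    and moments: "\<And>n::nat. integral\<^sup>L M (\<lambda>z. z ^ n) = integral\<^sup>L N (\<lambda>z. z ^ n)"
  shows "M = N"
proof -
  have borel_eq: "distr M borel id = distr N borel id"
  proof (rule measure_eqI_generator_eq[of "Collect closed" UNIV _ _ "\<lambda>_. UNIV"])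
    show "Int_stable (Collect closed :: complex set set)" by (auto simp: Int_stable_def)
    fix F :: "complex set" assume "F \<in> Collect closed"
    then have F: "closed F" by simp
    have eq: "measure M (F \<inter> sphere 0 1) = measure N (F \<inter> sphere 0 1)"
    proof (cases "F = {}")
      case False
      \<comment> \<open>A continuous function that is 1 on \<open>F\<close> and 0 at distance at
        least \<open>1 / n\<close> from \<open>F\<close>.\<close>
      define h where "h n z = max 0 (1 - real n * infdist z F)" for n z
      have h_cont: "continuous_on (sphere 0 1) (h n)" for n
        unfolding h_def by (intro continuous_intros)
      have h_lim: "(\<lambda>n. h n z) \<longlonglongrightarrow> indicator F z" for z
      proof (cases "z \<in> F")
        case True
        then show ?thesis by (simp add: h_def)
      next
        case False
        then have pos: "infdist z F > 0"
          using \<open>F \<noteq> {}\<close> F infdist_nonneg[of z F] in_closed_iff_infdist_zero[of F z] by force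
        obtain n0 where n0: "real n0 * infdist z F > 1"
          using reals_Archimedean3[OF pos] by blast
        have "h n z = 0" if "n \<ge> n0" for n
        proof -
          have "real n0 * infdist z F \<le> real n * infdist z F" using that pos by (simp add: mult_right_mono)
          then show ?thesis using n0 by (simp add: h_def)
        qed
        then show ?thesis using False
          by (intro tendsto_eventually) (auto simp: eventually_sequentially)
      qed
      have lim: "(\<lambda>n. integral\<^sup>L L (h n)) \<longlonglongrightarrow> measure L (F \<inter> sphere 0 1)"
        if L: "finite_measure L" "sets L = sets \<sigma>" for L
      proof -
        interpret finite_measure L by fact
        have space: "space L = sphere 0 1" using sets_eq_imp_space_eq[OF L(2)] by simp
        have FL: "F \<inter> sphere 0 1 \<in> sets L"
          unfolding L(2) sets_circle_measure sets_restrict_space using F by (auto simp: borel_closed)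
        have "(\<lambda>n. integral\<^sup>L L (h n)) \<longlonglongrightarrow> integral\<^sup>L L (indicator (F \<inter> sphere 0 1))"
        proof (rule integral_dominated_convergence[where w = "\<lambda>_. 1"])
          show "AE z in L. (\<lambda>n. h n z) \<longlonglongrightarrow> indicator (F \<inter> sphere 0 1) z"
          proof (rule AE_I2)
            fix z assume "z \<in> space L"
            then have "indicator (F \<inter> sphere 0 1) z = (indicator F z :: real)" by (auto simp: space indicator_def)
            then show "(\<lambda>n. h n z) \<longlonglongrightarrow> indicator (F \<inter> sphere 0 1) z" using h_lim[of z] by simp
          qed
          show "AE z in L. norm (h n z) \<le> 1" for n
            by (auto simp: h_def infdist_nonneg)
          show "h n \<in> borel_measurable L" for n
            using continuous_circle_measurable[OF h_cont] by (simp add: measurable_cong_sets[OF L(2) refl])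
        qed (use FL in auto)
        then show ?thesis using FL by (simp add: Int_absorb2 sets.sets_into_space)
      qed
      have "integral\<^sup>L M (h n) = integral\<^sup>L N (h n)" for n
        by (rule integral_continuous_eqI[OF M N moments h_cont])
      then show ?thesis using lim[OF M] lim[OF N] LIMSEQ_unique by simp
    qed simp
    have "emeasure (distr L borel id) F = ennreal (measure L (F \<inter> sphere 0 1))"
      if L: "finite_measure L" "sets L = sets \<sigma>" for L
    proof -
      interpret finite_measure L by fact
      have "id \<in> L \<rightarrow>\<^sub>M borel"
        unfolding measurable_cong_sets[OF L(2) refl] by (intro continuous_circle_measurable continuous_intros)
      then show ?thesis
        using F sets_eq_imp_space_eq[OF L(2)] by (simp add: emeasure_distr borel_closed emeasure_eq_measure)
    qed
    then show "emeasure (distr M borel id) F = emeasure (distr N borel id) F"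
      using eq M N by simp
  next
    interpret M: finite_measure "distr M borel id"
      by (intro finite_measure.finite_measure_distr M)
         (unfold measurable_cong_sets[OF M(2) refl], intro continuous_circle_measurable continuous_intros)
    show "emeasure (distr M borel id) UNIV \<noteq> \<infinity>" for i :: nat
      by (simp add: M.emeasure_eq_measure)
  qed (auto simp: borel_eq_closed)
  show ?thesis
  proof (rule measure_eqI)
    show "sets M = sets N" by (simp add: M N)
    fix A assume A: "A \<in> sets M"
    then have A': "A \<in> sets borel" "A \<subseteq> sphere 0 1"
      unfolding M(2) sets_circle_measure sets_restrict_space by (auto simp: borel_closed)
    have "emeasure (distr L borel id) A = emeasure L A" if L: "sets L = sets \<sigma>" for L
    proof -
      have "id \<in> L \<rightarrow>\<^sub>M borel"
        unfolding measurable_cong_sets[OF L refl] by (intro continuous_circle_measurable continuous_intros)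
      then show ?thesis
        using A' sets_eq_imp_space_eq[OF L] by (simp add: emeasure_distr Int_absorb2)
    qed
    then show "emeasure M A = emeasure N A" using borel_eq M N by metis
  qed
qed


section \<open>The space \<open>L\<^sup>2\<close> is complete\<close>

lemma square_integrable_fun_of: "square_integrable (fun_of f)"
  using Quotient3_rep_reflp[OF Quotient3_L2, of f] by (simp add: L2_rel_def)

lemma fun_of_measurable [measurable]: "fun_of f \<in> borel_measurable \<sigma>"
  using square_integrable_fun_of by (simp add: square_integrable_def)

lemma integrable_norm_fun_of_power2: "integrable \<sigma> (\<lambda>z. (cmod (fun_of f z))\<^sup>2)"
  using square_integrable_fun_of by (simp add: square_integrable_def)

lemma L2_of_fun_of [simp]: "L2_of (fun_of f) = f"
  by (rule Quotient3_abs_rep[OF Quotient3_L2])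

lemma L2_of_cong:
  assumes "square_integrable f" "square_integrable g" "AE z in \<sigma>. f z = g z"
  shows "L2_of f = L2_of g"
  using assms by (intro Quotient3_rel_abs[OF Quotient3_L2]) (simp add: L2_rel_def)

lemma fun_of_L2_of:
  assumes "square_integrable f"
  shows "AE z in \<sigma>. fun_of (L2_of f) z = f z"
  using rep_abs_rsp_left[OF Quotient3_L2, of f f] assms by (simp add: L2_rel_def)

lemma L2_eqI:
  assumes "AE z in \<sigma>. fun_of f z = fun_of g z"
  shows "f = g"
  using L2_of_cong[OF square_integrable_fun_of square_integrable_fun_of assms] by simp

lemma fun_of_zero: "AE z in \<sigma>. fun_of 0 z = 0"
  unfolding zero_L2_def by (rule fun_of_L2_of[OF square_integrable_zero])

lemma fun_of_add: "AE z in \<sigma>. fun_of (f + g) z = fun_of f z + fun_of g z"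
proof -
  have "f + g = L2_of (\<lambda>z. fun_of f z + fun_of g z)"
    using plus_L2.abs_eq[of "fun_of f" "fun_of g"] square_integrable_fun_of by (simp add: L2_rel_def)
  then show ?thesis
    using fun_of_L2_of[OF square_integrable_add[OF square_integrable_fun_of square_integrable_fun_of, of f g]] by simp
qed

lemma fun_of_cscale: "AE z in \<sigma>. fun_of (c *\<^sub>C f) z = c * fun_of f z"
proof -
  have "c *\<^sub>C f = L2_of (\<lambda>z. c * fun_of f z)"
    using cscale.abs_eq[of "fun_of f"] square_integrable_fun_of by (simp add: L2_rel_def)
  then show ?thesis
    using fun_of_L2_of[OF square_integrable_cmult[OF square_integrable_fun_of, of c f]] by simp
qed

lemma minus_eq_cscale: "- f = (-1) *\<^sub>C f" for f :: L2
  using L2.scale_minus_left[of 1 f] by simp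

lemma fun_of_diff: "AE z in \<sigma>. fun_of (f - g) z = fun_of f z - fun_of g z"
  using fun_of_add[of f "-g"] fun_of_cscale[of "-1" g]
  by eventually_elim (simp flip: minus_eq_cscale)

lemma cinner_L2_of:
  assumes "square_integrable f" "square_integrable g"
  shows "cinner (L2_of f) (L2_of g) = (LINT z|\<sigma>. f z * cnj (g z))"
  using cinner.abs_eq[of f g] assms by (simp add: L2_rel_def)

lemma cinner_integral: "cinner f g = (LINT z|\<sigma>. fun_of f z * cnj (fun_of g z))"
  using cinner_L2_of[OF square_integrable_fun_of square_integrable_fun_of, of f g] by simp

lemma cnj_measurable [measurable (raw)]:
  "f \<in> borel_measurable M \<Longrightarrow> (\<lambda>x. cnj (f x)) \<in> borel_measurable M"
  using measurable_compose[of f M borel cnj borel]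
    borel_measurable_continuous_onI[OF continuous_on_cnj[OF continuous_on_id]] by simp

lemma cinner_cscale_right: "cinner f (c *\<^sub>C g) = cnj c * cinner f g"
  by (subst (1 2) cinner_commute) (simp add: cinner_cscale_left)

lemma cinner_add_right: "cinner f (g + h) = cinner f g + cinner f h"
  by (subst (1 2 3) cinner_commute) (simp add: cinner_add_left)

lemma cinner_zero_left [simp]: "cinner 0 g = 0"
  using cinner_cscale_left[of 0 0 g] by simp

lemma cinner_zero_right [simp]: "cinner g 0 = 0"
  using cinner_cscale_right[of g 0 0] by simp

lemma cinner_minus_left: "cinner (- f) g = - cinner f g"
  unfolding minus_eq_cscale[of f] cinner_cscale_left by simp

lemma cinner_minus_right: "cinner f (- g) = - cinner f g"
  unfolding minus_eq_cscale[of g] cinner_cscale_right by simp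

lemma cinner_diff_left: "cinner (f - g) h = cinner f h - cinner g h"
  unfolding diff_conv_add_uminus cinner_add_left cinner_minus_left ..

lemma cinner_diff_right: "cinner f (g - h) = cinner f g - cinner f h"
  unfolding diff_conv_add_uminus cinner_add_right cinner_minus_right ..

lemma cinner_sum_left: "cinner (\<Sum>i\<in>I. f i) g = (\<Sum>i\<in>I. cinner (f i) g)"
  by (induction I rule: infinite_finite_induct) (simp_all add: cinner_add_left)

lemma cinner_sum_right: "cinner g (\<Sum>i\<in>I. f i) = (\<Sum>i\<in>I. cinner g (f i))"
  by (induction I rule: infinite_finite_induct) (simp_all add: cinner_add_right)

lemmas cinner_simps = cinner_add_left cinner_add_right cinner_diff_left cinner_diff_right
  cinner_minus_left cinner_minus_right cinner_cscale_left cinner_cscale_right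

lemma cinner_self_eq_norm: "cinner f f = of_real ((norm f)\<^sup>2)"
proof -
  have "(norm f)\<^sup>2 = Re (cinner f f)"
    using power2_norm_eq_inner[of f] by (simp add: inner_L2_def)
  moreover have "Im (cinner f f) = 0"
    using arg_cong[OF cinner_commute[of f f], of Im] by simp
  ultimately show ?thesis by (simp add: complex_eq_iff)
qed

lemma norm_power2_integral: "(norm f)\<^sup>2 = (LINT z|\<sigma>. (cmod (fun_of f z))\<^sup>2)"
proof -
  have "complex_of_real ((norm f)\<^sup>2) = (LINT z|\<sigma>. complex_of_real ((cmod (fun_of f z))\<^sup>2))"
    unfolding cinner_self_eq_norm[symmetric] cinner_integral
    by (simp only: complex_norm_square)
  then show ?thesis by (simp only: integral_complex_of_real of_real_eq_iff)
qed

lemma norm_L2_of_power2: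
  assumes "square_integrable f"
  shows "(norm (L2_of f))\<^sup>2 = (LINT z|\<sigma>. (cmod (f z))\<^sup>2)"
  unfolding norm_power2_integral
  by (rule integral_cong_AE)
     (use fun_of_L2_of[OF assms] assms in \<open>auto simp: square_integrable_def\<close>)

lemma norm_cscale [simp]: "norm (c *\<^sub>C f) = cmod c * norm f"
proof -
  have "complex_of_real ((norm (c *\<^sub>C f))\<^sup>2) = of_real ((cmod c * norm f)\<^sup>2)"
    unfolding power_mult_distrib of_real_mult complex_norm_square
    by (simp only: cinner_self_eq_norm[symmetric] cinner_cscale_left cinner_cscale_right mult.assoc
        mult.left_commute[of c])
  then have "(norm (c *\<^sub>C f))\<^sup>2 = (cmod c * norm f)\<^sup>2" by (simp only: of_real_eq_iff)
  then show ?thesis by (rule power2_eq_imp_eq) auto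
qed

lemma cinner_norm_le: "cmod (cinner f g) \<le> norm f * norm g"
proof -
  \<comment> \<open>A phase that makes the inner product real, reducing to the real Cauchy-Schwarz
    inequality.\<close>
  define c where "c = cnj (sgn (cinner f g))"
  have "cinner (c *\<^sub>C f) g = of_real (cmod (cinner f g))"
    unfolding cinner_cscale_left c_def sgn_eq
    by (cases "cinner f g = 0") (simp_all add: complex_norm_square[symmetric] power2_eq_square mult.commute)
  then have "cmod (cinner f g) = (c *\<^sub>C f) \<bullet> g" by (simp add: inner_L2_def)
  also have "\<dots> \<le> norm (c *\<^sub>C f) * norm g" by (rule norm_cauchy_schwarz)
  also have "\<dots> \<le> norm f * norm g"
    by (simp add: c_def norm_sgn)
  finally show ?thesis .
qed

lemma bounded_linear_cinner_left: "bounded_linear (\<lambda>f. cinner f g)"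
  by (rule bounded_linear_intro[where K = "norm g"])
     (simp_all add: cinner_add_left scaleR_L2_def cinner_cscale_left scaleR_conv_of_real cinner_norm_le)

lemma bounded_linear_cinner_right: "bounded_linear (\<lambda>f. cinner g f)"
  by (rule bounded_linear_intro[where K = "norm g"])
     (use cinner_norm_le[of g] in \<open>simp_all add: cinner_add_right scaleR_L2_def cinner_cscale_right
        scaleR_conv_of_real mult.commute\<close>)

lemma bounded_linear_cscale: "bounded_linear (\<lambda>f. c *\<^sub>C f)"
  by (rule bounded_linear_intro[where K = "cmod c"])
     (simp_all add: L2.scale_right_distrib scaleR_L2_def mult.commute)

lemma square_integrable_const: "square_integrable (\<lambda>z. c)"
  by (simp add: square_integrable_def)

lemma square_integrable_mult_bounded:
  assumes "\<phi> \<in> borel_measurable \<sigma>" "AE z in \<sigma>. cmod (\<phi> z) \<le> M"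
    and "square_integrable f"
  shows "square_integrable (\<lambda>z. \<phi> z * f z)"
proof -
  have [measurable]: "f \<in> borel_measurable \<sigma>" and i: "integrable \<sigma> (\<lambda>z. M\<^sup>2 * (cmod (f z))\<^sup>2)"
    using assms(3) by (auto simp: square_integrable_def)
  note [measurable] = assms(1)
  have "integrable \<sigma> (\<lambda>z. (cmod (\<phi> z * f z))\<^sup>2)"
  proof (rule Bochner_Integration.integrable_bound[OF i])
    show "AE z in \<sigma>. norm ((cmod (\<phi> z * f z))\<^sup>2) \<le> norm (M\<^sup>2 * (cmod (f z))\<^sup>2)"
      using assms(2)
      by eventually_elim (auto simp: norm_mult power_mult_distrib intro!: mult_right_mono power_mono)
  qed measurable
  then show ?thesis by (simp add: square_integrable_def)
qed

lemma essentially_bounded_imp_square_integrable: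
  "essentially_bounded \<phi> \<Longrightarrow> square_integrable \<phi>"
  using square_integrable_mult_bounded[OF _ _ square_integrable_const[of 1]]
  by (auto simp: essentially_bounded_def)

text \<open>
  The Cauchy-Schwarz inequality against the constant 1, using that the circle has measure 1.
\<close>

lemma integral_norm_le_norm: "(LINT z|\<sigma>. cmod (fun_of f z)) \<le> norm f"
proof -
  \<comment> \<open>The inner product of \<open>\<bar>f\<bar>\<close> with 1 is the integral in
    question.\<close>
  define h where "h = L2_of (\<lambda>z. complex_of_real (cmod (fun_of f z)))"
  have sq: "square_integrable (\<lambda>z. complex_of_real (cmod (fun_of f z)))"
    using square_integrable_fun_of[of f] by (simp add: square_integrable_def)
  have "cinner h (L2_of (\<lambda>z. 1)) = (LINT z|\<sigma>. complex_of_real (cmod (fun_of f z)))"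
    unfolding h_def by (subst cinner_L2_of) (auto intro: sq square_integrable_const)
  also have "\<dots> = of_real ((LINT z|\<sigma>. cmod (fun_of f z)))"
    by (rule integral_complex_of_real)
  finally have "(LINT z|\<sigma>. cmod (fun_of f z)) \<le> norm h * norm (L2_of (\<lambda>z. 1))"
    using cinner_norm_le[of h "L2_of (\<lambda>z. 1)"] by simp
  moreover have "(norm (L2_of (\<lambda>z. 1)))\<^sup>2 = 1"
    using cinner_L2_of[OF square_integrable_const square_integrable_const, of 1 1] circle.prob_space
    unfolding cinner_self_eq_norm by (simp flip: of_real_power)
  then have "norm (L2_of (\<lambda>z. 1)) = 1" using norm_ge_zero[of "L2_of (\<lambda>z. 1)"] by (auto simp: power2_eq_1_iff)
  moreover have "(norm h)\<^sup>2 = (norm f)\<^sup>2"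
    using cinner_L2_of[OF sq sq] unfolding h_def[symmetric] cinner_self_eq_norm norm_power2_integral[of f]
    by (simp only: complex_cnj_complex_of_real of_real_mult[symmetric] integral_complex_of_real of_real_eq_iff power2_eq_square)
  then have "norm h = norm f" by (rule power2_eq_imp_eq) auto
  ultimately show ?thesis by simp
qed

text \<open>
  Along such a subsequence the differences are summable in norm, hence absolutely summable at
  almost every point, which produces a pointwise limit.
\<close>

lemma L2_Cauchy_subseq:
  fixes X :: "nat \<Rightarrow> L2"
  assumes "Cauchy X"
  obtains s where "strict_mono s" "\<And>n. norm (X (s (Suc n)) - X (s n)) \<le> (1 / 2) ^ n"
proof -
  have "\<exists>N. \<forall>m\<ge>N. norm (X m - X N) < (1 / 2) ^ n" for n
    using assms unfolding Cauchy_altdef2 dist_norm by (auto simp: norm_minus_commute)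
  then obtain N where N: "\<And>n m. m \<ge> N n \<Longrightarrow> norm (X m - X (N n)) < (1 / 2) ^ n" by metis
  define s where "s = rec_nat (N 1) (\<lambda>n k. max (Suc k) (N (Suc (Suc n))))"
  have s_Suc: "s (Suc n) = max (Suc (s n)) (N (Suc (Suc n)))" for n by (simp add: s_def)
  have s_ge: "s n \<ge> N (Suc n)" for n by (cases n) (simp_all add: s_def)
  have mono: "strict_mono s" unfolding strict_mono_Suc_iff s_Suc by (simp add: less_max_iff_disj)
  have "norm (X (s (Suc n)) - X (s n)) \<le> (1 / 2) ^ n" for n
  proof -
    have "s (Suc n) \<ge> N (Suc n)"
      using s_ge[of n] mono by (meson le_trans less_imp_le_nat strict_mono_Suc_iff)
    then have "norm (X (s (Suc n)) - X (N (Suc n))) < (1 / 2) ^ Suc n" by (rule N)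
    moreover have "norm (X (s n) - X (N (Suc n))) < (1 / 2) ^ Suc n" by (rule N[OF s_ge])
    ultimately have "norm ((X (s (Suc n)) - X (N (Suc n))) - (X (s n) - X (N (Suc n)))) \<le> (1/2) ^ Suc n + (1/2) ^ Suc n"
      by (intro norm_triangle_le_diff) auto
    then show ?thesis by simp
  qed
  then show ?thesis using that mono by blast
qed

text \<open>
  The limit is built pointwise: a rapidly converging subsequence converges almost everywhere, and
  Fatou's lemma bounds the \<open>L\<^sup>2\<close>-distance between its pointwise limit and its members.
\<close>

instance L2 :: complete_space
proof
  fix X :: "nat \<Rightarrow> L2" assume X: "Cauchy X"
  obtain s where s: "strict_mono s" and step: "\<And>n. norm (X (s (Suc n)) - X (s n)) \<le> (1 / 2) ^ n"
    using L2_Cauchy_subseq[OF X] by blast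
  define g where "g n = fun_of (X (s n))" for n
  have g_meas [measurable]: "g n \<in> borel_measurable \<sigma>" for n by (simp add: g_def)
  have "(\<integral>\<^sup>+z. (\<Sum>n. ennreal (cmod (fun_of (X (s (Suc n)) - X (s n)) z))) \<partial>\<sigma>)
      = (\<Sum>n. \<integral>\<^sup>+z. ennreal (cmod (fun_of (X (s (Suc n)) - X (s n)) z)) \<partial>\<sigma>)"
    by (rule nn_integral_suminf) simp
  also have "\<dots> \<le> (\<Sum>n. ennreal ((1 / 2) ^ n))"
  proof (rule suminf_le)
    fix n
    let ?d = "X (s (Suc n)) - X (s n)"
    have "integrable \<sigma> (\<lambda>z. fun_of ?d z * cnj 1)"
      using square_integrable_const by (rule integrable_mult_cnj[OF square_integrable_fun_of])
    then have "(\<integral>\<^sup>+z. ennreal (cmod (fun_of ?d z)) \<partial>\<sigma>)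
        = ennreal ((LINT z|\<sigma>. cmod (fun_of ?d z)))"
      by (intro nn_integral_eq_integral) auto
    also have "\<dots> \<le> ennreal ((1 / 2) ^ n)"
      using integral_norm_le_norm[of ?d] step[of n] by (intro ennreal_leI) simp
    finally show "(\<integral>\<^sup>+z. ennreal (cmod (fun_of ?d z)) \<partial>\<sigma>) \<le> ennreal ((1 / 2) ^ n)" .
  qed auto
  also have "\<dots> < \<infinity>"
  proof -
    have "(\<Sum>n. ennreal ((1 / 2) ^ n)) = ennreal (\<Sum>n. (1 / 2) ^ n)"
      by (rule suminf_ennreal2) (auto simp: summable_geometric_iff)
    then show ?thesis by (metis ennreal_less_top infinity_ennreal_def)
  qed
  finally have "AE z in \<sigma>. (\<Sum>n. ennreal (cmod (fun_of (X (s (Suc n)) - X (s n)) z))) \<noteq> \<infinity>"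
    by (intro nn_integral_PInf_AE) (auto simp: less_top)
  moreover have "AE z in \<sigma>. \<forall>n. fun_of (X (s (Suc n)) - X (s n)) z = g (Suc n) z - g n z"
    unfolding AE_all_countable g_def using fun_of_diff by blast
  ultimately have lim: "AE z in \<sigma>. (\<lambda>n. g n z) \<longlonglongrightarrow> lim (\<lambda>n. g n z)"
  proof eventually_elim
    case (elim z)
    then have "summable (\<lambda>n. cmod (g (Suc n) z - g n z))"
      by (intro summable_suminf_not_top) auto
    then have "summable (\<lambda>n. g (Suc n) z - g n z)"
      by (rule summable_norm_cancel)
    then have "convergent (\<lambda>n. \<Sum>k<n. g (Suc k) z - g k z)"
      by (simp add: summable_iff_convergent)
    moreover have "(\<Sum>k<n. g (Suc k) z - g k z) = g n z - g 0 z" for n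
      by (rule sum_lessThan_telescope)
    ultimately have "convergent (\<lambda>n. g n z - g 0 z)" by simp
    from convergent_add[OF this convergent_const[of "g 0 z"]]
    have "convergent (\<lambda>n. g n z)" by simp
    then show ?case by (simp add: convergent_LIMSEQ_iff)
  qed
  define h where "h z = lim (\<lambda>n. g n z)" for z
  have h_meas [measurable]: "h \<in> borel_measurable \<sigma>"
    unfolding h_def by measurable
  have fatou: "(\<integral>\<^sup>+z. ennreal ((cmod (h z - g n z))\<^sup>2) \<partial>\<sigma>) \<le> ennreal (e\<^sup>2)"
    if e: "e > 0" and n: "\<And>m. m \<ge> n \<Longrightarrow> norm (X (s m) - X (s n)) \<le> e" for e n
  proof -
    have "(\<integral>\<^sup>+z. ennreal ((cmod (h z - g n z))\<^sup>2) \<partial>\<sigma>)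
        = (\<integral>\<^sup>+z. liminf (\<lambda>m. ennreal ((cmod (g m z - g n z))\<^sup>2)) \<partial>\<sigma>)"
    proof (rule nn_integral_cong_AE)
      show "AE z in \<sigma>. ennreal ((cmod (h z - g n z))\<^sup>2) = liminf (\<lambda>m. ennreal ((cmod (g m z - g n z))\<^sup>2))"
        using lim
      proof eventually_elim
        case (elim z)
        then have "(\<lambda>m. ennreal ((cmod (g m z - g n z))\<^sup>2)) \<longlonglongrightarrow> ennreal ((cmod (h z - g n z))\<^sup>2)"
          unfolding h_def[symmetric] by (intro tendsto_intros)
        then show ?case by (intro lim_imp_Liminf[symmetric]) auto
      qed
    qed
    also have "\<dots> \<le> liminf (\<lambda>m. \<integral>\<^sup>+z. ennreal ((cmod (g m z - g n z))\<^sup>2) \<partial>\<sigma>)"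
      by (rule nn_integral_liminf) simp
    also have "\<dots> \<le> ennreal (e\<^sup>2)"
    proof (rule Liminf_le)
      show "\<forall>\<^sub>F m in sequentially. (\<integral>\<^sup>+z. ennreal ((cmod (g m z - g n z))\<^sup>2) \<partial>\<sigma>) \<le> ennreal (e\<^sup>2)"
        unfolding eventually_sequentially
      proof (intro exI[of _ n] allI impI)
        fix m assume "n \<le> m"
        have "(\<integral>\<^sup>+z. ennreal ((cmod (g m z - g n z))\<^sup>2) \<partial>\<sigma>)
            = (\<integral>\<^sup>+z. ennreal ((cmod (fun_of (X (s m) - X (s n)) z))\<^sup>2) \<partial>\<sigma>)"
          using fun_of_diff[of "X (s m)" "X (s n)"] by (intro nn_integral_cong_AE) (auto simp: g_def)
        also have "\<dots> = ennreal ((norm (X (s m) - X (s n)))\<^sup>2)"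
          unfolding norm_power2_integral
          by (intro nn_integral_eq_integral integrable_norm_fun_of_power2) auto
        also have "\<dots> \<le> ennreal (e\<^sup>2)"
          using n[OF \<open>n \<le> m\<close>] by (intro ennreal_leI power_mono) auto
        finally show "(\<integral>\<^sup>+z. ennreal ((cmod (g m z - g n z))\<^sup>2) \<partial>\<sigma>) \<le> ennreal (e\<^sup>2)" .
      qed
    qed simp
    finally show ?thesis .
  qed
  have tail: "\<exists>n. \<forall>m\<ge>n. norm (X (s m) - X (s n)) \<le> e \<and> norm (X m - X (s m)) \<le> e" if "e > 0" for e
  proof -
    obtain N where N: "\<And>m n. m \<ge> N \<Longrightarrow> n \<ge> N \<Longrightarrow> norm (X m - X n) < e"
      using X \<open>e > 0\<close> unfolding Cauchy_iff by blast
    have "s m \<ge> m" for m using s by (rule seq_suble)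
    then show ?thesis using N by (intro exI[of _ N]) (meson le_trans less_imp_le order_refl)
  qed
  have sq: "square_integrable h"
  proof -
    obtain n where n: "\<And>m. m \<ge> n \<Longrightarrow> norm (X (s m) - X (s n)) \<le> 1" using tail[of 1] by auto
    have "square_integrable (\<lambda>z. h z - g n z)"
      using fatou[OF zero_less_one n] unfolding square_integrable_def integrable_iff_bounded
      by (auto intro: le_less_trans)
    then have "square_integrable (\<lambda>z. (h z - g n z) + g n z)"
      by (rule square_integrable_add) (simp add: g_def square_integrable_fun_of)
    then show ?thesis by simp
  qed
  have close: "norm (L2_of h - X (s n)) \<le> e"
    if e: "e > 0" and n: "\<And>m. m \<ge> n \<Longrightarrow> norm (X (s m) - X (s n)) \<le> e" for e n
  proof -
    have "ennreal ((norm (L2_of h - X (s n)))\<^sup>2) = (\<integral>\<^sup>+z. ennreal ((cmod (fun_of (L2_of h - X (s n)) z))\<^sup>2) \<partial>\<sigma>)"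
      unfolding norm_power2_integral
      by (intro nn_integral_eq_integral[symmetric] integrable_norm_fun_of_power2) auto
    also have "\<dots> = (\<integral>\<^sup>+z. ennreal ((cmod (h z - g n z))\<^sup>2) \<partial>\<sigma>)"
      using fun_of_diff[of "L2_of h" "X (s n)"] fun_of_L2_of[OF sq]
      by (intro nn_integral_cong_AE) (auto simp: g_def)
    also have "\<dots> \<le> ennreal (e\<^sup>2)" by (rule fatou[OF e n])
    finally have "(norm (L2_of h - X (s n)))\<^sup>2 \<le> e\<^sup>2" by (simp add: ennreal_le_iff)
    from power2_le_imp_le[OF this less_imp_le[OF e]] show ?thesis .
  qed
  have "X \<longlonglongrightarrow> L2_of h"
  proof (rule LIMSEQ_I)
    fix r :: real assume "r > 0"
    then obtain n where n: "\<And>m. m \<ge> n \<Longrightarrow> norm (X (s m) - X (s n)) \<le> r / 4 \<and> norm (X m - X (s m)) \<le> r / 4"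
      using tail[of "r / 4"] by auto
    have "norm (X m - L2_of h) < r" if "m \<ge> n" for m
    proof -
      have "norm (L2_of h - X (s n)) \<le> r / 4"
        by (rule close) (use n \<open>r > 0\<close> in \<open>auto\<close>)
      then have "norm ((X m - X (s m)) + (X (s m) - X (s n)) + (X (s n) - L2_of h)) \<le> r / 4 + r / 4 + r / 4"
        using n[OF that] norm_minus_commute[of "L2_of h" "X (s n)"] by (intro norm_triangle_mono) auto
      moreover have "(X m - X (s m)) + (X (s m) - X (s n)) + (X (s n) - L2_of h) = X m - L2_of h" by simp
      ultimately show ?thesis using \<open>r > 0\<close> by simp
    qed
    then show "\<exists>n. \<forall>m\<ge>n. norm (X m - L2_of h) < r" by blast
  qed
  then show "convergent X" by (rule convergentI)
qed

instance L2 :: banach ..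


section \<open>Orthonormal expansions\<close>

definition orthonormal_family :: "('i \<Rightarrow> L2) \<Rightarrow> 'i set \<Rightarrow> bool" where
  "orthonormal_family b I \<longleftrightarrow> (\<forall>i\<in>I. \<forall>j\<in>I. cinner (b i) (b j) = (if i = j then 1 else 0))"

lemma cinner_orthonormal_sum:
  assumes "orthonormal_family b I" "finite F" "F \<subseteq> I" "j \<in> I"
  shows "cinner (\<Sum>i\<in>F. c i *\<^sub>C b i) (b j) = (if j \<in> F then c j else 0)"
proof -
  have "cinner (\<Sum>i\<in>F. c i *\<^sub>C b i) (b j) = (\<Sum>i\<in>F. if i = j then c j else 0)"
    unfolding cinner_sum_left cinner_cscale_left
    by (intro sum.cong refl) (use assms in \<open>auto simp: orthonormal_family_def subset_iff\<close>)
  then show ?thesis using assms(2) by simp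
qed

lemma norm_orthonormal_sum:
  assumes "orthonormal_family b I" "finite F" "F \<subseteq> I"
  shows "(norm (\<Sum>i\<in>F. c i *\<^sub>C b i))\<^sup>2 = (\<Sum>i\<in>F. (cmod (c i))\<^sup>2)"
proof -
  have "cinner (\<Sum>i\<in>F. c i *\<^sub>C b i) (\<Sum>i\<in>F. c i *\<^sub>C b i) = (\<Sum>i\<in>F. cnj (c i) * c i)"
    unfolding cinner_sum_right cinner_cscale_right
    using assms(3) by (intro sum.cong refl) (auto simp: cinner_orthonormal_sum[OF assms] subset_iff)
  also have "\<dots> = of_real (\<Sum>i\<in>F. (cmod (c i))\<^sup>2)"
    by (simp only: of_real_sum complex_norm_square mult.commute)
  finally show ?thesis by (simp only: cinner_self_eq_norm of_real_eq_iff)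
qed

text \<open>
  The square of the norm of \<open>f\<close> minus its projection to the span of the \<open>b i\<close> is the difference
  of the two sides.
\<close>

lemma bessel_inequality:
  assumes "orthonormal_family b I" "finite F" "F \<subseteq> I"
  shows "(\<Sum>i\<in>F. (cmod (cinner f (b i)))\<^sup>2) \<le> (norm f)\<^sup>2"
proof -
  let ?s = "\<Sum>i\<in>F. cinner f (b i) *\<^sub>C b i"
  have s: "cinner ?s ?s = of_real (\<Sum>i\<in>F. (cmod (cinner f (b i)))\<^sup>2)"
    unfolding cinner_self_eq_norm norm_orthonormal_sum[OF assms] ..
  have fs: "cinner f ?s = of_real (\<Sum>i\<in>F. (cmod (cinner f (b i)))\<^sup>2)"
    by (simp only: cinner_sum_right cinner_cscale_right of_real_sum complex_norm_square mult.commute)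
  then have sf: "cinner ?s f = of_real (\<Sum>i\<in>F. (cmod (cinner f (b i)))\<^sup>2)"
    by (subst cinner_commute) (simp only: complex_cnj_complex_of_real)
  have "complex_of_real ((norm (f - ?s))\<^sup>2) = of_real ((norm f)\<^sup>2 - (\<Sum>i\<in>F. (cmod (cinner f (b i)))\<^sup>2))"
    unfolding cinner_self_eq_norm[symmetric] cinner_diff_left cinner_diff_right s fs sf
    unfolding cinner_self_eq_norm of_real_diff by simp
  then have "(norm (f - ?s))\<^sup>2 = (norm f)\<^sup>2 - (\<Sum>i\<in>F. (cmod (cinner f (b i)))\<^sup>2)"
    by (simp only: of_real_eq_iff)
  then show ?thesis using zero_le_power2[of "norm (f - ?s)"] by linarith
qed

text \<open>
  By orthogonality, the squared distance between two partial sums is a sum of squares of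
  coefficients, so the partial sums form a Cauchy filter.
\<close>

lemma riesz_fischer:
  assumes b: "orthonormal_family b I"
    and bound: "\<And>F. finite F \<Longrightarrow> F \<subseteq> I \<Longrightarrow> (\<Sum>i\<in>F. (cmod (c i))\<^sup>2) \<le> B"
  shows "(\<lambda>i. c i *\<^sub>C b i) summable_on I"
proof -
  let ?f = "\<lambda>i. c i *\<^sub>C b i" and ?q = "\<lambda>i. (cmod (c i))\<^sup>2"
  define A where "A = sum ?q ` {F. F \<subseteq> I \<and> finite F}"
  have bdd: "bdd_above A" using bound by (auto simp: A_def intro!: bdd_aboveI)
  have ne: "A \<noteq> {}" by (auto simp: A_def)
  have "\<exists>P. eventually P (finite_subsets_at_top I) \<and>
          (\<forall>F F'. P F \<and> P F' \<longrightarrow> dist (sum ?f F) (sum ?f F') < e)" if "e > 0" for e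
  proof -
    have "Sup A - (e / 2)\<^sup>2 < Sup A" using \<open>e > 0\<close> by simp
    then obtain F0 where F0: "finite F0" "F0 \<subseteq> I" "Sup A - (e / 2)\<^sup>2 < sum ?q F0"
      unfolding less_cSup_iff[OF ne bdd] by (auto simp: A_def)
    have near: "dist (sum ?f F) (sum ?f F0) < e / 2" if F: "finite F" "F0 \<subseteq> F" "F \<subseteq> I" for F
    proof -
      have "sum ?f F - sum ?f F0 = sum ?f (F - F0)"
        using F F0 by (simp add: sum_diff)
      then have "(norm (sum ?f F - sum ?f F0))\<^sup>2 = sum ?q (F - F0)"
        using norm_orthonormal_sum[OF b, of "F - F0" c] F by auto
      also have "\<dots> = sum ?q F - sum ?q F0" using F F0 by (simp add: sum_diff)
      also have "\<dots> < (e / 2)\<^sup>2"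
        using cSup_upper[OF _ bdd, of "sum ?q F"] F F0 by (auto simp: A_def)
      finally show ?thesis
        unfolding dist_norm by (rule power2_less_imp_less) (use \<open>e > 0\<close> in simp)
    qed
    have "eventually (\<lambda>F. finite F \<and> F0 \<subseteq> F \<and> F \<subseteq> I) (finite_subsets_at_top I)"
      using F0 by (auto simp: eventually_finite_subsets_at_top)
    moreover have "dist (sum ?f F) (sum ?f F') < e"
      if "finite F \<and> F0 \<subseteq> F \<and> F \<subseteq> I" "finite F' \<and> F0 \<subseteq> F' \<and> F' \<subseteq> I" for F F'
      using dist_triangle_half_r[of "sum ?f F0" "sum ?f F" e "sum ?f F'"] near[of F] near[of F'] that
      by (simp add: dist_commute)
    ultimately show ?thesis
      by (intro exI[of _ "\<lambda>F. finite F \<and> F0 \<subseteq> F \<and> F \<subseteq> I"] conjI allI impI) auto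
  qed
  then have "cauchy_filter (filtermap (sum ?f) (finite_subsets_at_top I))"
    by (simp add: cauchy_filter_metric_filtermap)
  then obtain L where "(sum ?f \<longlongrightarrow> L) (finite_subsets_at_top I)"
    using complete_uniform[THEN iffD1, OF complete_UNIV] by (force simp add: filterlim_def)
  then show ?thesis
    unfolding summable_on_def has_sum_def by blast
qed

lemma cinner_has_sum:
  assumes "orthonormal_family b I" "((\<lambda>i. c i *\<^sub>C b i) has_sum f) I" "j \<in> I"
  shows "cinner f (b j) = c j"
proof -
  have "((\<lambda>i. cinner (c i *\<^sub>C b i) (b j)) has_sum cinner f (b j)) I"
    by (rule has_sum_bounded_linear[OF bounded_linear_cinner_left assms(2)])
  moreover have "((\<lambda>i. cinner (c i *\<^sub>C b i) (b j)) has_sum c j) I"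
  proof -
    have "((\<lambda>i. cinner (c i *\<^sub>C b i) (b j)) has_sum c j) I \<longleftrightarrow> ((\<lambda>i. c i) has_sum c j) {j}"
      using assms by (intro has_sum_cong_neutral) (auto simp: cinner_cscale_left orthonormal_family_def)
    then show ?thesis using has_sum_finite[of "{j}" c] by simp
  qed
  ultimately show ?thesis by (rule has_sum_unique)
qed

lemma has_sum_in_closed_subspace:
  assumes "L2.subspace S" "closed S" "\<And>i. i \<in> I \<Longrightarrow> b i \<in> S" "((\<lambda>i. c i *\<^sub>C b i) has_sum f) I"
  shows "f \<in> S"
proof -
  have "eventually (\<lambda>F. (\<Sum>i\<in>F. c i *\<^sub>C b i) \<in> S) (finite_subsets_at_top I)"
    using assms(1,3)
    by (intro eventually_finite_subsets_at_top_weakI) (auto intro!: L2.subspace_sum L2.subspace_scale)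
  then show ?thesis
    using assms(4) unfolding has_sum_def
    by (intro Lim_in_closed_set[OF assms(2)]) auto
qed

text \<open>
  The family is indexed because the vectors \<open>u\<^sup>m e\<close> are indexed by pairs. Completeness is expressed
  by the triviality of the orthogonal complement within \<open>S\<close>, the form in which it is both proved
  and used; \<open>orthonormal_basis_iff\<close> compares it with density of the span.
\<close>

definition orthonormal_basis_of :: "('i \<Rightarrow> L2) \<Rightarrow> 'i set \<Rightarrow> L2 set \<Rightarrow> bool" where
  "orthonormal_basis_of b I S \<longleftrightarrow> orthonormal_family b I \<and> L2.subspace S \<and> closed S \<and> b ` I \<subseteq> S \<and>
     (\<forall>f\<in>S. (\<forall>i\<in>I. cinner f (b i) = 0) \<longrightarrow> f = 0)"

lemma riesz_fischer_coefficients: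
  assumes "orthonormal_basis_of b I S"
    and "\<And>F. finite F \<Longrightarrow> F \<subseteq> I \<Longrightarrow> (\<Sum>i\<in>F. (cmod (c i))\<^sup>2) \<le> B"
  obtains g where "g \<in> S" "((\<lambda>i. c i *\<^sub>C b i) has_sum g) I" "\<And>i. i \<in> I \<Longrightarrow> cinner g (b i) = c i"
proof -
  have b: "orthonormal_family b I" using assms(1) by (simp add: orthonormal_basis_of_def)
  obtain g where g: "((\<lambda>i. c i *\<^sub>C b i) has_sum g) I"
    using riesz_fischer[OF b assms(2)] by (auto simp: summable_on_def)
  have "g \<in> S"
    using assms(1) by (intro has_sum_in_closed_subspace[OF _ _ _ g]) (auto simp: orthonormal_basis_of_def)
  from that[OF this g cinner_has_sum[OF b g]] show ?thesis .
qed

text \<open>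
  The sum converges by Bessel's inequality, and orthogonality is checked against the expansion of
  \<open>h\<close>. For \<open>S = H\<^sup>2\<close> this is the projection that defines Toeplitz operators.
\<close>

lemma orthonormal_projection:
  assumes "orthonormal_basis_of b I S"
  obtains g where "g \<in> S" "\<And>h. h \<in> S \<Longrightarrow> cinner (f - g) h = 0"
    "((\<lambda>i. cinner f (b i) *\<^sub>C b i) has_sum g) I"
proof -
  have b: "orthonormal_family b I" and S: "L2.subspace S"
    and total: "\<And>f. f \<in> S \<Longrightarrow> (\<And>i. i \<in> I \<Longrightarrow> cinner f (b i) = 0) \<Longrightarrow> f = 0"
    using assms by (auto simp: orthonormal_basis_of_def)
  have expand: "\<exists>g\<in>S. ((\<lambda>i. cinner f (b i) *\<^sub>C b i) has_sum g) I \<and> (\<forall>i\<in>I. cinner g (b i) = cinner f (b i))" for f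
    by (rule riesz_fischer_coefficients[OF assms bessel_inequality[OF b, of _ f]]) auto
  obtain g where g: "g \<in> S" "((\<lambda>i. cinner f (b i) *\<^sub>C b i) has_sum g) I"
    and g_coeff: "\<And>i. i \<in> I \<Longrightarrow> cinner g (b i) = cinner f (b i)"
    using expand[of f] by blast
  have orth: "cinner (f - g) h = 0" if "h \<in> S" for h
  proof -
    obtain h' where h': "h' \<in> S" "((\<lambda>i. cinner h (b i) *\<^sub>C b i) has_sum h') I"
      and h'_coeff: "\<And>i. i \<in> I \<Longrightarrow> cinner h' (b i) = cinner h (b i)"
      using expand[of h] by blast
    have "h - h' = 0"
      using that h' h'_coeff by (intro total L2.subspace_diff[OF S]) (auto simp: cinner_diff_left)
    then have "((\<lambda>i. cinner h (b i) *\<^sub>C b i) has_sum h) I" using h' by simp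
    then have "((\<lambda>i. cinner (f - g) (cinner h (b i) *\<^sub>C b i)) has_sum cinner (f - g) h) I"
      by (rule has_sum_bounded_linear[OF bounded_linear_cinner_right])
    moreover have "((\<lambda>i. cinner (f - g) (cinner h (b i) *\<^sub>C b i)) has_sum 0) I"
      by (rule has_sum_0) (simp add: cinner_cscale_right cinner_diff_left g_coeff)
    ultimately show ?thesis by (rule has_sum_unique)
  qed
  show ?thesis by (rule that[OF g(1) orth g(2)])
qed

lemma orthonormal_expansion:
  assumes "orthonormal_basis_of b I S" "f \<in> S"
  shows "((\<lambda>i. cinner f (b i) *\<^sub>C b i) has_sum f) I"
proof -
  have S: "L2.subspace S" using assms by (auto simp: orthonormal_basis_of_def)
  obtain g where g: "g \<in> S" "\<And>h. h \<in> S \<Longrightarrow> cinner (f - g) h = 0" "((\<lambda>i. cinner f (b i) *\<^sub>C b i) has_sum g) I"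
    using orthonormal_projection[OF assms(1)] by blast
  have "cinner (f - g) (f - g) = 0" using g assms(2) S by (intro g(2) L2.subspace_diff) auto
  then have "f = g" by (simp add: cinner_self_eq_norm)
  then show ?thesis using g by simp
qed

lemma parseval:
  assumes "orthonormal_basis_of b I S" "f \<in> S"
  shows "((\<lambda>i. cinner f (b i) * cnj (cinner g (b i))) has_sum cinner f g) I"
proof -
  have "((\<lambda>i. cinner (cinner f (b i) *\<^sub>C b i) g) has_sum cinner f g) I"
    by (rule has_sum_bounded_linear[OF bounded_linear_cinner_left orthonormal_expansion[OF assms]])
  moreover have "cinner (cinner f (b i) *\<^sub>C b i) g = cinner f (b i) * cnj (cinner g (b i))" for i
    unfolding cinner_cscale_left by (subst (2) cinner_commute) simp
  ultimately show ?thesis by simp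
qed

lemma L2_subspace_closure:
  assumes "L2.subspace S"
  shows "L2.subspace (closure S)"
proof (rule L2.subspaceI)
  show "0 \<in> closure S" using L2.subspace_0[OF assms] closure_subset by blast
next
  fix x y assume "x \<in> closure S" "y \<in> closure S"
  then obtain X Y where "\<And>n. X n \<in> S" "X \<longlonglongrightarrow> x" "\<And>n. Y n \<in> S" "Y \<longlonglongrightarrow> y"
    unfolding closure_sequential by blast
  then show "x + y \<in> closure S"
    unfolding closure_sequential
    by (intro exI[of _ "\<lambda>n. X n + Y n"]) (auto intro!: tendsto_add L2.subspace_add[OF assms])
next
  fix c x assume "x \<in> closure S"
  then obtain X where "\<And>n. X n \<in> S" "X \<longlonglongrightarrow> x"
    unfolding closure_sequential by blast
  then show "c *\<^sub>C x \<in> closure S"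
    unfolding closure_sequential
    by (intro exI[of _ "\<lambda>n. c *\<^sub>C X n"])
       (auto intro!: L2.subspace_scale[OF assms] bounded_linear.tendsto[OF bounded_linear_cscale])
qed

lemma orthogonal_to_closure_span:
  assumes "\<And>e. e \<in> E \<Longrightarrow> cinner f e = 0" "g \<in> closure (L2.span E)"
  shows "cinner f g = 0"
proof -
  have "L2.span E \<subseteq> {g. cinner f g = 0}"
    using assms(1)
    by (intro L2.span_minimal L2.subspaceI) (auto simp: cinner_add_right cinner_cscale_right)
  moreover have "closed {g. cinner f g = 0}"
    by (intro closed_Collect_eq bounded_linear.continuous_on[OF bounded_linear_cinner_right] continuous_intros)
  ultimately have "closure (L2.span E) \<subseteq> {g. cinner f g = 0}" by (rule closure_minimal)
  then show ?thesis using assms(2) by blast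
qed

lemma orthonormal_basis_iff:
  "orthonormal_basis E S \<longleftrightarrow> orthonormal_basis_of (\<lambda>e. e) E S"
proof
  assume E: "orthonormal_basis E S"
  then have S: "S = closure (L2.span E)" by (simp add: orthonormal_basis_def)
  have "f = 0" if "f \<in> S" "\<And>e. e \<in> E \<Longrightarrow> cinner f e = 0" for f
    using orthogonal_to_closure_span[where E = E and f = f and g = f] that S
    by (simp add: cinner_self_eq_norm)
  moreover have "E \<subseteq> S" unfolding S using L2.span_superset closure_subset by blast
  moreover have "L2.subspace S" unfolding S by (intro L2_subspace_closure L2.subspace_span)
  moreover have "closed S" unfolding S by (rule closed_closure)
  moreover have "orthonormal_family (\<lambda>e. e) E"
    using E by (simp add: orthonormal_basis_def orthonormal_family_def)
  ultimately show "orthonormal_basis_of (\<lambda>e. e) E S"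
    unfolding orthonormal_basis_of_def by simp
next
  assume E: "orthonormal_basis_of (\<lambda>e. e) E S"
  have "closure (L2.span E) \<subseteq> S"
    using E by (intro closure_minimal L2.span_minimal) (auto simp: orthonormal_basis_of_def)
  moreover have "S \<subseteq> closure (L2.span E)"
  proof
    fix f assume "f \<in> S"
    show "f \<in> closure (L2.span E)"
      by (rule has_sum_in_closed_subspace[OF _ _ _ orthonormal_expansion[OF E \<open>f \<in> S\<close>]])
         (use L2_subspace_closure[OF L2.subspace_span] subsetD[OF order_trans[OF L2.span_superset closure_subset]] in simp_all)
  qed
  ultimately have "closure (L2.span E) = S" by (rule equalityI)
  moreover have "orthonormal_family (\<lambda>e. e) E" using E by (simp add: orthonormal_basis_of_def)
  ultimately show "orthonormal_basis E S"
    by (simp add: orthonormal_basis_def orthonormal_family_def)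
qed

lemma orthonormal_basisD:
  assumes "orthonormal_basis E S"
  shows "E \<subseteq> S" and "e \<in> E \<Longrightarrow> e' \<in> E \<Longrightarrow> cinner e e' = (if e = e' then 1 else 0)"
  using assms unfolding orthonormal_basis_iff orthonormal_basis_of_def orthonormal_family_def by auto

text \<open>
  Zorn's lemma yields a maximal orthonormal subset of \<open>S\<close> containing \<open>e\<close>. A nonzero vector of \<open>S\<close>
  orthogonal to it could be normalized and added.
\<close>

lemma orthonormal_basis_extending:
  assumes S: "L2.subspace S" "closed S" and e: "e \<in> S" "norm e = 1"
  shows "\<exists>E. e \<in> E \<and> orthonormal_basis E S"
proof -
  define \<A> where "\<A> = {E. e \<in> E \<and> E \<subseteq> S \<and> orthonormal_family (\<lambda>x. x) E}"
  have "{e} \<in> \<A>"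
    using e by (auto simp: \<A>_def orthonormal_family_def cinner_self_eq_norm)
  moreover have "\<Union>\<C> \<in> \<A>" if \<C>: "\<C> \<noteq> {}" "subset.chain \<A> \<C>" for \<C>
  proof -
    have sub: "\<And>E. E \<in> \<C> \<Longrightarrow> E \<in> \<A>" and chain: "\<And>E E'. E \<in> \<C> \<Longrightarrow> E' \<in> \<C> \<Longrightarrow> E \<subseteq> E' \<or> E' \<subseteq> E"
      using \<C>(2) by (auto simp: subset.chain_def)
    have "cinner x y = (if x = y then 1 else 0)" if xy: "x \<in> \<Union>\<C>" "y \<in> \<Union>\<C>" for x y
    proof -
      obtain E where "E \<in> \<C>" "x \<in> E" "y \<in> E" using xy chain by blast
      then show ?thesis using sub by (auto simp: \<A>_def orthonormal_family_def)
    qed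
    then show ?thesis using \<C>(1) sub by (auto simp: \<A>_def orthonormal_family_def)
  qed
  ultimately obtain E where E: "E \<in> \<A>" and max: "\<And>X. X \<in> \<A> \<Longrightarrow> E \<subseteq> X \<Longrightarrow> X = E"
    using subset_Zorn_nonempty[of \<A>] by blast
  have "f = 0" if f: "f \<in> S" "\<forall>x\<in>E. cinner f x = 0" for f
  proof (rule ccontr)
    assume "f \<noteq> 0"
    define g where "g = of_real (1 / norm f) *\<^sub>C f"
    have g: "norm g = 1" using \<open>f \<noteq> 0\<close> by (simp add: g_def norm_divide)
    have g_orth: "cinner g x = 0" "cinner x g = 0" if "x \<in> E" for x
      using f(2) that cinner_commute[of x f] by (auto simp: g_def cinner_cscale_left cinner_cscale_right)
    have "g \<in> S" unfolding g_def by (rule L2.subspace_scale[OF S(1) f(1)])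
    moreover have "g \<notin> E" using g_orth[of g] g by (auto simp: cinner_self_eq_norm)
    ultimately have "insert g E \<in> \<A>"
      using E g g_orth by (auto simp: \<A>_def orthonormal_family_def cinner_self_eq_norm)
    then have "g \<in> E" using max by blast
    then show False using g_orth[of g] g by (simp add: cinner_self_eq_norm)
  qed
  then have "orthonormal_basis E S"
    using E S by (auto simp: orthonormal_basis_iff orthonormal_basis_of_def \<A>_def)
  then show ?thesis using E by (auto simp: \<A>_def)
qed


section \<open>Fourier coefficients and the boundary functions of \<open>H\<^sup>2\<close>\<close>

definition chi :: "int \<Rightarrow> L2" where "chi n = L2_of (\<lambda>z. z powi n)"

definition fourier :: "L2 \<Rightarrow> int \<Rightarrow> complex" where "fourier f n = cinner f (chi n)"

lemma measurable_powi [measurable]: "(\<lambda>z::complex. z powi n) \<in> borel_measurable \<sigma>"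
  by (intro continuous_circle_measurable continuous_on_power_int continuous_on_id) auto

lemma cnj_powi_circle: "z \<in> sphere 0 1 \<Longrightarrow> cnj z powi n = z powi (- n)"
proof -
  assume "z \<in> sphere 0 1"
  then have "cnj z = inverse z"
    using complex_norm_square[of z] by (intro inverse_unique[symmetric]) simp
  then have "cnj z powi n = inverse z powi n" by simp
  then show ?thesis by (simp add: power_int_minus power_int_inverse)
qed

lemma norm_powi_circle: "z \<in> sphere 0 1 \<Longrightarrow> cmod (z powi n) = 1"
  by (simp add: norm_power_int)

lemma square_integrable_powi: "square_integrable (\<lambda>z. z powi n)"
proof -
  have "integrable \<sigma> (\<lambda>z. (cmod (z powi n))\<^sup>2) \<longleftrightarrow> integrable \<sigma> (\<lambda>z. 1 :: real)"
    by (rule Bochner_Integration.integrable_cong) (auto simp: norm_powi_circle)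
  then show ?thesis by (simp add: square_integrable_def)
qed

lemma fun_of_chi: "AE z in \<sigma>. fun_of (chi n) z = z powi n"
  unfolding chi_def by (rule fun_of_L2_of[OF square_integrable_powi])

lemma integral_circle_powi: "(LINT z|\<sigma>. z powi n) = (if n = 0 then 1 else 0)"
proof (cases "n \<ge> 0")
  case True
  then show ?thesis using integral_circle_power[of "nat n"] by (simp add: power_int_def)
next
  case False
  have "(LINT z|\<sigma>. z powi n) = (LINT z|\<sigma>. cnj (z ^ nat (- n)))"
  proof (rule Bochner_Integration.integral_cong)
    fix z assume "z \<in> space \<sigma>"
    then show "z powi n = cnj (z ^ nat (- n))"
      using False cnj_powi_circle[of z "- n"] by (simp add: power_int_def)
  qed simp
  also have "\<dots> = cnj ((LINT z|\<sigma>. z ^ nat (- n)))"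
    by (rule Bochner_Integration.integral_cnj)
  also have "\<dots> = 0" using False by (simp only: integral_circle_power) simp
  finally show ?thesis using False by simp
qed

lemma powi_mult_circle:
  fixes z :: complex
  shows "z \<in> sphere 0 1 \<Longrightarrow> z powi m * z powi n = z powi (m + n)"
  by (cases "z = 0") (auto simp: power_int_add)

lemma fourier_L2_of:
  assumes "square_integrable f"
  shows "fourier (L2_of f) n = (LINT z|\<sigma>. f z * z powi (- n))"
  unfolding fourier_def chi_def cinner_L2_of[OF assms square_integrable_powi]
  by (rule Bochner_Integration.integral_cong) (auto simp: cnj_powi_circle)

lemma integrable_mult_powi:
  assumes "square_integrable f"
  shows "integrable \<sigma> (\<lambda>z. f z * z powi n)"
proof -
  have "integrable \<sigma> (\<lambda>z. f z * cnj (z powi (- n)))"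
    by (rule integrable_mult_cnj[OF assms square_integrable_powi])
  also have "?this \<longleftrightarrow> ?thesis"
    by (rule Bochner_Integration.integrable_cong) (auto simp: cnj_powi_circle)
  finally show ?thesis .
qed

lemma fourier_integral: "fourier f n = (LINT z|\<sigma>. fun_of f z * z powi (- n))"
  using fourier_L2_of[OF square_integrable_fun_of, of f n] by simp

lemma fourier_chi: "fourier (chi m) n = (if m = n then 1 else 0)"
proof -
  have "fourier (chi m) n = (LINT z|\<sigma>. z powi (m - n))"
    unfolding chi_def fourier_L2_of[OF square_integrable_powi]
    by (rule Bochner_Integration.integral_cong) (auto simp: powi_mult_circle)
  then show ?thesis by (simp add: integral_circle_powi)
qed

lemma orthonormal_family_chi: "orthonormal_family chi UNIV"
  using fourier_chi by (auto simp: orthonormal_family_def fourier_def)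

lemma fourier_add: "fourier (f + g) n = fourier f n + fourier g n"
  and fourier_diff: "fourier (f - g) n = fourier f n - fourier g n"
  and fourier_cscale: "fourier (c *\<^sub>C f) n = c * fourier f n"
  and fourier_zero: "fourier 0 n = 0"
  by (simp_all add: fourier_def cinner_add_left cinner_diff_left cinner_cscale_left)

text \<open>
  The positive and the negative part of \<open>h\<close> are densities of two measures with the same moments.
\<close>

lemma real_integrable_eq_0_if_moments_eq_0:
  fixes h :: "complex \<Rightarrow> real"
  assumes h: "integrable \<sigma> h"
    and moments: "\<And>n::nat. (LINT z|\<sigma>. of_real (h z) * z ^ n) = 0"
  shows "AE z in \<sigma>. h z = 0"
proof -
  note [measurable] = borel_measurable_integrable[OF h]
  have pow_meas [measurable]: "(\<lambda>z::complex. z ^ n) \<in> borel_measurable \<sigma>" for n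
    by (intro continuous_circle_measurable continuous_intros)
  \<comment> \<open>For nonnegative integrable \<open>g\<close> the measure \<open>D g\<close> is
    finite and has the moments of \<open>g\<close>.\<close>
  define D where "D g = density \<sigma> (\<lambda>z. ennreal (g z))" for g :: "complex \<Rightarrow> real"
  have D: "finite_measure (D g)" "sets (D g) = sets \<sigma>"
      "integral\<^sup>L (D g) (\<lambda>z. z ^ n) = (LINT z|\<sigma>. of_real (g z) * z ^ n)"
    if g: "integrable \<sigma> g" "\<And>z. g z \<ge> 0" for g n
  proof -
    note [measurable] = borel_measurable_integrable[OF g(1)]
    have "emeasure (D g) (space (D g)) = (\<integral>\<^sup>+z. ennreal (g z) \<partial>\<sigma>)"
      unfolding D_def by (subst emeasure_density) (auto intro!: nn_integral_cong simp del: space_circle_measure)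
    also have "\<dots> = ennreal (integral\<^sup>L \<sigma> g)"
      using g by (intro nn_integral_eq_integral) auto
    finally show "finite_measure (D g)" by (intro finite_measureI) simp
    show "sets (D g) = sets \<sigma>" by (simp add: D_def)
    show "integral\<^sup>L (D g) (\<lambda>z. z ^ n) = (LINT z|\<sigma>. of_real (g z) * z ^ n)"
      unfolding D_def using g(2)
      by (subst integral_density) (auto simp: scaleR_conv_of_real)
  qed
  define p q where "p z = max 0 (h z)" and "q z = max 0 (- h z)" for z
  have int: "integrable \<sigma> p" "integrable \<sigma> q"
    unfolding p_def q_def using h by auto
  have nonneg: "\<And>z. p z \<ge> 0" "\<And>z. q z \<ge> 0" by (auto simp: p_def q_def)
  have int_pow: "integrable \<sigma> (\<lambda>z. complex_of_real (g z) * z ^ n)"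
    if g: "integrable \<sigma> g" for g n
  proof (rule Bochner_Integration.integrable_bound[OF g])
    note [measurable] = borel_measurable_integrable[OF g]
    show "(\<lambda>z. complex_of_real (g z) * z ^ n) \<in> borel_measurable \<sigma>" by measurable
  qed (auto simp: norm_mult norm_power intro!: AE_I2)
  have "D p = D q"
  proof (rule measure_eq_if_moments_eq)
    fix n
    have "(\<lambda>z. of_real (h z) * z ^ n) = (\<lambda>z. complex_of_real (p z) * z ^ n - of_real (q z) * z ^ n)"
      by (auto simp: p_def q_def max_def fun_eq_iff)
    then have "0 = (LINT z|\<sigma>. complex_of_real (p z) * z ^ n)
        - (LINT z|\<sigma>. of_real (q z) * z ^ n)"
      using moments[of n] int_pow[OF int(1), of n] int_pow[OF int(2), of n] by simp
    then show "integral\<^sup>L (D p) (\<lambda>z. z ^ n) = integral\<^sup>L (D q) (\<lambda>z. z ^ n)"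
      using D(3)[OF int(1) nonneg(1)] D(3)[OF int(2) nonneg(2)] by simp
  qed (use D int nonneg in auto)
  then have "AE z in \<sigma>. ennreal (p z) = ennreal (q z)"
    unfolding D_def by (intro circle.density_unique) (auto simp: p_def q_def)
  then show ?thesis
    by eventually_elim (auto simp: p_def q_def max_def split: if_splits)
qed

text \<open>
  The real and the imaginary part are combinations of \<open>f\<close> and \<open>cnj f\<close>, whose moments are Fourier
  coefficients of \<open>f\<close> up to conjugation.
\<close>

lemma fourier_eq_0_imp_eq_0:
  assumes "\<And>n. fourier f n = 0"
  shows "f = 0"
proof -
  have int: "integrable \<sigma> (\<lambda>z. fun_of f z * z ^ n)" for n
    using integrable_mult_powi[OF square_integrable_fun_of, of f "int n"] by simp
  have int': "integrable \<sigma> (\<lambda>z. cnj (fun_of f z) * z ^ n)" for n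
  proof -
    have "integrable \<sigma> (\<lambda>z. z powi n * cnj (fun_of f z))"
      by (rule integrable_mult_cnj[OF square_integrable_powi square_integrable_fun_of])
    then show ?thesis by (simp add: mult.commute)
  qed
  have 1: "(LINT z|\<sigma>. fun_of f z * z ^ n) = 0" for n
    using assms[of "- int n"] by (simp add: fourier_integral)
  have 2: "(LINT z|\<sigma>. cnj (fun_of f z) * z ^ n) = 0" for n
  proof -
    have "(LINT z|\<sigma>. cnj (fun_of f z) * z ^ n)
        = (LINT z|\<sigma>. cnj (fun_of f z * z powi (- int n)))"
      by (intro Bochner_Integration.integral_cong) (auto simp: cnj_powi_circle)
    then show ?thesis
      using assms[of "int n"] by (simp only: Bochner_Integration.integral_cnj fourier_integral) simp
  qed
  have fint: "integrable \<sigma> (fun_of f)" using int[of 0] by simp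
  have "AE z in \<sigma>. Re (fun_of f z) = 0"
  proof (rule real_integrable_eq_0_if_moments_eq_0)
    show "integrable \<sigma> (\<lambda>z. Re (fun_of f z))" using fint by (rule integrable_Re)
    fix n
    have "(\<lambda>z. complex_of_real (Re (fun_of f z)) * z ^ n)
        = (\<lambda>z. (fun_of f z * z ^ n + cnj (fun_of f z) * z ^ n) * (1 / 2))"
      unfolding complex_add_cnj distrib_right[symmetric] by (simp add: fun_eq_iff)
    then show "(LINT z|\<sigma>. complex_of_real (Re (fun_of f z)) * z ^ n) = 0"
      using int[of n] int'[of n] 1[of n] 2[of n] by simp
  qed
  moreover have "AE z in \<sigma>. Im (fun_of f z) = 0"
  proof (rule real_integrable_eq_0_if_moments_eq_0)
    show "integrable \<sigma> (\<lambda>z. Im (fun_of f z))" using fint by (rule integrable_Im)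
    fix n
    have "(\<lambda>z. complex_of_real (Im (fun_of f z)) * z ^ n)
        = (\<lambda>z. (fun_of f z * z ^ n - cnj (fun_of f z) * z ^ n) * (- \<i> / 2))"
      unfolding complex_diff_cnj left_diff_distrib[symmetric] by (auto simp: fun_eq_iff complex_eq_iff)
    then show "(LINT z|\<sigma>. complex_of_real (Im (fun_of f z)) * z ^ n) = 0"
      using int[of n] int'[of n] 1[of n] 2[of n] by simp
  qed
  ultimately have "AE z in \<sigma>. fun_of f z = fun_of 0 z"
    using fun_of_zero by eventually_elim (simp add: complex_eq_iff)
  then show ?thesis by (rule L2_eqI)
qed

lemma fourier_inject: "(\<And>n. fourier f n = fourier g n) \<Longrightarrow> f = g"
  using fourier_eq_0_imp_eq_0[of "f - g"] by (simp add: fourier_diff)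

lemma parseval_norm:
  assumes "orthonormal_basis_of b I S" "f \<in> S"
  shows "((\<lambda>i. (cmod (cinner f (b i)))\<^sup>2) has_sum (norm f)\<^sup>2) I"
proof -
  have "((\<lambda>i. Re (cinner f (b i) * cnj (cinner f (b i)))) has_sum Re (cinner f f)) I"
    by (rule has_sum_bounded_linear[OF bounded_linear_Re parseval[OF assms]])
  moreover have "Re (cinner f (b i) * cnj (cinner f (b i))) = (cmod (cinner f (b i)))\<^sup>2" for i
    by (simp only: complex_norm_square[symmetric] Re_complex_of_real)
  moreover have "Re (cinner f f) = (norm f)\<^sup>2"
    by (simp only: cinner_self_eq_norm Re_complex_of_real)
  ultimately show ?thesis by simp
qed

text \<open>
  This set is \<open>H\<^sup>2\<close>, by \<open>H2_eq_analytic\<close>; as a set cut out by Fourier coefficients it is visibly a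
  closed subspace with the nonnegative powers of \<open>z\<close> as a basis.
\<close>

definition analytic_L2 :: "L2 set" where
  "analytic_L2 = {f. \<forall>n<0. fourier f n = 0}"

lemma orthonormal_basis_analytic: "orthonormal_basis_of (\<lambda>n::nat. chi (int n)) UNIV analytic_L2"
proof -
  have INT: "analytic_L2 = (\<Inter>n\<in>{..<0}. {f. fourier f n = 0})" by (auto simp: analytic_L2_def)
  have "closed {f. fourier f n = 0}" for n
    unfolding fourier_def
    by (intro closed_Collect_eq bounded_linear.continuous_on[OF bounded_linear_cinner_left] continuous_intros)
  then have "closed analytic_L2" unfolding INT by (intro closed_INT) simp
  moreover have "L2.subspace analytic_L2"
    by (rule L2.subspaceI) (auto simp: analytic_L2_def fourier_add fourier_cscale fourier_zero)
  moreover have "f = 0" if "f \<in> analytic_L2" "\<And>n::nat. cinner f (chi (int n)) = 0" for f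
  proof (rule fourier_eq_0_imp_eq_0)
    fix n show "fourier f n = 0"
      using that(1) that(2)[of "nat n"] by (cases "n < 0") (auto simp: analytic_L2_def fourier_def)
  qed
  moreover have "orthonormal_family (\<lambda>n::nat. chi (int n)) UNIV"
    using orthonormal_family_chi by (auto simp: orthonormal_family_def)
  ultimately show ?thesis
    by (auto simp: orthonormal_basis_of_def analytic_L2_def fourier_chi)
qed

text \<open>
  On the circle of radius \<open>r < 1\<close> the power series converges absolutely and uniformly and can be
  integrated term by term.
\<close>

lemma dilate_fourier:
  assumes F: "F holomorphic_on ball 0 1" and a: "\<And>z. z \<in> ball 0 1 \<Longrightarrow> (\<lambda>n. a n * z ^ n) sums F z"
    and r: "0 \<le> r" "r < 1"
  shows "square_integrable (\<lambda>z. F (of_real r * z))"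
    and "fourier (L2_of (\<lambda>z. F (of_real r * z))) m = (if m < 0 then 0 else a (nat m) * of_real r ^ nat m)"
proof -
  have in_ball: "of_real r * z \<in> ball 0 1" if "z \<in> sphere 0 1" for z :: complex
    using that r by (simp add: norm_mult)
  have cont: "continuous_on (sphere 0 1) (\<lambda>z. F (of_real r * z))"
    by (rule continuous_on_compose2[OF holomorphic_on_imp_continuous_on[OF F]])
       (use in_ball in \<open>auto intro!: continuous_intros\<close>)
  note [measurable] = continuous_circle_measurable[OF cont]
  obtain B where B: "\<And>z. z \<in> sphere 0 1 \<Longrightarrow> cmod (F (of_real r * z)) \<le> B"
    using compact_imp_bounded[OF compact_continuous_image[OF cont compact_sphere]]
    unfolding bounded_iff by blast
  have "AE z in \<sigma>. cmod (F (of_real r * z)) \<le> B"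
    using B by (intro AE_I2) auto
  from square_integrable_mult_bounded[OF continuous_circle_measurable[OF cont] this square_integrable_const[of 1]]
  show sq: "square_integrable (\<lambda>z. F (of_real r * z))" by simp
  \<comment> \<open>Convergence at the point \<open>R\<close> between \<open>r\<close> and 1 gives
    absolute convergence at \<open>r\<close>.\<close>
  define R where "R = (1 + r) / 2"
  have R: "r < R" "R < 1" using r by (auto simp: R_def)
  have "summable (\<lambda>n. a n * of_real R ^ n)"
    using a[of "of_real R"] R r by (intro sums_summable) auto
  then have "summable (\<lambda>n. norm (a n * of_real r ^ n))"
    by (rule powser_insidea) (use r R in auto)
  then have summ: "summable (\<lambda>n. cmod (a n) * r ^ n)"
    using r by (simp add: norm_mult norm_power)
  let ?g = "\<lambda>n z. a n * of_real r ^ n * z powi (int n - m)"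
  have g_norm: "cmod (?g n z) = cmod (a n) * r ^ n" if "z \<in> sphere 0 1" for n z
    using r norm_powi_circle[OF that] by (simp add: norm_mult norm_power)
  have g_int: "integrable \<sigma> (?g n)" for n
    using square_integrable_powi[of "int n - m"] integrable_mult_cnj[OF square_integrable_powi square_integrable_const, of "int n - m" 1]
    by simp
  have "fourier (L2_of (\<lambda>z. F (of_real r * z))) m = (LINT z|\<sigma>. (\<Sum>n. ?g n z))"
    unfolding fourier_L2_of[OF sq]
  proof (rule Bochner_Integration.integral_cong)
    fix z assume "z \<in> space \<sigma>"
    then have z: "z \<in> sphere 0 1" by simp
    have "(\<lambda>n. a n * (of_real r * z) ^ n * z powi (- m)) sums (F (of_real r * z) * z powi (- m))"
      by (rule sums_mult2[OF a[OF in_ball[OF z]]])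
    moreover have "a n * (of_real r * z) ^ n * z powi (- m) = ?g n z" for n
      using powi_mult_circle[OF z, of "int n" "- m"] by (simp add: power_mult_distrib)
    ultimately show "F (of_real r * z) * z powi (- m) = (\<Sum>n. ?g n z)"
      by (simp add: sums_iff)
  qed simp
  also have "\<dots> = (\<Sum>n. integral\<^sup>L \<sigma> (?g n))"
  proof (rule integral_suminf[OF g_int])
    show "AE z in \<sigma>. summable (\<lambda>n. norm (?g n z))"
      using summ by (intro AE_I2) (simp add: g_norm)
    have "(LINT z|\<sigma>. norm (?g n z)) = cmod (a n) * r ^ n" for n
    proof -
      have "(LINT z|\<sigma>. norm (?g n z)) = (LINT z|\<sigma>. cmod (a n) * r ^ n)"
        by (rule Bochner_Integration.integral_cong) (auto simp: g_norm)
      then show ?thesis using circle.prob_space by simp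
    qed
    then show "summable (\<lambda>n. (LINT z|\<sigma>. norm (?g n z)))" using summ by simp
  qed
  also have "\<dots> = (\<Sum>n. if n = nat m then (if m < 0 then 0 else a (nat m) * of_real r ^ nat m) else 0)"
    by (rule arg_cong[where f = suminf]) (auto simp: integral_circle_powi fun_eq_iff)
  also have "\<dots> = (if m < 0 then 0 else a (nat m) * of_real r ^ nat m)"
    using suminf_finite[of "{nat m}" "\<lambda>n. if n = nat m then (if m < 0 then 0 else a (nat m) * of_real r ^ nat m) else 0"] by simp
  finally show "fourier (L2_of (\<lambda>z. F (of_real r * z))) m = (if m < 0 then 0 else a (nat m) * of_real r ^ nat m)" .
qed

text \<open>
  The squared distance from the dilate to \<open>f\<close> is the sum of \<open>\<bar>a\<^sub>n\<bar>\<^sup>2 (1 - r\<^sup>n)\<^sup>2\<close>. Its terms tend to 0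
  as \<open>r\<close> increases to 1 and are dominated by \<open>\<bar>a\<^sub>n\<bar>\<^sup>2\<close>, so Tannery's theorem applies.
\<close>

lemma boundary_eqI:
  assumes F: "F holomorphic_on ball 0 1" and a: "\<And>z. z \<in> ball 0 1 \<Longrightarrow> (\<lambda>n. a n * z ^ n) sums F z"
    and f: "f \<in> analytic_L2" "\<And>n. fourier f (int n) = a n"
  shows "boundary F = f"
  unfolding boundary_def
proof (rule tendsto_Lim)
  let ?F = "\<lambda>r. L2_of (\<lambda>z. F (of_real r * z))"
  have subspace: "L2.subspace analytic_L2"
    using orthonormal_basis_analytic by (simp add: orthonormal_basis_of_def)
  have norm_eq: "(norm (?F r - f))\<^sup>2 = (\<Sum>n. (cmod (a n))\<^sup>2 * (1 - r ^ n)\<^sup>2)" if r: "0 < r" "r < 1" for r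
  proof -
    have "?F r \<in> analytic_L2"
      using dilate_fourier(2)[OF F a] r by (simp add: analytic_L2_def)
    then have "?F r - f \<in> analytic_L2" by (rule L2.subspace_diff[OF subspace _ f(1)])
    from has_sum_imp_sums[OF parseval_norm[OF orthonormal_basis_analytic this]]
    have "(norm (?F r - f))\<^sup>2 = (\<Sum>n. (cmod (fourier (?F r - f) (int n)))\<^sup>2)"
      by (simp add: sums_iff fourier_def)
    moreover have "(cmod (fourier (?F r - f) (int n)))\<^sup>2 = (cmod (a n))\<^sup>2 * (1 - r ^ n)\<^sup>2" for n
    proof -
      have "fourier (?F r - f) (int n) = a n * of_real (r ^ n - 1)"
        using dilate_fourier(2)[OF F a, of r "int n"] r f(2) by (simp add: fourier_diff algebra_simps)
      then show ?thesis
        by (simp only: norm_mult power_mult_distrib norm_of_real power2_abs power2_commute[of "r ^ n"])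
    qed
    ultimately show ?thesis by simp
  qed
  have ev: "\<forall>\<^sub>F r in at_left (1::real). 0 < r \<and> r < 1"
    using eventually_at_left_real[of 0 1] by (simp add: greaterThanLessThan_def greaterThan_def lessThan_def Int_def conj_commute)
  have "((\<lambda>r. \<Sum>n. (cmod (a n))\<^sup>2 * (1 - r ^ n)\<^sup>2) \<longlongrightarrow> (\<Sum>n. 0)) (at_left (1::real))"
  proof (rule conjunct2[OF conjunct2[OF tannerys_theorem]])
    show "summable (\<lambda>n. (cmod (a n))\<^sup>2)"
      using has_sum_imp_sums[OF parseval_norm[OF orthonormal_basis_analytic f(1)]] f(2)
      by (simp add: sums_iff fourier_def)
    show "((\<lambda>r. (cmod (a k))\<^sup>2 * (1 - r ^ k)\<^sup>2) \<longlongrightarrow> 0) (at_left (1::real))" for k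
      by (auto intro!: tendsto_eq_intros)
    have "norm ((cmod (a k))\<^sup>2 * (1 - r ^ k)\<^sup>2) \<le> (cmod (a k))\<^sup>2" if "0 < r \<and> r < 1" for k and r :: real
      using that by (auto simp: norm_mult abs_square_le_1 power_le_one intro!: mult_left_le)
    then show "\<forall>\<^sub>F (k, r) in at_top \<times>\<^sub>F at_left 1. norm ((cmod (a k))\<^sup>2 * (1 - r ^ k)\<^sup>2) \<le> (cmod (a k))\<^sup>2"
      unfolding eventually_prod_filter
      by (intro exI[of _ "\<lambda>_. True"] exI[of _ "\<lambda>r. 0 < r \<and> r < 1"]) (use ev in auto)
  qed simp
  moreover have "\<forall>\<^sub>F r in at_left 1. (norm (?F r - f))\<^sup>2 = (\<Sum>n. (cmod (a n))\<^sup>2 * (1 - r ^ n)\<^sup>2)"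
    using ev by (rule eventually_mono) (use norm_eq in blast)
  ultimately have "((\<lambda>r. (norm (?F r - f))\<^sup>2) \<longlongrightarrow> 0) (at_left 1)"
    by (simp add: tendsto_cong)
  then have "((\<lambda>r. sqrt ((norm (?F r - f))\<^sup>2)) \<longlongrightarrow> sqrt 0) (at_left 1)"
    by (rule tendsto_real_sqrt)
  then have "((\<lambda>r. norm (?F r - f)) \<longlongrightarrow> 0) (at_left 1)" by simp
  then show "(?F \<longlongrightarrow> f) (at_left 1)"
    by (simp add: tendsto_iff dist_norm)
qed simp

lemma holomorphic_taylor:
  assumes "F holomorphic_on ball 0 1" "z \<in> ball 0 1"
  shows "(\<lambda>n. (deriv ^^ n) F 0 / fact n * z ^ n) sums F z"
  using holomorphic_power_series[OF assms] by simp

text \<open>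
  Bessel's inequality for the dilates bounds the sums of \<open>\<bar>a\<^sub>n\<bar>\<^sup>2 r\<^bsup>2n\<^esup>\<close> uniformly in \<open>r\<close>, so the
  Taylor coefficients are square summable and are the Fourier coefficients of some \<open>f\<close>.
\<close>

lemma hardy_disc_boundary:
  assumes F: "F \<in> hardy_disc"
  shows "boundary F \<in> analytic_L2" "fourier (boundary F) (int n) = (deriv ^^ n) F 0 / fact n"
proof -
  define a where "a n = (deriv ^^ n) F 0 / fact n" for n
  have hol: "F holomorphic_on ball 0 1"
    and bdd: "bdd_above ((\<lambda>r. LINT z|\<sigma>. (cmod (F (of_real r * z)))\<^sup>2) ` {0..<1})"
    using F by (auto simp: hardy_disc_def)
  have a: "\<And>z. z \<in> ball 0 1 \<Longrightarrow> (\<lambda>n. a n * z ^ n) sums F z"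
    unfolding a_def by (rule holomorphic_taylor[OF hol])
  obtain B where B: "\<And>r. 0 \<le> r \<Longrightarrow> r < 1 \<Longrightarrow> (LINT z|\<sigma>. (cmod (F (of_real r * z)))\<^sup>2) \<le> B"
    using bdd unfolding bdd_above_def by (metis atLeastLessThan_iff imageI)
  have bound: "(\<Sum>n\<in>A. (cmod (a n))\<^sup>2) \<le> B" if A: "finite A" for A
  proof (rule tendsto_upperbound)
    show "((\<lambda>r. \<Sum>n\<in>A. (cmod (a n * of_real r ^ n))\<^sup>2) \<longlongrightarrow> (\<Sum>n\<in>A. (cmod (a n))\<^sup>2)) (at_left (1::real))"
      by (auto intro!: tendsto_eq_intros sum.cong)
    have le: "(\<Sum>n\<in>A. (cmod (a n * of_real r ^ n))\<^sup>2) \<le> B" if r: "0 < r" "r < 1" for r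
    proof -
      let ?f = "L2_of (\<lambda>z. F (of_real r * z))"
      have sq: "square_integrable (\<lambda>z. F (of_real r * z))"
        using dilate_fourier(1)[OF hol a] r by simp
      have "(\<Sum>n\<in>A. (cmod (cinner ?f (chi (int n))))\<^sup>2) \<le> (norm ?f)\<^sup>2"
        using orthonormal_basis_analytic A
        by (intro bessel_inequality) (auto simp: orthonormal_basis_of_def)
      moreover have "cinner ?f (chi (int n)) = a n * of_real r ^ n" for n
        using dilate_fourier(2)[OF hol a, of r "int n"] r by (simp add: fourier_def)
      ultimately show ?thesis using B[of r] r norm_L2_of_power2[OF sq] by simp
    qed
    show "\<forall>\<^sub>F r in at_left (1::real). (\<Sum>n\<in>A. (cmod (a n * of_real r ^ n))\<^sup>2) \<le> B"
      by (rule eventually_mono[OF eventually_at_left_real[of 0]]) (use le in auto)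
  qed simp
  obtain f where f: "f \<in> analytic_L2" "\<And>n::nat. cinner f (chi (int n)) = a n"
    using riesz_fischer_coefficients[OF orthonormal_basis_analytic bound] by auto
  have "boundary F = f"
    by (rule boundary_eqI[OF hol a f(1)]) (auto simp: fourier_def f(2))
  then show "boundary F \<in> analytic_L2" "fourier (boundary F) (int n) = (deriv ^^ n) F 0 / fact n"
    using f by (simp_all add: fourier_def a_def)
qed

text \<open>
  Conversely, the power series with the Fourier coefficients of \<open>f\<close> converges in the disc, and
  Parseval's identity bounds the norms of its dilates by the norm of \<open>f\<close>.
\<close>

lemma H2_eq_analytic: "H2 = analytic_L2"
proof
  show "H2 \<subseteq> analytic_L2" using hardy_disc_boundary(1) by (auto simp: H2_def)
  show "analytic_L2 \<subseteq> H2"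
  proof
    fix f assume f: "f \<in> analytic_L2"
    define a where "a n = fourier f (int n)" for n :: nat
    define F where "F z = (\<Sum>n. a n * z ^ n)" for z
    have "norm (chi n) = 1" for n
    proof -
      have "(norm (chi n))\<^sup>2 = 1"
        using fourier_chi[of n n] by (simp add: fourier_def cinner_self_eq_norm flip: of_real_power)
      then show ?thesis using norm_ge_zero[of "chi n"] by (auto simp: power2_eq_1_iff)
    qed
    then have a_le: "cmod (a n) \<le> norm f" for n
      using cinner_norm_le[of f "chi (int n)"] by (simp add: a_def fourier_def)
    have a_sums: "(\<lambda>n. a n * z ^ n) sums F z" if "z \<in> ball 0 1" for z
    proof -
      have "summable (\<lambda>n. norm f * cmod z ^ n)"
        using that by (intro summable_mult summable_geometric) simp
      then have "summable (\<lambda>n. a n * z ^ n)"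
        by (rule summable_comparison_test'[where N = 0])
           (auto simp: norm_mult norm_power intro!: mult_right_mono a_le)
      then show ?thesis unfolding F_def by (rule summable_sums)
    qed
    have hol: "F holomorphic_on ball 0 1"
      by (rule power_series_holomorphic[where a = a]) (use a_sums in auto)
    have "(LINT z|\<sigma>. (cmod (F (of_real r * z)))\<^sup>2) \<le> (norm f)\<^sup>2" if r: "0 \<le> r" "r < 1" for r
    proof -
      let ?f = "L2_of (\<lambda>z. F (of_real r * z))"
      have sq: "square_integrable (\<lambda>z. F (of_real r * z))"
        using dilate_fourier(1)[OF hol a_sums] r by simp
      have "?f \<in> analytic_L2"
        using dilate_fourier(2)[OF hol a_sums] r by (simp add: analytic_L2_def)
      note ps = parseval_norm[OF orthonormal_basis_analytic this] parseval_norm[OF orthonormal_basis_analytic f]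
      have "(norm ?f)\<^sup>2 \<le> (norm f)\<^sup>2"
      proof (rule has_sum_mono[OF ps])
        fix n :: nat
        have "cinner ?f (chi (int n)) = a n * of_real r ^ n"
          using dilate_fourier(2)[OF hol a_sums, of r "int n"] r by (simp add: fourier_def)
        then have "cmod (cinner ?f (chi (int n))) = cmod (a n) * r ^ n"
          using r by (simp add: norm_mult norm_power)
        also have "\<dots> \<le> cmod (a n)" using r by (intro mult_left_le power_le_one) auto
        finally show "(cmod (cinner ?f (chi (int n))))\<^sup>2 \<le> (cmod (cinner f (chi (int n))))\<^sup>2"
          by (intro power_mono) (auto simp: a_def fourier_def)
      qed
      then show ?thesis unfolding norm_L2_of_power2[OF sq] .
    qed
    then have "F \<in> hardy_disc"
      using hol by (auto simp: hardy_disc_def intro!: bdd_aboveI2)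
    moreover have "boundary F = f"
      by (rule boundary_eqI[OF hol a_sums f]) (auto simp: a_def)
    ultimately show "f \<in> H2" unfolding H2_def by blast
  qed
qed

lemma orthonormal_basis_H2: "orthonormal_basis_of (\<lambda>n::nat. chi (int n)) UNIV H2"
  using orthonormal_basis_analytic by (simp add: H2_eq_analytic)

lemma bounded_analytic_imp_hardy:
  assumes "bounded_analytic u"
  shows "u \<in> hardy_disc"
proof -
  have hol: "u holomorphic_on ball 0 1" using assms by (simp add: bounded_analytic_def)
  obtain B where B: "\<And>z. z \<in> ball 0 1 \<Longrightarrow> cmod (u z) \<le> B"
    using assms unfolding bounded_analytic_def bounded_iff by (metis imageI)
  have "(LINT z|\<sigma>. (cmod (u (of_real r * z)))\<^sup>2) \<le> B\<^sup>2" if r: "0 \<le> r" "r < 1" for r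
  proof (rule circle.integral_le_const)
    show "integrable \<sigma> (\<lambda>z. (cmod (u (of_real r * z)))\<^sup>2)"
      using dilate_fourier(1)[OF hol holomorphic_taylor[OF hol] r] by (simp add: square_integrable_def)
    show "AE z in \<sigma>. (cmod (u (of_real r * z)))\<^sup>2 \<le> B\<^sup>2"
      using r by (intro AE_I2 power_mono B) (auto simp: norm_mult)
  qed
  then show ?thesis using hol by (auto simp: hardy_disc_def intro!: bdd_aboveI2)
qed


section \<open>Toeplitz operators and the decomposition of \<open>H\<^sup>2\<close> along an inner function\<close>

lemma square_integrable_mult_op:
  "essentially_bounded \<phi> \<Longrightarrow> square_integrable (\<lambda>z. \<phi> z * fun_of f z)"
  using square_integrable_mult_bounded[OF _ _ square_integrable_fun_of]
  by (auto simp: essentially_bounded_def)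

lemma fun_of_mult_op:
  "essentially_bounded \<phi> \<Longrightarrow> AE z in \<sigma>. fun_of (mult_op \<phi> f) z = \<phi> z * fun_of f z"
  unfolding mult_op_def by (intro fun_of_L2_of square_integrable_mult_op)

lemma essentially_bounded_cnj:
  assumes "essentially_bounded \<phi>"
  shows "essentially_bounded (\<lambda>z. cnj (\<phi> z))"
  using assms by (auto simp: essentially_bounded_def)

lemma essentially_bounded_unimodular:
  assumes "\<phi> \<in> borel_measurable \<sigma>" "AE z in \<sigma>. cmod (\<phi> z) = 1"
  shows "essentially_bounded \<phi>"
  using assms by (auto simp: essentially_bounded_def intro!: exI[of _ 1])

lemma essentially_bounded_mult:
  assumes "essentially_bounded \<phi>" "essentially_bounded \<psi>"
  shows "essentially_bounded (\<lambda>z. \<phi> z * \<psi> z)"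
proof -
  obtain M N where M: "AE z in \<sigma>. cmod (\<phi> z) \<le> M" and N: "AE z in \<sigma>. cmod (\<psi> z) \<le> N"
    using assms by (auto simp: essentially_bounded_def)
  have "AE z in \<sigma>. cmod (\<phi> z * \<psi> z) \<le> M * N"
    using M N by eventually_elim (auto simp: norm_mult intro!: mult_mono intro: order_trans[OF norm_ge_zero])
  then show ?thesis
    using assms by (auto simp: essentially_bounded_def)
qed

lemma cinner_mult_op:
  assumes "essentially_bounded \<phi>"
  shows "cinner (mult_op \<phi> f) g = (LINT z|\<sigma>. \<phi> z * fun_of f z * cnj (fun_of g z))"
  using cinner_L2_of[OF square_integrable_mult_op[OF assms] square_integrable_fun_of, of f g]
  by (simp add: mult_op_def)

lemma cinner_mult_op_adjoint:
  assumes "essentially_bounded \<phi>"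
  shows "cinner (mult_op \<phi> f) g = cinner f (mult_op (\<lambda>z. cnj (\<phi> z)) g)"
  using cinner_L2_of[OF square_integrable_fun_of square_integrable_mult_op[OF essentially_bounded_cnj[OF assms]], of f g]
  unfolding mult_op_def[symmetric] L2_of_fun_of
  by (simp add: cinner_mult_op[OF assms] mult.assoc mult.left_commute)

lemma mult_op_add:
  assumes "essentially_bounded \<phi>"
  shows "mult_op \<phi> (f + g) = mult_op \<phi> f + mult_op \<phi> g"
proof (rule L2_eqI)
  show "AE z in \<sigma>. fun_of (mult_op \<phi> (f + g)) z = fun_of (mult_op \<phi> f + mult_op \<phi> g) z"
    using fun_of_mult_op[OF assms, of "f + g"] fun_of_mult_op[OF assms, of f] fun_of_mult_op[OF assms, of g]
      fun_of_add[of f g] fun_of_add[of "mult_op \<phi> f" "mult_op \<phi> g"]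
    by eventually_elim (simp add: distrib_left)
qed

lemma mult_op_cscale:
  assumes "essentially_bounded \<phi>"
  shows "mult_op \<phi> (c *\<^sub>C f) = c *\<^sub>C mult_op \<phi> f"
proof (rule L2_eqI)
  show "AE z in \<sigma>. fun_of (mult_op \<phi> (c *\<^sub>C f)) z = fun_of (c *\<^sub>C mult_op \<phi> f) z"
    using fun_of_mult_op[OF assms, of "c *\<^sub>C f"] fun_of_mult_op[OF assms, of f]
      fun_of_cscale[of c f] fun_of_cscale[of c "mult_op \<phi> f"]
    by eventually_elim simp
qed

lemma mult_op_mult_op:
  assumes "essentially_bounded \<phi>" "essentially_bounded \<psi>"
  shows "mult_op \<phi> (mult_op \<psi> f) = mult_op (\<lambda>z. \<phi> z * \<psi> z) f"
proof (rule L2_eqI)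
  show "AE z in \<sigma>. fun_of (mult_op \<phi> (mult_op \<psi> f)) z = fun_of (mult_op (\<lambda>z. \<phi> z * \<psi> z) f) z"
    using fun_of_mult_op[OF assms(1), of "mult_op \<psi> f"] fun_of_mult_op[OF assms(2), of f]
      fun_of_mult_op[OF essentially_bounded_mult[OF assms], of f]
    by eventually_elim simp
qed

lemma bounded_linear_mult_op:
  assumes "essentially_bounded \<phi>"
  shows "bounded_linear (mult_op \<phi>)"
proof -
  obtain M where M: "AE z in \<sigma>. cmod (\<phi> z) \<le> M"
    using assms by (auto simp: essentially_bounded_def)
  have "norm (mult_op \<phi> f) \<le> norm f * \<bar>M\<bar>" for f
  proof -
    have "(norm (mult_op \<phi> f))\<^sup>2 \<le> (LINT z|\<sigma>. M\<^sup>2 * (cmod (fun_of f z))\<^sup>2)"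
      unfolding norm_power2_integral
    proof (rule integral_mono_AE)
      show "AE z in \<sigma>. (cmod (fun_of (mult_op \<phi> f) z))\<^sup>2 \<le> M\<^sup>2 * (cmod (fun_of f z))\<^sup>2"
        using M fun_of_mult_op[OF assms, of f]
        by eventually_elim (auto simp: norm_mult power_mult_distrib intro!: mult_right_mono power_mono)
    qed (use integrable_norm_fun_of_power2 in auto)
    also have "\<dots> = (norm f * \<bar>M\<bar>)\<^sup>2"
      by (simp add: norm_power2_integral power_mult_distrib mult.commute)
    finally show ?thesis by (rule power2_le_imp_le) simp
  qed
  then show ?thesis
    by (intro bounded_linear_intro[where K = "\<bar>M\<bar>"])
       (simp_all add: mult_op_add[OF assms] mult_op_cscale[OF assms] scaleR_L2_def)
qed

lemma H2_subspace: "L2.subspace H2"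
  and H2_closed: "closed H2"
  and chi_in_H2: "chi (int n) \<in> H2"
  using orthonormal_basis_H2 by (auto simp: orthonormal_basis_of_def)

lemma hardy_projection_unique:
  assumes "g \<in> H2" "\<And>h. h \<in> H2 \<Longrightarrow> cinner (f - g) h = 0"
  shows "hardy_projection f = g"
  unfolding hardy_projection_def
proof (rule the_equality)
  show "g \<in> H2 \<and> (\<forall>h\<in>H2. cinner (f - g) h = 0)" using assms by blast
  fix g' assume g': "g' \<in> H2 \<and> (\<forall>h\<in>H2. cinner (f - g') h = 0)"
  then have "g - g' \<in> H2" using assms(1) L2.subspace_diff[OF H2_subspace] by blast
  then have "cinner (f - g') (g - g') - cinner (f - g) (g - g') = 0" using g' assms(2) by simp
  then have "cinner (g - g') (g - g') = 0" by (simp add: cinner_diff_left)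
  then show "g' = g" by (simp add: cinner_self_eq_norm)
qed

lemma hardy_projection:
  shows "hardy_projection f \<in> H2"
    and "h \<in> H2 \<Longrightarrow> cinner (hardy_projection f) h = cinner f h"
proof -
  obtain g where g: "g \<in> H2" "\<And>h. h \<in> H2 \<Longrightarrow> cinner (f - g) h = 0"
    using orthonormal_projection[OF orthonormal_basis_H2, of f] by metis
  then have "hardy_projection f = g" by (rule hardy_projection_unique)
  then show "hardy_projection f \<in> H2" "h \<in> H2 \<Longrightarrow> cinner (hardy_projection f) h = cinner f h"
    using g by (auto simp: cinner_diff_left)
qed

lemma toeplitz_in_H2: "toeplitz \<phi> f \<in> H2"
  by (simp add: toeplitz_def hardy_projection)

lemma cinner_toeplitz: "h \<in> H2 \<Longrightarrow> cinner (toeplitz \<phi> f) h = cinner (mult_op \<phi> f) h"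
  by (simp add: toeplitz_def hardy_projection)

lemma adjoint_toeplitz:
  assumes "essentially_bounded \<phi>" "g \<in> H2"
  shows "adjoint_H2 (toeplitz \<phi>) g = toeplitz (\<lambda>z. cnj (\<phi> z)) g"
  unfolding adjoint_H2_def
proof (rule the_equality)
  have *: "cinner (toeplitz \<phi> f) g = cinner f (toeplitz (\<lambda>z. cnj (\<phi> z)) g)" if "f \<in> H2" for f
  proof -
    have "cinner (toeplitz \<phi> f) g = cinner f (mult_op (\<lambda>z. cnj (\<phi> z)) g)"
      using assms by (simp add: cinner_toeplitz cinner_mult_op_adjoint)
    also have "\<dots> = cnj (cinner (toeplitz (\<lambda>z. cnj (\<phi> z)) g) f)"
      using that by (subst cinner_commute) (simp add: cinner_toeplitz)
    finally show ?thesis using cinner_commute[of f "toeplitz (\<lambda>z. cnj (\<phi> z)) g"] by simp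
  qed
  then show "toeplitz (\<lambda>z. cnj (\<phi> z)) g \<in> H2 \<and> (\<forall>f\<in>H2. cinner (toeplitz \<phi> f) g = cinner f (toeplitz (\<lambda>z. cnj (\<phi> z)) g))"
    by (simp add: toeplitz_in_H2)
  fix k assume k: "k \<in> H2 \<and> (\<forall>f\<in>H2. cinner (toeplitz \<phi> f) g = cinner f k)"
  let ?d = "k - toeplitz (\<lambda>z. cnj (\<phi> z)) g"
  have "?d \<in> H2" using k toeplitz_in_H2 by (intro L2.subspace_diff[OF H2_subspace]) auto
  then have "cinner ?d k = cinner ?d (toeplitz (\<lambda>z. cnj (\<phi> z)) g)" using k * by force
  then have "cinner ?d ?d = 0" by (simp add: cinner_diff_right)
  then show "k = toeplitz (\<lambda>z. cnj (\<phi> z)) g" by (simp add: cinner_self_eq_norm)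
qed

text \<open>
  This is the boundary function of the reproducing kernel of \<open>H\<^sup>2\<close>; see
  \<open>cinner_boundary_szego\<close>.
\<close>

definition szego_kernel :: "complex \<Rightarrow> L2" where
  "szego_kernel b = L2_of (\<lambda>z. 1 / (1 - cnj b * z))"

lemma
  assumes b: "b \<in> ball 0 1"
  shows square_integrable_szego: "square_integrable (\<lambda>z. 1 / (1 - cnj b * z))"
    and fourier_szego: "fourier (szego_kernel b) m = (if m < 0 then 0 else cnj b ^ nat m)"
proof -
  \<comment> \<open>The kernel is the dilate by \<open>s\<close> of the geometric series with ratio
    \<open>cnj b / s\<close>, which converges on the whole unit disc.\<close>
  define s where "s = (1 + cmod b) / 2"
  have s: "0 < s" "s < 1" "cmod b < s" using b by (auto simp: s_def intro: add_pos_nonneg)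
  define c where "c = cnj b / of_real s"
  have c: "cmod c < 1" using s by (simp add: c_def norm_divide)
  have nz: "1 - c * z \<noteq> 0" if "z \<in> ball 0 1" for z
  proof
    assume "1 - c * z = 0"
    then have "cmod (c * z) = 1" by simp
    moreover have "cmod c * cmod z < 1 * 1" using c that by (intro mult_strict_mono') auto
    ultimately show False by (simp add: norm_mult)
  qed
  have hol: "(\<lambda>z. 1 / (1 - c * z)) holomorphic_on ball 0 1"
    using nz by (intro holomorphic_intros) auto
  have sums: "(\<lambda>n. c ^ n * z ^ n) sums (1 / (1 - c * z))" if "z \<in> ball 0 1" for z
  proof -
    have "cmod c * cmod z < 1 * 1" using c that by (intro mult_strict_mono') auto
    then show ?thesis
      using geometric_sums[of "c * z"] by (simp add: norm_mult power_mult_distrib)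
  qed
  have eq: "(\<lambda>z. 1 / (1 - c * (of_real s * z))) = (\<lambda>z. 1 / (1 - cnj b * z))"
    using s by (simp add: c_def)
  show "square_integrable (\<lambda>z. 1 / (1 - cnj b * z))"
    using dilate_fourier(1)[OF hol sums, of s] s unfolding eq by simp
  have "c ^ n * of_real s ^ n = cnj b ^ n" for n
    using s by (simp add: c_def power_divide)
  then show "fourier (szego_kernel b) m = (if m < 0 then 0 else cnj b ^ nat m)"
    using dilate_fourier(2)[OF hol sums, of s m] s unfolding eq szego_kernel_def by simp
qed

lemma szego_in_H2: "b \<in> ball 0 1 \<Longrightarrow> szego_kernel b \<in> H2"
  by (simp add: H2_eq_analytic analytic_L2_def fourier_szego)

lemma cinner_szego_has_sum:
  assumes "f \<in> H2" "b \<in> ball 0 1"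
  shows "((\<lambda>n. fourier f (int n) * b ^ n) has_sum cinner f (szego_kernel b)) UNIV"
  using parseval[OF orthonormal_basis_H2 assms(1), of "szego_kernel b"] fourier_szego[OF assms(2)]
  by (simp add: fourier_def)

lemma cinner_boundary_szego:
  assumes F: "F \<in> hardy_disc" and b: "b \<in> ball 0 1"
  shows "cinner (boundary F) (szego_kernel b) = F b"
proof -
  have "boundary F \<in> H2" using F by (simp add: H2_def)
  from has_sum_imp_sums[OF cinner_szego_has_sum[OF this b]]
  have "(\<lambda>n. (deriv ^^ n) F 0 / fact n * b ^ n) sums cinner (boundary F) (szego_kernel b)"
    by (simp add: hardy_disc_boundary(2)[OF F])
  moreover have "(\<lambda>n. (deriv ^^ n) F 0 / fact n * b ^ n) sums F b"
    using F b by (intro holomorphic_taylor) (auto simp: hardy_disc_def)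
  ultimately show ?thesis by (rule sums_unique2)
qed

text \<open>
  The zero does double duty. It puts a bounded function with a bounded inverse, the Szego kernel at
  \<open>a\<close>, into the model space, and it excludes constant inner functions.
\<close>

locale inner_with_zero =
  fixes u :: "complex \<Rightarrow> complex" and a :: complex
  assumes inner_u: "inner_function u" and a_in_disc: "a \<in> ball 0 1" and zero_at_a: "u a = 0"
begin

abbreviation U :: "complex \<Rightarrow> complex" where "U \<equiv> fun_of (boundary u)"
abbreviation Upow :: "nat \<Rightarrow> L2 \<Rightarrow> L2" where "Upow \<equiv> boundary_power u"
abbreviation K :: "L2 set" where "K \<equiv> model_space u"

lemma u_hardy: "u \<in> hardy_disc"
  using inner_u by (intro bounded_analytic_imp_hardy) (simp add: inner_function_def)

lemma u_in_H2: "boundary u \<in> H2"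
  using u_hardy by (simp add: H2_def)

lemma U_unimodular: "AE z in \<sigma>. cmod (U z) = 1"
  using inner_u by (simp add: inner_function_def)

lemma U_power_bounded: "essentially_bounded (\<lambda>z. U z ^ m)"
proof (rule essentially_bounded_unimodular)
  show "AE z in \<sigma>. cmod (U z ^ m) = 1"
    using U_unimodular by eventually_elim (simp add: norm_power)
qed measurable

lemma fun_of_Upow: "AE z in \<sigma>. fun_of (Upow m f) z = U z ^ m * fun_of f z"
  unfolding boundary_power_def by (rule fun_of_mult_op[OF U_power_bounded])

lemma bounded_linear_Upow: "bounded_linear (Upow m)"
  unfolding boundary_power_def by (rule bounded_linear_mult_op[OF U_power_bounded])

lemma Upow_cscale: "Upow m (c *\<^sub>C f) = c *\<^sub>C Upow m f"
  unfolding boundary_power_def by (rule mult_op_cscale[OF U_power_bounded])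

lemma Upow_Upow: "Upow m (Upow n f) = Upow (m + n) f"
  unfolding boundary_power_def mult_op_mult_op[OF U_power_bounded U_power_bounded]
  by (simp add: power_add)

lemma Upow_0 [simp]: "Upow 0 f = f"
  by (simp add: boundary_power_def mult_op_def)

lemma cinner_Upow_Upow: "cinner (Upow m f) (Upow m g) = cinner f g"
  unfolding cinner_integral
proof (rule integral_cong_AE)
  show "AE z in \<sigma>. fun_of (Upow m f) z * cnj (fun_of (Upow m g) z) = fun_of f z * cnj (fun_of g z)"
    using fun_of_Upow[of m f] fun_of_Upow[of m g] U_unimodular
  proof eventually_elim
    case (elim z)
    have "U z ^ m * cnj (U z ^ m) = of_real ((cmod (U z ^ m))\<^sup>2)" by (simp only: complex_norm_square)
    also have "\<dots> = 1" using elim(3) by (simp add: norm_power)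
    finally have 1: "U z ^ m * cnj (U z ^ m) = 1" .
    have "fun_of (Upow m f) z * cnj (fun_of (Upow m g) z)
        = (U z ^ m * cnj (U z ^ m)) * (fun_of f z * cnj (fun_of g z))"
      unfolding elim(1,2) complex_cnj_mult by (simp only: mult_ac)
    then show ?case by (simp only: 1 mult_1)
  qed
qed measurable

lemma norm_Upow [simp]: "norm (Upow m f) = norm f"
  using cinner_Upow_Upow[of m f f] by (simp add: cinner_self_eq_norm flip: of_real_power)

text \<open>
  Multiplication by \<open>z\<^sup>j\<close> shifts Fourier coefficients. Consequently \<open>u z\<^sup>j\<close> is again in \<open>H\<^sup>2\<close> for
  \<open>j \<ge> 0\<close>, and so \<open>u\<close> multiplies \<open>H\<^sup>2\<close> into itself.
\<close>

lemma fourier_Upow_chi: "fourier (Upow 1 (chi j)) n = fourier (boundary u) (n - j)"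
  unfolding fourier_integral
proof (rule integral_cong_AE)
  have "AE z in \<sigma>. z \<in> sphere 0 1" by (rule AE_I2) simp
  then show "AE z in \<sigma>. fun_of (Upow 1 (chi j)) z * z powi - n = U z * z powi - (n - j)"
    using fun_of_Upow[of 1 "chi j"] fun_of_chi[of j]
  proof eventually_elim
    case (elim z)
    then show ?case using powi_mult_circle[of z j "- n"] by (simp add: mult.assoc)
  qed
qed measurable

lemma Upow_chi_in_H2: "Upow 1 (chi (int n)) \<in> H2"
  using u_in_H2 by (simp only: H2_eq_analytic analytic_L2_def fourier_Upow_chi mem_Collect_eq) simp

lemma Upow_has_sum:
  assumes "f \<in> H2"
  shows "((\<lambda>n::nat. fourier f (int n) *\<^sub>C Upow m (chi (int n))) has_sum Upow m f) UNIV"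
  using has_sum_bounded_linear[OF bounded_linear_Upow orthonormal_expansion[OF orthonormal_basis_H2 assms]]
  by (simp add: Upow_cscale fourier_def)

lemma Upow_in_H2: "f \<in> H2 \<Longrightarrow> Upow m f \<in> H2"
proof (induction m)
  case (Suc m)
  then have "Upow m f \<in> H2" by simp
  from has_sum_in_closed_subspace[OF H2_subspace H2_closed _ Upow_has_sum[OF this, of 1]]
  have "Upow 1 (Upow m f) \<in> H2" using Upow_chi_in_H2 by blast
  then show ?case by (simp add: Upow_Upow)
qed simp

text \<open>
  Evaluation at \<open>b\<close> is multiplicative. For \<open>f = z\<^sup>j\<close> this is the shift of the Fourier coefficients of
  \<open>u\<close>; both sides are linear and continuous in \<open>f\<close>.
\<close>

lemma cinner_Upow_szego:
  assumes f: "f \<in> H2" and b: "b \<in> ball 0 1"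
  shows "cinner (Upow 1 f) (szego_kernel b) = u b * cinner f (szego_kernel b)"
proof -
  have chi: "cinner (Upow 1 (chi (int j))) (szego_kernel b) = u b * b ^ j" for j
  proof -
    let ?g = "\<lambda>n. fourier (Upow 1 (chi (int j))) (int n) * b ^ n"
    have "((\<lambda>n. fourier (boundary u) (int n) * b ^ n * b ^ j) has_sum (u b * b ^ j)) UNIV"
      using cinner_szego_has_sum[OF u_in_H2 b] unfolding cinner_boundary_szego[OF u_hardy b]
      by (rule has_sum_cmult_left)
    also have "(\<lambda>n. fourier (boundary u) (int n) * b ^ n * b ^ j) = ?g \<circ> (\<lambda>n. n + j)"
      by (simp add: fun_eq_iff fourier_Upow_chi power_add del: One_nat_def)
    finally have "(?g has_sum (u b * b ^ j)) (range (\<lambda>n. n + j))"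
      by (subst has_sum_reindex) (simp_all add: o_def)
    \<comment> \<open>The coefficients of index below \<open>j\<close> vanish because
      \<open>u\<close> is analytic.\<close>
    also have "?this \<longleftrightarrow> (?g has_sum (u b * b ^ j)) UNIV"
    proof (rule has_sum_cong_neutral)
      fix n assume "n \<in> UNIV - range (\<lambda>n. n + j)"
      then have "n < j" by (metis DiffD2 le_add_diff_inverse2 not_le rangeI)
      then show "?g n = 0"
        using u_in_H2 by (simp add: fourier_Upow_chi H2_eq_analytic analytic_L2_def del: One_nat_def)
    qed auto
    finally show ?thesis
      using cinner_szego_has_sum[OF Upow_chi_in_H2 b] by (intro has_sum_unique)
  qed
  have "((\<lambda>j. cinner (fourier f (int j) *\<^sub>C Upow 1 (chi (int j))) (szego_kernel b)) has_sum
      cinner (Upow 1 f) (szego_kernel b)) UNIV"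
    by (rule has_sum_bounded_linear[OF bounded_linear_cinner_left Upow_has_sum[OF f]])
  moreover have "((\<lambda>j. u b * (fourier f (int j) * b ^ j)) has_sum (u b * cinner f (szego_kernel b))) UNIV"
    by (rule has_sum_cmult_right[OF cinner_szego_has_sum[OF f b]])
  ultimately show ?thesis
    unfolding cinner_cscale_left chi by (simp add: mult.left_commute has_sum_unique)
qed

lemma cinner_Upow_power_szego:
  assumes "f \<in> H2" "b \<in> ball 0 1"
  shows "cinner (Upow m f) (szego_kernel b) = u b ^ m * cinner f (szego_kernel b)"
proof (induction m)
  case (Suc m)
  have "Upow (Suc m) f = Upow 1 (Upow m f)" by (simp add: Upow_Upow)
  then show ?case
    using cinner_Upow_szego[OF Upow_in_H2[OF assms(1)] assms(2), of m] Suc by simp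
qed simp

lemma K_subset_H2: "K \<subseteq> H2" by (auto simp: model_space_def)

lemma cinner_K_Upow: "f \<in> K \<Longrightarrow> g \<in> H2 \<Longrightarrow> cinner f (Upow (Suc m) g) = 0"
proof -
  assume "f \<in> K" "g \<in> H2"
  then have "cinner f (Upow 1 (Upow m g)) = 0"
    using Upow_in_H2[of g m] unfolding model_space_def by blast
  then show ?thesis by (simp add: Upow_Upow)
qed

lemma K_subspace: "L2.subspace K"
  using H2_subspace
  by (intro L2.subspaceI)
     (auto simp: model_space_def cinner_add_left cinner_cscale_left
        L2.subspace_0 L2.subspace_add L2.subspace_scale)

lemma K_closed: "closed K"
proof -
  have eq: "K = H2 \<inter> (\<Inter>g\<in>H2. {f. cinner f (Upow 1 g) = 0})"
    by (auto simp: model_space_def)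
  have "closed {f. cinner f (Upow 1 g) = 0}" for g
    by (intro closed_Collect_eq bounded_linear.continuous_on[OF bounded_linear_cinner_left] continuous_intros)
  then show ?thesis unfolding eq by (intro closed_Int H2_closed closed_INT) simp
qed

text \<open>
  Functions in \<open>u H\<^sup>2\<close> vanish at the zero \<open>a\<close> of \<open>u\<close>.
\<close>

lemma szego_in_K: "szego_kernel a \<in> K"
proof -
  have "cinner (szego_kernel a) (Upow 1 g) = 0" if "g \<in> H2" for g
    using cinner_Upow_szego[OF that a_in_disc] zero_at_a cinner_commute[of "szego_kernel a" "Upow 1 g"] by simp
  then show ?thesis using szego_in_H2[OF a_in_disc] by (simp add: model_space_def)
qed

text \<open>
  Multiplication by \<open>u\<close> is isometric, so the smaller of the two powers cancels, and \<open>K\<close> is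
  orthogonal to \<open>u H\<^sup>2\<close>.
\<close>

lemma cinner_Upow_K:
  assumes "e \<in> K" "e' \<in> K"
  shows "cinner (Upow m e) (Upow n e') = (if m = n then cinner e e' else 0)"
proof (cases m n rule: linorder_cases)
  case less
  then obtain k where n: "n = m + Suc k" using less_imp_Suc_add by auto
  have "cinner (Upow m e) (Upow n e') = cinner e (Upow (Suc k) e')"
    unfolding n Upow_Upow[symmetric] by (rule cinner_Upow_Upow)
  then show ?thesis using less cinner_K_Upow[of e e' k] assms K_subset_H2 by auto
next
  case greater
  then obtain k where m: "m = n + Suc k" using less_imp_Suc_add by auto
  have "cinner (Upow m e) (Upow n e') = cinner (Upow (Suc k) e) e'"
    unfolding m Upow_Upow[symmetric] by (rule cinner_Upow_Upow)
  also have "\<dots> = 0"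
    using cinner_K_Upow[of e' e k] assms K_subset_H2 by (subst cinner_commute) auto
  finally show ?thesis using greater by simp
qed (simp add: cinner_Upow_Upow)

text \<open>
  The projection \<open>p\<close> of \<open>f\<close> to \<open>u H\<^sup>2\<close> has the expansion coefficients of \<open>f\<close> in the orthonormal family
  \<open>u z\<^sup>n\<close>. The difference \<open>f - p\<close> is in \<open>K\<close> and orthogonal to \<open>f\<close> and to \<open>p\<close>, hence zero.
\<close>

lemma orthogonal_to_K_imp_multiple:
  assumes f: "f \<in> H2" "\<And>k. k \<in> K \<Longrightarrow> cinner f k = 0"
  shows "\<exists>g\<in>H2. f = Upow 1 g"
proof -
  have on: "orthonormal_family (\<lambda>n::nat. Upow 1 (chi (int n))) UNIV"
    using orthonormal_basis_H2
    by (simp add: orthonormal_family_def cinner_Upow_Upow orthonormal_basis_of_def del: One_nat_def)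
  obtain g where g: "g \<in> H2" and g_coeff: "\<And>n::nat. cinner g (chi (int n)) = cinner f (Upow 1 (chi (int n)))"
    using riesz_fischer_coefficients[OF orthonormal_basis_H2 bessel_inequality[OF on, of _ f]] by auto
  let ?p = "Upow 1 g"
  have "cinner (f - ?p) (Upow 1 h) = 0" if "h \<in> H2" for h
  proof -
    have "((\<lambda>n::nat. cinner (f - ?p) (fourier h (int n) *\<^sub>C Upow 1 (chi (int n)))) has_sum cinner (f - ?p) (Upow 1 h)) UNIV"
      by (rule has_sum_bounded_linear[OF bounded_linear_cinner_right Upow_has_sum[OF that]])
    moreover have "((\<lambda>n::nat. cinner (f - ?p) (fourier h (int n) *\<^sub>C Upow 1 (chi (int n)))) has_sum 0) UNIV"
      by (rule has_sum_0) (simp add: cinner_cscale_right cinner_diff_left g_coeff cinner_Upow_Upow del: One_nat_def)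
    ultimately show ?thesis by (rule has_sum_unique)
  qed
  moreover have "f - ?p \<in> H2" using f g Upow_in_H2 by (intro L2.subspace_diff[OF H2_subspace]) auto
  ultimately have K: "f - ?p \<in> K" by (simp add: model_space_def)
  have "cinner ?p (f - ?p) = cnj (cinner (f - ?p) ?p)" by (rule cinner_commute)
  also have "\<dots> = 0" using cinner_K_Upow[OF K g, of 0] by simp
  finally have "cinner (f - ?p) (f - ?p) = 0" using f(2)[OF K] by (simp add: cinner_diff_left)
  then have "f = ?p" by (simp add: cinner_self_eq_norm)
  then show ?thesis using g by blast
qed

text \<open>
  Such an \<open>f\<close> is divisible by every power of \<open>u\<close>, with quotients of the same norm as \<open>f\<close>. Evaluating
  at points \<open>b\<close> with \<open>\<bar>u b\<bar> < 1\<close>, which include a neighbourhood of \<open>a\<close>, shows that the analytic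
  extension of \<open>f\<close> to the disc vanishes there, and therefore everywhere.
\<close>

lemma orthogonal_to_all_imp_eq_0:
  assumes f: "f \<in> H2" "\<And>m k. k \<in> K \<Longrightarrow> cinner f (Upow m k) = 0"
  shows "f = 0"
proof -
  have factor: "\<exists>g\<in>H2. f = Upow m g" for m
  proof (induction m)
    case 0
    then show ?case using f by auto
  next
    case (Suc m)
    then obtain g where g: "g \<in> H2" "f = Upow m g" by blast
    then have "cinner g k = 0" if "k \<in> K" for k
      using f(2)[OF that, of m] by (simp add: cinner_Upow_Upow)
    then obtain h where "h \<in> H2" "g = Upow 1 h"
      using orthogonal_to_K_imp_multiple[OF g(1)] by blast
    then show ?case using g by (auto simp: Upow_Upow)
  qed
  obtain F where F: "F \<in> hardy_disc" "f = boundary F" using f(1) by (auto simp: H2_def)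
  have hol: "F holomorphic_on ball 0 1" "u holomorphic_on ball 0 1"
    using F u_hardy by (auto simp: hardy_disc_def)
  have zero: "F b = 0" if b: "b \<in> ball 0 1" "cmod (u b) < 1" for b
  proof -
    have "cmod (F b) \<le> cmod (u b) ^ m * (norm f * norm (szego_kernel b))" for m
    proof -
      obtain g where g: "g \<in> H2" "f = Upow m g" using factor by blast
      have "F b = u b ^ m * cinner g (szego_kernel b)"
        using cinner_boundary_szego[OF F(1) b(1)] cinner_Upow_power_szego[OF g(1) b(1), of m] F g by simp
      then have "cmod (F b) = cmod (u b) ^ m * cmod (cinner g (szego_kernel b))"
        by (simp add: norm_mult norm_power)
      also have "\<dots> \<le> cmod (u b) ^ m * (norm f * norm (szego_kernel b))"
        using cinner_norm_le[of g "szego_kernel b"] g by (intro mult_left_mono) auto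
      finally show ?thesis .
    qed
    \<comment> \<open>Letting \<open>m\<close> tend to infinity in the estimate forces
      \<open>F b = 0\<close>.\<close>
    moreover have "(\<lambda>m. cmod (u b) ^ m * (norm f * norm (szego_kernel b))) \<longlonglongrightarrow> 0"
      using b by (intro tendsto_mult_left_zero LIMSEQ_power_zero) simp
    ultimately have "cmod (F b) \<le> 0"
      by (intro LIMSEQ_le_const) auto
    then show ?thesis by simp
  qed
  define S where "S = {b \<in> ball 0 1. cmod (u b) < 1}"
  have "open S"
  proof -
    have "continuous_on (ball 0 1) (\<lambda>b. cmod (u b))"
      by (intro continuous_intros holomorphic_on_imp_continuous_on hol)
    from continuous_open_preimage[OF this open_ball open_lessThan[of 1]]
    show ?thesis by (simp add: S_def vimage_def Int_def conj_commute)
  qed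
  moreover have "S \<noteq> {}" using a_in_disc zero_at_a by (auto simp: S_def)
  moreover have "S \<subseteq> ball 0 1" "\<And>b. b \<in> S \<Longrightarrow> F b = 0" using zero by (auto simp: S_def)
  ultimately have "F z = 0" if "z \<in> ball 0 1" for z
    using analytic_continuation_open[of S "ball 0 1" F "\<lambda>_. 0" z] hol that by simp
  then have "boundary F = 0"
    using hol by (intro boundary_eqI[where a = "\<lambda>_. 0"]) (auto simp: analytic_L2_def fourier_zero)
  then show ?thesis using F by simp
qed

lemma orthonormal_basis_Upow:
  assumes "orthonormal_basis E K"
  shows "orthonormal_basis_of (\<lambda>(m, e). Upow m e) (UNIV \<times> E) H2"
proof -
  have E: "orthonormal_basis_of (\<lambda>e. e) E K" using assms by (simp add: orthonormal_basis_iff)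
  note EK = orthonormal_basisD(1)[OF assms] and on = orthonormal_basisD(2)[OF assms]
  have "f = 0" if f: "f \<in> H2" "\<And>m e. e \<in> E \<Longrightarrow> cinner f (Upow m e) = 0" for f
  proof (rule orthogonal_to_all_imp_eq_0[OF f(1)])
    fix m k assume "k \<in> K"
    have "((\<lambda>e. cinner f (Upow m (cinner k e *\<^sub>C e))) has_sum cinner f (Upow m k)) E"
      by (rule has_sum_bounded_linear[OF bounded_linear_compose[OF bounded_linear_cinner_right bounded_linear_Upow]
            orthonormal_expansion[OF E \<open>k \<in> K\<close>]])
    moreover have "((\<lambda>e. cinner f (Upow m (cinner k e *\<^sub>C e))) has_sum 0) E"
      by (rule has_sum_0) (simp add: Upow_cscale cinner_cscale_right f(2))
    ultimately show "cinner f (Upow m k) = 0" by (rule has_sum_unique)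
  qed
  moreover have "orthonormal_family (\<lambda>(m, e). Upow m e) (UNIV \<times> E)"
    using EK on by (auto simp: orthonormal_family_def cinner_Upow_K subset_iff)
  ultimately show ?thesis
    using H2_subspace H2_closed EK K_subset_H2 Upow_in_H2
    by (auto simp: orthonormal_basis_of_def)
qed

end


section \<open>The conjugations and composition with the inner function\<close>

lemma orthonormal_basis_eqI:
  assumes "orthonormal_basis_of b I S" "f \<in> S" "g \<in> S" "\<And>i. i \<in> I \<Longrightarrow> cinner f (b i) = cinner g (b i)"
  shows "f = g"
proof -
  have "f - g \<in> S" using assms by (intro L2.subspace_diff) (auto simp: orthonormal_basis_of_def)
  moreover have "\<And>i. i \<in> I \<Longrightarrow> cinner (f - g) (b i) = 0" using assms(4) by (simp add: cinner_diff_left)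
  ultimately have "f - g = 0" using assms(1) unfolding orthonormal_basis_of_def by blast
  then show ?thesis by simp
qed

context inner_with_zero
begin

text \<open>
  The coefficient family in the definition of the conjugation exists and is unique because the
  vectors \<open>u\<^sup>m e\<close> form an orthonormal basis.
\<close>

lemma C_basis:
  assumes E: "orthonormal_basis E K" and \<alpha>: "\<And>n. cmod (\<alpha> n) = 1" and h: "h \<in> H2"
  shows "C_basis \<alpha> u E h \<in> H2"
    and "e \<in> E \<Longrightarrow> cinner (C_basis \<alpha> u E h) (Upow m e) = cnj (cinner h (Upow m e)) * \<alpha> m"
proof -
  let ?b = "\<lambda>(m, e). Upow m e"
  note B = orthonormal_basis_Upow[OF E]
  then have on: "orthonormal_family ?b (UNIV \<times> E)" by (simp add: orthonormal_basis_of_def)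
  let ?c = "\<lambda>i. cnj (cinner h (?b i)) * \<alpha> (fst i)"
  have "(\<Sum>i\<in>F. (cmod (?c i))\<^sup>2) \<le> (norm h)\<^sup>2" if "finite F" "F \<subseteq> UNIV \<times> E" for F
    using bessel_inequality[OF on that, of h] by (simp add: norm_mult \<alpha>)
  then obtain g where g: "g \<in> H2" "((\<lambda>i. ?c i *\<^sub>C ?b i) has_sum g) (UNIV \<times> E)"
    and g_coeff: "\<And>i. i \<in> UNIV \<times> E \<Longrightarrow> cinner g (?b i) = ?c i"
    by (rule riesz_fischer_coefficients[OF B]) (assumption | rule that)+
  have "C_basis \<alpha> u E h = g"
    unfolding C_basis_def
  proof (rule the_equality)
    show "\<exists>\<mu>. ((\<lambda>(m, e). \<mu> m e *\<^sub>C Upow m e) has_sum h) (UNIV \<times> E) \<and>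
        ((\<lambda>(m, e). (cnj (\<mu> m e) * \<alpha> m) *\<^sub>C Upow m e) has_sum g) (UNIV \<times> E)"
      using orthonormal_expansion[OF B h] g(2)
      by (intro exI[of _ "\<lambda>m e. cinner h (Upow m e)"]) (simp add: case_prod_unfold)
  next
    fix g'
    assume "\<exists>\<mu>. ((\<lambda>(m, e). \<mu> m e *\<^sub>C Upow m e) has_sum h) (UNIV \<times> E) \<and>
        ((\<lambda>(m, e). (cnj (\<mu> m e) * \<alpha> m) *\<^sub>C Upow m e) has_sum g') (UNIV \<times> E)"
    then obtain \<mu> where \<mu>: "((\<lambda>(m, e). \<mu> m e *\<^sub>C Upow m e) has_sum h) (UNIV \<times> E)"
      "((\<lambda>(m, e). (cnj (\<mu> m e) * \<alpha> m) *\<^sub>C Upow m e) has_sum g') (UNIV \<times> E)" by blast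
    have "((\<lambda>i. \<mu> (fst i) (snd i) *\<^sub>C ?b i) has_sum h) (UNIV \<times> E)"
      using \<mu>(1) by (simp add: case_prod_unfold)
    from cinner_has_sum[OF on this]
    have coeff: "\<mu> m e = cinner h (Upow m e)" if "e \<in> E" for m e
      using that by force
    have "((\<lambda>i. ?c i *\<^sub>C ?b i) has_sum g') (UNIV \<times> E)"
      using \<mu>(2) by (rule has_sum_cong[THEN iffD1, rotated]) (auto simp: coeff)
    then show "g' = g" using g(2) by (rule has_sum_unique)
  qed
  then show "C_basis \<alpha> u E h \<in> H2"
    and "e \<in> E \<Longrightarrow> cinner (C_basis \<alpha> u E h) (Upow m e) = cnj (cinner h (Upow m e)) * \<alpha> m"
    using g(1) g_coeff[of "(m, e)"] by auto
qed

text \<open>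
  The coefficients of \<open>C T C f\<close> and of the adjoint image of \<open>f\<close> are compared. For a basis vector \<open>f\<close>
  this comparison is the stated identity, and in general both coefficients are linear and
  continuous in \<open>f\<close>, so that expanding \<open>f\<close> reduces them to this case.
\<close>

lemma symmetric_wrt_C_basis_iff:
  assumes \<phi>: "essentially_bounded \<phi>" and E: "orthonormal_basis E K" and \<alpha>: "\<And>n. cmod (\<alpha> n) = 1"
  shows "symmetric_wrt (C_basis \<alpha> u E) (toeplitz \<phi>) \<longleftrightarrow>
    (\<forall>m n. \<forall>e\<in>E. \<forall>e'\<in>E. \<alpha> m * cnj (\<alpha> n) * cinner (mult_op \<phi> (Upow m e)) (Upow n e') =
      cinner (mult_op \<phi> (Upow n e')) (Upow m e))" (is "_ \<longleftrightarrow> ?crit")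
proof -
  let ?C = "C_basis \<alpha> u E"
  note B = orthonormal_basis_Upow[OF E]
  note C = C_basis[where \<alpha> = \<alpha>, OF E \<alpha>]
  have in_H2: "Upow m e \<in> H2" if "e \<in> E" for m e
    using B that by (auto simp: orthonormal_basis_of_def)
  have coeff_CTC: "cinner (?C (toeplitz \<phi> (?C f))) (Upow n e') = \<alpha> n * cnj (cinner (mult_op \<phi> (?C f)) (Upow n e'))"
    if "f \<in> H2" "e' \<in> E" for f n e'
    using C(2)[OF toeplitz_in_H2 that(2)] by (simp add: cinner_toeplitz in_H2 that mult.commute)
  have coeff_adj: "cinner (adjoint_H2 (toeplitz \<phi>) f) (Upow n e') = cnj (cinner (mult_op \<phi> (Upow n e')) f)"
    if "f \<in> H2" "e' \<in> E" for f n e'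
  proof -
    have "cinner (adjoint_H2 (toeplitz \<phi>) f) (Upow n e') = cinner (mult_op (\<lambda>z. cnj (\<phi> z)) f) (Upow n e')"
      by (simp add: adjoint_toeplitz[OF \<phi> that(1)] cinner_toeplitz in_H2 that)
    also have "\<dots> = cinner f (mult_op \<phi> (Upow n e'))"
      using cinner_mult_op_adjoint[OF essentially_bounded_cnj[OF \<phi>]] by simp
    finally show ?thesis using cinner_commute[of f] by simp
  qed
  have symm: "symmetric_wrt ?C (toeplitz \<phi>) \<longleftrightarrow>
    (\<forall>f\<in>H2. \<forall>n. \<forall>e'\<in>E. \<alpha> n * cnj (cinner (mult_op \<phi> (?C f)) (Upow n e')) = cnj (cinner (mult_op \<phi> (Upow n e')) f))"
    (is "_ \<longleftrightarrow> ?coeffs")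
  proof
    assume "symmetric_wrt ?C (toeplitz \<phi>)"
    then have CTC: "\<And>f. f \<in> H2 \<Longrightarrow> ?C (toeplitz \<phi> (?C f)) = adjoint_H2 (toeplitz \<phi>) f"
      unfolding symmetric_wrt_def by blast
    show ?coeffs
    proof (intro ballI allI)
      fix f n e' assume "f \<in> H2" "e' \<in> E"
      then show "\<alpha> n * cnj (cinner (mult_op \<phi> (?C f)) (Upow n e')) = cnj (cinner (mult_op \<phi> (Upow n e')) f)"
        using coeff_CTC[of f e' n] coeff_adj[of f e' n] CTC[of f] by simp
    qed
  next
    assume c: ?coeffs
    show "symmetric_wrt ?C (toeplitz \<phi>)"
      unfolding symmetric_wrt_def
    proof
      fix f assume f: "f \<in> H2"
      show "?C (toeplitz \<phi> (?C f)) = adjoint_H2 (toeplitz \<phi>) f"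
      proof (rule orthonormal_basis_eqI[OF B])
        show "?C (toeplitz \<phi> (?C f)) \<in> H2" by (rule C(1)[OF toeplitz_in_H2])
        show "adjoint_H2 (toeplitz \<phi>) f \<in> H2" by (simp add: adjoint_toeplitz[OF \<phi> f] toeplitz_in_H2)
      qed (use c f in \<open>auto simp: coeff_CTC coeff_adj\<close>)
    qed
  qed
  show ?thesis
    unfolding symm
  proof
    assume c: ?coeffs
    show ?crit
    proof (intro allI ballI)
      fix m n e e' assume e: "e \<in> E" and e': "e' \<in> E"
      have "?C (Upow m e) = \<alpha> m *\<^sub>C Upow m e"
      proof (rule orthonormal_basis_eqI[OF B])
        show "?C (Upow m e) \<in> H2" by (rule C(1)[OF in_H2[OF e]])
        show "\<alpha> m *\<^sub>C Upow m e \<in> H2" using in_H2[OF e] by (rule L2.subspace_scale[OF H2_subspace])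
        fix i :: "nat \<times> L2" assume "i \<in> UNIV \<times> E"
        then obtain k d where i: "i = (k, d)" "d \<in> E" by auto
        have "cinner (Upow m e) (Upow k d) = (if (m, e) = (k, d) then 1 else 0)"
          using B e i unfolding orthonormal_basis_of_def orthonormal_family_def by force
        then show "cinner (?C (Upow m e)) (case i of (m, e) \<Rightarrow> Upow m e) = cinner (\<alpha> m *\<^sub>C Upow m e) (case i of (m, e) \<Rightarrow> Upow m e)"
          using C(2)[OF in_H2[OF e, of m] i(2), of k] i by (auto simp: cinner_cscale_left)
      qed
      then have "\<alpha> n * cnj (\<alpha> m * cinner (mult_op \<phi> (Upow m e)) (Upow n e')) = cnj (cinner (mult_op \<phi> (Upow n e')) (Upow m e))"
        using c in_H2[OF e, of m] e' by (auto simp: mult_op_cscale[OF \<phi>] cinner_cscale_left)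
      from arg_cong[OF this, of cnj]
      show "\<alpha> m * cnj (\<alpha> n) * cinner (mult_op \<phi> (Upow m e)) (Upow n e') = cinner (mult_op \<phi> (Upow n e')) (Upow m e)"
        by (simp add: mult_ac)
    qed
  next
    assume crit: ?crit
    show ?coeffs
    proof (intro ballI allI)
      fix f n e' assume f: "f \<in> H2" and e': "e' \<in> E"
      let ?b = "\<lambda>(m, e). Upow m e"
      have "((\<lambda>i. cnj (cinner (mult_op \<phi> (cinner (?C f) (?b i) *\<^sub>C ?b i)) (Upow n e'))) has_sum
          cnj (cinner (mult_op \<phi> (?C f)) (Upow n e'))) (UNIV \<times> E)"
        by (rule has_sum_bounded_linear[OF bounded_linear_compose[OF bounded_linear_cnj
              bounded_linear_compose[OF bounded_linear_cinner_left bounded_linear_mult_op[OF \<phi>]]]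
            orthonormal_expansion[OF B C(1)[OF f]]])
      from has_sum_cmult_right[OF this, of "\<alpha> n"]
      have "((\<lambda>i. \<alpha> n * cnj (cinner (mult_op \<phi> (cinner (?C f) (?b i) *\<^sub>C ?b i)) (Upow n e'))) has_sum
          \<alpha> n * cnj (cinner (mult_op \<phi> (?C f)) (Upow n e'))) (UNIV \<times> E)" .
      also have "?this \<longleftrightarrow> ((\<lambda>i. cnj (cinner (mult_op \<phi> (Upow n e')) (cinner f (?b i) *\<^sub>C ?b i))) has_sum
          \<alpha> n * cnj (cinner (mult_op \<phi> (?C f)) (Upow n e'))) (UNIV \<times> E)"
      proof (rule has_sum_cong)
        fix i :: "nat \<times> L2" assume "i \<in> UNIV \<times> E"
        then obtain m e where i: "i = (m, e)" "e \<in> E" by auto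
        have "\<alpha> n * cnj (cinner (mult_op \<phi> (cinner (?C f) (?b i) *\<^sub>C ?b i)) (Upow n e'))
            = cinner f (Upow m e) * cnj (\<alpha> m * cnj (\<alpha> n) * cinner (mult_op \<phi> (Upow m e)) (Upow n e'))"
          by (simp add: i C(2)[OF f i(2)] mult_op_cscale[OF \<phi>] cinner_cscale_left mult_ac)
        also have "\<dots> = cinner f (Upow m e) * cnj (cinner (mult_op \<phi> (Upow n e')) (Upow m e))"
          using crit i e' by metis
        finally show "\<alpha> n * cnj (cinner (mult_op \<phi> (cinner (?C f) (?b i) *\<^sub>C ?b i)) (Upow n e')) =
            cnj (cinner (mult_op \<phi> (Upow n e')) (cinner f (?b i) *\<^sub>C ?b i))"
          by (simp add: i cinner_cscale_right)
      qed
      finally have "((\<lambda>i. cnj (cinner (mult_op \<phi> (Upow n e')) (cinner f (?b i) *\<^sub>C ?b i))) has_sum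
          \<alpha> n * cnj (cinner (mult_op \<phi> (?C f)) (Upow n e'))) (UNIV \<times> E)" .
      moreover have "((\<lambda>i. cnj (cinner (mult_op \<phi> (Upow n e')) (cinner f (?b i) *\<^sub>C ?b i))) has_sum
          cnj (cinner (mult_op \<phi> (Upow n e')) f)) (UNIV \<times> E)"
        by (rule has_sum_bounded_linear[OF bounded_linear_compose[OF bounded_linear_cnj bounded_linear_cinner_right]
            orthonormal_expansion[OF B f]])
      ultimately show "\<alpha> n * cnj (cinner (mult_op \<phi> (?C f)) (Upow n e')) = cnj (cinner (mult_op \<phi> (Upow n e')) f)"
        by (rule has_sum_unique)
    qed
  qed
qed

text \<open>
  A version of the boundary function of \<open>u\<close> with values on the circle everywhere, so that it is a
  measurable map of the circle to itself; the default value 1 is used only on a null set.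
\<close>

definition Ucirc :: "complex \<Rightarrow> complex" where
  "Ucirc z = (if cmod (U z) = 1 then U z else 1)"

lemma AE_Ucirc: "AE z in \<sigma>. Ucirc z = U z"
  using U_unimodular by eventually_elim (simp add: Ucirc_def)

lemma norm_Ucirc [simp]: "cmod (Ucirc z) = 1"
  by (simp add: Ucirc_def)

lemma Ucirc_measurable [measurable]: "Ucirc \<in> \<sigma> \<rightarrow>\<^sub>M \<sigma>"
proof -
  have "Ucirc \<in> borel_measurable \<sigma>"
    unfolding Ucirc_def by measurable
  then have "Ucirc \<in> \<sigma> \<rightarrow>\<^sub>M restrict_space borel (sphere 0 1)"
    by (rule measurable_restrict_space2[rotated]) auto
  then show ?thesis by (simp add: measurable_cong_sets[OF refl sets_circle_measure])
qed

lemma Upow_power_AE: "AE z in \<sigma>. fun_of (Upow m f) z = Ucirc z ^ m * fun_of f z"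
  using fun_of_Upow[of m f] AE_Ucirc by eventually_elim simp

text \<open>
  The moments of the transported measure are the inner products \<open>\<langle>u\<^sup>n e, e\<rangle>\<close>, which vanish for
  \<open>n \<noteq> 0\<close> because \<open>e\<close> is orthogonal to \<open>u H\<^sup>2\<close>.
\<close>

lemma pushforward_measure:
  assumes e: "e \<in> K"
  shows "distr (density \<sigma> (\<lambda>z. ennreal ((cmod (fun_of e z))\<^sup>2))) \<sigma> Ucirc
    = density \<sigma> (\<lambda>z. ennreal ((norm e)\<^sup>2))" (is "distr ?D _ _ = ?N")
proof (rule measure_eq_if_moments_eq)
  have [measurable]: "(\<lambda>z::complex. z ^ n) \<in> borel_measurable \<sigma>" for n
    by (intro continuous_circle_measurable continuous_intros)
  have Ucirc_D: "Ucirc \<in> ?D \<rightarrow>\<^sub>M \<sigma>" by simp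
  have "emeasure ?D (space ?D) = (\<integral>\<^sup>+z. ennreal ((cmod (fun_of e z))\<^sup>2) \<partial>\<sigma>)"
    by (subst emeasure_density) (auto intro!: nn_integral_cong simp del: space_circle_measure)
  also have "\<dots> = ennreal ((norm e)\<^sup>2)"
    unfolding norm_power2_integral by (intro nn_integral_eq_integral integrable_norm_fun_of_power2) auto
  finally have "finite_measure ?D" by (intro finite_measureI) simp
  then show "finite_measure (distr ?D \<sigma> Ucirc)"
    by (rule finite_measure.finite_measure_distr[OF _ Ucirc_D])
  have "emeasure ?N (space ?N) = (\<integral>\<^sup>+z. ennreal ((norm e)\<^sup>2) \<partial>\<sigma>)"
    by (subst emeasure_density) (auto intro!: nn_integral_cong simp del: space_circle_measure nn_integral_const)
  also have "\<dots> = ennreal ((norm e)\<^sup>2)" using circle.emeasure_space_1 by simp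
  finally show "finite_measure ?N" by (intro finite_measureI) simp
  show "integral\<^sup>L (distr ?D \<sigma> Ucirc) (\<lambda>z. z ^ n) = integral\<^sup>L ?N (\<lambda>z. z ^ n)" for n
  proof -
    have "integral\<^sup>L (distr ?D \<sigma> Ucirc) (\<lambda>z. z ^ n) = integral\<^sup>L ?D (\<lambda>z. Ucirc z ^ n)"
      by (rule integral_distr) simp_all
    also have "\<dots> = (LINT z|\<sigma>. (cmod (fun_of e z))\<^sup>2 *\<^sub>R Ucirc z ^ n)"
      by (rule integral_density) auto
    also have "\<dots> = cinner (Upow n e) e"
      unfolding cinner_integral
    proof (rule integral_cong_AE)
      show "AE z in \<sigma>. (cmod (fun_of e z))\<^sup>2 *\<^sub>R Ucirc z ^ n = fun_of (Upow n e) z * cnj (fun_of e z)"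
        using Upow_power_AE[of n e]
      proof eventually_elim
        case (elim z)
        then show ?case
          by (simp only: scaleR_conv_of_real complex_norm_square mult_ac)
      qed
    qed measurable
    also have "\<dots> = (if n = 0 then of_real ((norm e)\<^sup>2) else 0)"
      using cinner_Upow_K[OF e e, of n 0] by (simp add: cinner_self_eq_norm)
    also have "\<dots> = (LINT z|\<sigma>. (norm e)\<^sup>2 *\<^sub>R z ^ n)"
      by (simp add: integral_circle_power scaleR_conv_of_real)
    also have "\<dots> = integral\<^sup>L ?N (\<lambda>z. z ^ n)"
      by (rule integral_density[symmetric]) auto
    finally show ?thesis .
  qed
qed simp_all

lemma nn_integral_pushforward:
  assumes "e \<in> K" and [measurable]: "h \<in> borel_measurable \<sigma>"
  shows "(\<integral>\<^sup>+z. ennreal ((cmod (fun_of e z))\<^sup>2) * h (Ucirc z) \<partial>\<sigma>)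
    = ennreal ((norm e)\<^sup>2) * (\<integral>\<^sup>+z. h z \<partial>\<sigma>)"
proof -
  have "(\<integral>\<^sup>+z. ennreal ((cmod (fun_of e z))\<^sup>2) * h (Ucirc z) \<partial>\<sigma>)
      = (\<integral>\<^sup>+z. h z \<partial>distr (density \<sigma> (\<lambda>z. ennreal ((cmod (fun_of e z))\<^sup>2))) \<sigma> Ucirc)"
    by (simp add: nn_integral_distr nn_integral_density)
  also have "\<dots> = ennreal ((norm e)\<^sup>2) * (\<integral>\<^sup>+z. h z \<partial>\<sigma>)"
    unfolding pushforward_measure[OF assms(1)] by (simp add: nn_integral_density nn_integral_cmult)
  finally show ?thesis .
qed

lemma integral_pushforward:
  fixes h :: "complex \<Rightarrow> complex"
  assumes e: "e \<in> K" and h: "integrable \<sigma> h"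
  shows "integrable \<sigma> (\<lambda>z. h (Ucirc z) * of_real ((cmod (fun_of e z))\<^sup>2))"
    and "(LINT z|\<sigma>. h (Ucirc z) * of_real ((cmod (fun_of e z))\<^sup>2))
      = integral\<^sup>L \<sigma> h * of_real ((norm e)\<^sup>2)"
proof -
  note [measurable] = borel_measurable_integrable[OF h]
  let ?D = "density \<sigma> (\<lambda>z. ennreal ((cmod (fun_of e z))\<^sup>2))"
  let ?N = "density \<sigma> (\<lambda>z. ennreal ((norm e)\<^sup>2))"
  have Ucirc_D: "Ucirc \<in> ?D \<rightarrow>\<^sub>M \<sigma>" by simp
  have "integrable ?N h"
    using h by (subst integrable_density) auto
  then have "integrable (distr ?D \<sigma> Ucirc) h"
    unfolding pushforward_measure[OF e] .
  then have "integrable ?D (\<lambda>z. h (Ucirc z))"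
    by (subst (asm) integrable_distr_eq[OF Ucirc_D]) auto
  then show "integrable \<sigma> (\<lambda>z. h (Ucirc z) * of_real ((cmod (fun_of e z))\<^sup>2))"
    by (subst (asm) integrable_density) (auto simp: scaleR_conv_of_real mult.commute)
  have "(LINT z|\<sigma>. h (Ucirc z) * of_real ((cmod (fun_of e z))\<^sup>2)) = integral\<^sup>L ?D (\<lambda>z. h (Ucirc z))"
    by (subst integral_density) (auto simp: scaleR_conv_of_real mult.commute)
  also have "\<dots> = integral\<^sup>L (distr ?D \<sigma> Ucirc) h"
    by (rule integral_distr[symmetric, OF Ucirc_D]) simp
  also have "\<dots> = integral\<^sup>L \<sigma> h * of_real ((norm e)\<^sup>2)"
    unfolding pushforward_measure[OF e]
    by (subst integral_density) (auto simp: scaleR_conv_of_real mult.commute)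
  finally show "(LINT z|\<sigma>. h (Ucirc z) * of_real ((cmod (fun_of e z))\<^sup>2))
      = integral\<^sup>L \<sigma> h * of_real ((norm e)\<^sup>2)" .
qed

text \<open>
  By polarization, \<open>e cnj e'\<close> is a combination of four functions \<open>\<bar>e + c e'\<bar>\<^sup>2\<close>, and \<open>e + c e'\<close> is
  again in \<open>K\<close>.
\<close>

lemma integral_pushforward_polarized:
  fixes h :: "complex \<Rightarrow> complex"
  assumes e: "e \<in> K" "e' \<in> K" and h: "integrable \<sigma> h"
  shows "(LINT z|\<sigma>. h (Ucirc z) * (fun_of e z * cnj (fun_of e' z)))
      = integral\<^sup>L \<sigma> h * cinner e e'"
proof -
  note [measurable] = borel_measurable_integrable[OF h]
  define p where "p c = e + c *\<^sub>C e'" for c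
  have p: "p c \<in> K" for c
    unfolding p_def using e by (intro L2.subspace_add[OF K_subspace] L2.subspace_scale[OF K_subspace])
  \<comment> \<open>The factors \<open>1\<close> and \<open>-1\<close> are kept so that the terms
    match \<open>p 1\<close> and \<open>p (-1)\<close>.\<close>
  have polar: "4 * (x * cnj y) = of_real ((cmod (x + 1 * y))\<^sup>2) - of_real ((cmod (x + (-1) * y))\<^sup>2)
      + \<i> * of_real ((cmod (x + \<i> * y))\<^sup>2) - \<i> * of_real ((cmod (x + (-\<i>) * y))\<^sup>2)" for x y :: complex
    unfolding complex_norm_square by (simp add: algebra_simps)
  let ?q = "\<lambda>c z. h (Ucirc z) * of_real ((cmod (fun_of (p c) z))\<^sup>2)"
  note q_int = integral_pushforward(1)[OF p h]
  have "4 * (LINT z|\<sigma>. h (Ucirc z) * (fun_of e z * cnj (fun_of e' z)))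
      = (LINT z|\<sigma>. 4 * (h (Ucirc z) * (fun_of e z * cnj (fun_of e' z))))"
    by simp
  also have "\<dots> = (LINT z|\<sigma>. ?q 1 z - ?q (-1) z + \<i> * ?q \<i> z - \<i> * ?q (-\<i>) z)"
  proof (rule integral_cong_AE)
    have fun_p: "AE z in \<sigma>. fun_of (p c) z = fun_of e z + c * fun_of e' z" for c
      using fun_of_add[of e "c *\<^sub>C e'"] fun_of_cscale[of c e'] unfolding p_def by eventually_elim simp
    show "AE z in \<sigma>. 4 * (h (Ucirc z) * (fun_of e z * cnj (fun_of e' z))) =
        ?q 1 z - ?q (-1) z + \<i> * ?q \<i> z - \<i> * ?q (-\<i>) z"
      using fun_p[of 1] fun_p[of "-1"] fun_p[of \<i>] fun_p[of "-\<i>"]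
    proof eventually_elim
      case (elim z)
      have "4 * (h (Ucirc z) * (fun_of e z * cnj (fun_of e' z))) = h (Ucirc z) * (4 * (fun_of e z * cnj (fun_of e' z)))"
        by (rule mult.left_commute)
      then show ?case
        unfolding elim polar by (simp add: algebra_simps del: of_real_power)
    qed
  qed measurable
  also have "\<dots> = integral\<^sup>L \<sigma> h * (of_real ((norm (p 1))\<^sup>2) - of_real ((norm (p (-1)))\<^sup>2)
      + \<i> * of_real ((norm (p \<i>))\<^sup>2) - \<i> * of_real ((norm (p (-\<i>)))\<^sup>2))"
    using q_int by (simp add: integral_pushforward(2)[OF p h] algebra_simps del: of_real_power)
  also have "\<dots> = integral\<^sup>L \<sigma> h * (4 * cinner e e')"
    unfolding cinner_self_eq_norm[symmetric] p_def cinner_simps by (simp add: algebra_simps)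
  finally show ?thesis by simp
qed

text \<open>
  Since \<open>u\<close> has modulus 1, \<open>u\<^sup>m cnj (u\<^sup>n)\<close> is the power \<open>u\<^bsup>m-n\<^esup>\<close> and can be absorbed into the function
  composed with \<open>u\<close>.
\<close>

lemma integral_composition_Upow:
  fixes h :: "complex \<Rightarrow> complex"
  assumes e: "e \<in> K" "e' \<in> K" and h: "square_integrable h"
  shows "(LINT z|\<sigma>. h (Ucirc z) * fun_of (Upow m e) z * cnj (fun_of (Upow n e') z))
    = fourier (L2_of h) (int n - int m) * cinner e e'"
proof -
  let ?h = "\<lambda>z. h z * z powi (int m - int n)"
  have [measurable]: "h \<in> borel_measurable \<sigma>"
    using h by (auto simp: square_integrable_def)
  have h_int: "integrable \<sigma> ?h" by (rule integrable_mult_powi[OF h])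
  have "(LINT z|\<sigma>. h (Ucirc z) * fun_of (Upow m e) z * cnj (fun_of (Upow n e') z))
      = (LINT z|\<sigma>. ?h (Ucirc z) * (fun_of e z * cnj (fun_of e' z)))"
  proof (rule integral_cong_AE)
    show "AE z in \<sigma>. h (Ucirc z) * fun_of (Upow m e) z * cnj (fun_of (Upow n e') z)
        = ?h (Ucirc z) * (fun_of e z * cnj (fun_of e' z))"
      using Upow_power_AE[of m e] Upow_power_AE[of n e']
    proof eventually_elim
      case (elim z)
      have "Ucirc z \<in> sphere 0 1" by simp
      then have "Ucirc z ^ m * cnj (Ucirc z) ^ n = Ucirc z powi (int m - int n)"
        using powi_mult_circle[of "Ucirc z" "int m" "- int n"] cnj_powi_circle[of "Ucirc z" "int n"] by simp
      then show ?case unfolding elim by (simp add: mult_ac)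
    qed
  qed measurable
  also have "\<dots> = integral\<^sup>L \<sigma> ?h * cinner e e'"
    by (rule integral_pushforward_polarized[OF e h_int])
  also have "integral\<^sup>L \<sigma> ?h = fourier (L2_of h) (int n - int m)"
    using fourier_L2_of[OF h, of "int n - int m"] by simp
  finally show ?thesis .
qed

lemma cinner_mult_op_composition:
  fixes h :: "complex \<Rightarrow> complex"
  assumes e: "e \<in> K" "e' \<in> K" and \<phi>: "essentially_bounded \<phi>"
    and h: "square_integrable h" and \<phi>h: "AE z in \<sigma>. \<phi> z = h (Ucirc z)"
  shows "cinner (mult_op \<phi> (Upow m e)) (Upow n e') = fourier (L2_of h) (int n - int m) * cinner e e'"
  unfolding cinner_mult_op[OF \<phi>] integral_composition_Upow[OF e h, symmetric]
proof (rule integral_cong_AE)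
  have [measurable]: "h \<in> borel_measurable \<sigma>" "\<phi> \<in> borel_measurable \<sigma>"
    using h \<phi> by (auto simp: square_integrable_def essentially_bounded_def)
  show "(\<lambda>z. \<phi> z * fun_of (Upow m e) z * cnj (fun_of (Upow n e') z)) \<in> borel_measurable \<sigma>"
    "(\<lambda>z. h (Ucirc z) * fun_of (Upow m e) z * cnj (fun_of (Upow n e') z)) \<in> borel_measurable \<sigma>"
    by measurable
  show "AE z in \<sigma>. \<phi> z * fun_of (Upow m e) z * cnj (fun_of (Upow n e') z)
      = h (Ucirc z) * fun_of (Upow m e) z * cnj (fun_of (Upow n e') z)"
    using \<phi>h by eventually_elim simp
qed

lemma szego_lower_bound: "AE z in \<sigma>. 1 / 2 \<le> cmod (fun_of (szego_kernel a) z)"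
proof -
  have "AE z in \<sigma>. fun_of (szego_kernel a) z = 1 / (1 - cnj a * z)"
    unfolding szego_kernel_def by (rule fun_of_L2_of[OF square_integrable_szego[OF a_in_disc]])
  moreover have "AE z in \<sigma>. z \<in> sphere 0 1" by (rule AE_I2) simp
  ultimately show ?thesis
  proof eventually_elim
    case (elim z)
    have az: "cmod (cnj a * z) < 1" using a_in_disc elim(2) by (simp add: norm_mult)
    then have "1 - cnj a * z \<noteq> 0" by auto
    moreover have "cmod (1 - cnj a * z) \<le> 2"
      using norm_triangle_ineq4[of 1 "cnj a * z"] az by simp
    ultimately show ?case unfolding elim(1) norm_divide by (simp add: field_simps)
  qed
qed

lemma szego_nonzero: "szego_kernel a \<noteq> 0"
  using fourier_szego[OF a_in_disc, of 0] by (auto simp: fourier_zero)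

text \<open>
  The measures \<open>\<sigma>\<close> and \<open>\<bar>k\<bar>\<^sup>2 \<sigma>\<close> have the same null sets, where \<open>k\<close> is the Szego kernel at \<open>a\<close>, and
  the latter is transported to a multiple of \<open>\<sigma>\<close>. Composition with \<open>u\<close> is therefore independent of
  the choice of representatives.
\<close>

lemma AE_compose_Ucirc:
  assumes "AE z in \<sigma>. P z"
  shows "AE z in \<sigma>. P (Ucirc z)"
proof -
  let ?k = "szego_kernel a"
  have "AE z in density \<sigma> (\<lambda>z. ennreal ((norm ?k)\<^sup>2)). P z"
    using assms by (subst AE_density) auto
  then have "AE z in distr (density \<sigma> (\<lambda>z. ennreal ((cmod (fun_of ?k z))\<^sup>2))) \<sigma> Ucirc. P z"
    unfolding pushforward_measure[OF szego_in_K] .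
  then have "AE z in density \<sigma> (\<lambda>z. ennreal ((cmod (fun_of ?k z))\<^sup>2)). P (Ucirc z)"
    by (rule AE_distrD[rotated]) simp
  then have "AE z in \<sigma>. 0 < ennreal ((cmod (fun_of ?k z))\<^sup>2) \<longrightarrow> P (Ucirc z)"
    by (subst (asm) AE_density) auto
  then show ?thesis
    using szego_lower_bound
  proof eventually_elim
    case (elim z)
    then have "fun_of ?k z \<noteq> 0" by auto
    then show ?case using elim(1) by simp
  qed
qed

text \<open>
  All three follow from the transport of \<open>\<bar>k\<bar>\<^sup>2 \<sigma>\<close> to \<open>\<parallel>k\<parallel>\<^sup>2 \<sigma>\<close>; for the composition without the
  factor \<open>k\<close>, note that \<open>\<bar>k\<bar>\<close> is at least 1/2.
\<close>

lemma square_integrable_composition: "square_integrable (\<lambda>z. fun_of f (Ucirc z))"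
  and square_integrable_composition_szego: "square_integrable (\<lambda>z. fun_of f (Ucirc z) * fun_of (szego_kernel a) z)"
  and norm_composition_szego:
    "norm (L2_of (\<lambda>z. fun_of f (Ucirc z) * fun_of (szego_kernel a) z)) = norm f * norm (szego_kernel a)"
proof -
  let ?k = "szego_kernel a"
  have finite: "(\<integral>\<^sup>+z. ennreal ((cmod (fun_of ?k z))\<^sup>2) * ennreal ((cmod (fun_of f (Ucirc z)))\<^sup>2) \<partial>\<sigma>)
      = ennreal ((norm f * norm ?k)\<^sup>2)"
    using nn_integral_pushforward[OF szego_in_K, of "\<lambda>z. ennreal ((cmod (fun_of f z))\<^sup>2)"]
      nn_integral_eq_integral[OF integrable_norm_fun_of_power2, of f]
    by (simp add: norm_power2_integral[symmetric] power_mult_distrib mult.commute flip: ennreal_mult')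
  have norm_eq: "ennreal ((cmod (fun_of f (Ucirc z) * fun_of ?k z))\<^sup>2)
      = ennreal ((cmod (fun_of ?k z))\<^sup>2) * ennreal ((cmod (fun_of f (Ucirc z)))\<^sup>2)" for z
    by (simp add: norm_mult power_mult_distrib mult.commute flip: ennreal_mult')
  have nn: "(\<integral>\<^sup>+z. ennreal ((cmod (fun_of f (Ucirc z) * fun_of ?k z))\<^sup>2) \<partial>\<sigma>) = ennreal ((norm f * norm ?k)\<^sup>2)"
    unfolding norm_eq by (rule finite)
  then have int: "integrable \<sigma> (\<lambda>z. (cmod (fun_of f (Ucirc z) * fun_of ?k z))\<^sup>2)"
    unfolding integrable_iff_bounded by simp
  then show sq: "square_integrable (\<lambda>z. fun_of f (Ucirc z) * fun_of ?k z)"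
    by (simp add: square_integrable_def)
  have "(norm (L2_of (\<lambda>z. fun_of f (Ucirc z) * fun_of ?k z)))\<^sup>2
      = (LINT z|\<sigma>. (cmod (fun_of f (Ucirc z) * fun_of ?k z))\<^sup>2)"
    by (rule norm_L2_of_power2[OF sq])
  also have "\<dots> = (norm f * norm ?k)\<^sup>2"
    by (rule integral_eq_nn_integral[THEN trans]) (use nn in auto)
  finally show "norm (L2_of (\<lambda>z. fun_of f (Ucirc z) * fun_of ?k z)) = norm f * norm ?k"
    by (rule power2_eq_imp_eq) auto
  have "integrable \<sigma> (\<lambda>z. (cmod (fun_of f (Ucirc z)))\<^sup>2)"
  proof (rule Bochner_Integration.integrable_bound)
    show "integrable \<sigma> (\<lambda>z. 4 * (cmod (fun_of f (Ucirc z) * fun_of ?k z))\<^sup>2)"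
      using int by simp
    show "AE z in \<sigma>. norm ((cmod (fun_of f (Ucirc z)))\<^sup>2) \<le> norm (4 * (cmod (fun_of f (Ucirc z) * fun_of ?k z))\<^sup>2)"
      using szego_lower_bound
    proof eventually_elim
      case (elim z)
      then have "1 \<le> (2 * cmod (fun_of ?k z))\<^sup>2" by (intro one_le_power) simp
      then have "(cmod (fun_of f (Ucirc z)))\<^sup>2 * 1 \<le> (cmod (fun_of f (Ucirc z)))\<^sup>2 * (2 * cmod (fun_of ?k z))\<^sup>2"
        by (intro mult_left_mono) auto
      then show ?case by (simp add: norm_mult power_mult_distrib mult_ac)
    qed
  qed measurable
  then show "square_integrable (\<lambda>z. fun_of f (Ucirc z))"
    by (simp add: square_integrable_def)
qed

end


section \<open>Symbols of symmetric Toeplitz operators\<close>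

lemma root_of_unimodular:
  assumes "cmod r = 1" "d > 0"
  shows "\<exists>\<zeta>. cmod \<zeta> = 1 \<and> cnj \<zeta> ^ d = r"
proof -
  have "r \<noteq> 0" using assms(1) by auto
  then have "r = cis (Arg r)" using assms(1) cis_Arg[of r] by (simp add: sgn_eq)
  moreover have "cis (Arg r / d) ^ d = cis (Arg r)" using assms(2) by (simp add: Complex.DeMoivre)
  ultimately show ?thesis
    by (intro exI[of _ "cnj (cis (Arg r / d))"]) simp
qed

lemma quasi_periodic_ratio_power:
  fixes \<alpha> :: "nat \<Rightarrow> complex"
  assumes "\<And>n. \<alpha> (n + d) = r * \<alpha> n"
  shows "\<alpha> (n + d * q) = r ^ q * \<alpha> n"
proof (induction q)
  case (Suc q)
  have "\<alpha> (n + d * Suc q) = \<alpha> ((n + d * q) + d)" by (simp add: algebra_simps)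
  then show ?case using assms Suc by simp
qed simp

text \<open>
  If \<open>k \<ge> 1\<close> and \<open>c\<^sub>k \<noteq> 0\<close>, the hypothesis says that the shift of \<open>\<alpha>\<close> by \<open>k\<close> is a multiple of \<open>\<alpha>\<close>, with factor
  \<open>c\<^sub>k / c\<^bsub>-k\<^esub>\<close>. Let \<open>d\<close> be the smallest positive shift with this property and \<open>r\<close> its factor. Division
  with remainder shows that every other such shift \<open>k\<close> is a multiple of \<open>d\<close>, so that its factor is
  \<open>r\<^bsup>k/d\<^esup>\<close>. Taking for \<open>cnj \<zeta>\<close> a root of order \<open>d\<close> of \<open>r\<close> turns all the factors into \<open>cnj \<zeta>\<^sup>k\<close>. If
  there is no such shift, all \<open>c\<^sub>k\<close> with \<open>k \<noteq> 0\<close> vanish.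
\<close>

lemma geometric_symmetry:
  fixes \<alpha> :: "nat \<Rightarrow> complex" and c :: "int \<Rightarrow> complex"
  assumes \<alpha>: "\<And>n. cmod (\<alpha> n) = 1"
    and c: "\<And>m n. \<alpha> m * cnj (\<alpha> n) * c (int n - int m) = c (int m - int n)"
  shows "\<exists>\<zeta>. cmod \<zeta> = 1 \<and> (\<forall>k::nat. c (- int k) = \<zeta> ^ k * c (int k))"
proof -
  have nz: "\<alpha> n \<noteq> 0" for n using \<alpha>[of n] by auto
  have \<alpha>_cnj: "\<alpha> n * cnj (\<alpha> n) = 1" for n
    using complex_norm_square[of "\<alpha> n"] \<alpha>[of n] by simp
  have norm_c: "cmod (c (- int k)) = cmod (c (int k))" for k :: nat
    using arg_cong[OF c[of 0 k], of cmod] \<alpha> by (simp add: norm_mult)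
  define R where "R k r \<longleftrightarrow> (\<forall>n. \<alpha> (n + k) = r * \<alpha> n)" for k r
  have R_c: "R k (c (int k) / c (- int k))" if k: "c (int k) \<noteq> 0" for k
    unfolding R_def
  proof
    fix n
    have c': "c (- int k) \<noteq> 0" using norm_c[of k] k by auto
    have "c (int k) = \<alpha> (n + k) * cnj (\<alpha> n) * c (- int k)"
      using c[of "n + k" n] by simp
    then have "c (int k) / c (- int k) * \<alpha> n = \<alpha> (n + k) * (\<alpha> n * cnj (\<alpha> n))"
      using c' by (simp add: mult_ac)
    then show "\<alpha> (n + k) = c (int k) / c (- int k) * \<alpha> n" by (simp add: \<alpha>_cnj)
  qed
  show ?thesis
  proof (cases "\<exists>k>0. \<exists>r. R k r")
    case False
    then have "c (int k) = 0" if "k > 0" for k using R_c[of k] that by blast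
    then have "c (- int k) = 1 ^ k * c (int k)" for k
      using norm_c[of k] by (cases "k = 0") auto
    then show ?thesis by (intro exI[of _ 1]) simp
  next
    case True
    define d where "d = (LEAST k. k > 0 \<and> (\<exists>r. R k r))"
    have d: "d > 0" "\<exists>r. R d r" using LeastI_ex[OF True] by (auto simp: d_def)
    then obtain r where r: "R d r" by blast
    have r_norm: "cmod r = 1"
      using arg_cong[OF r[unfolded R_def, rule_format, of 0], of cmod] \<alpha> by (simp add: norm_mult)
    obtain \<zeta> where \<zeta>: "cmod \<zeta> = 1" "cnj \<zeta> ^ d = r"
      using root_of_unimodular[OF r_norm d(1)] by blast
    have \<zeta>_cnj: "\<zeta> * cnj \<zeta> = 1" using complex_norm_square[of \<zeta>] \<zeta>(1) by simp
    have ratio: "s = cnj \<zeta> ^ k" if s: "R k s" for k s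
    proof -
      \<comment> \<open>The remainder \<open>j\<close> is again a period up to a factor, so it is 0
        by minimality of \<open>d\<close>.\<close>
      define q j where "q = k div d" and "j = k mod d"
      have k: "k = j + d * q" by (simp add: q_def j_def)
      have power: "\<alpha> (n + d * q) = r ^ q * \<alpha> n" for n
        using r unfolding R_def by (intro quasi_periodic_ratio_power) blast
      have rq: "r ^ q \<noteq> 0" using r_norm by auto
      have "R j (s / r ^ q)"
        unfolding R_def
      proof
        fix n
        have "s * \<alpha> n = \<alpha> ((n + j) + d * q)" using s k unfolding R_def by (metis add.assoc)
        also have "\<dots> = r ^ q * \<alpha> (n + j)" by (rule power)
        finally show "\<alpha> (n + j) = s / r ^ q * \<alpha> n" using rq by (simp add: field_simps)
      qed
      moreover have "j < d" using d(1) by (simp add: j_def)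
      ultimately have "j = 0" using not_less_Least[of j "\<lambda>k. k > 0 \<and> (\<exists>r. R k r)"] by (auto simp: d_def)
      then have "s * \<alpha> 0 = r ^ q * \<alpha> 0" using s k power[of 0] unfolding R_def by (metis add_0)
      then show ?thesis using nz[of 0] \<zeta>(2) k \<open>j = 0\<close> by (simp add: power_mult)
    qed
    have "c (- int k) = \<zeta> ^ k * c (int k)" for k
    proof (cases "c (int k) = 0")
      case True
      then show ?thesis using norm_c[of k] by simp
    next
      case False
      then have "c (- int k) \<noteq> 0" using norm_c[of k] by auto
      moreover have "c (int k) / c (- int k) = cnj \<zeta> ^ k" by (rule ratio[OF R_c[OF False]])
      ultimately have "c (int k) = cnj \<zeta> ^ k * c (- int k)" by (simp add: field_simps)
      then have "\<zeta> ^ k * c (int k) = (\<zeta> * cnj \<zeta>) ^ k * c (- int k)" by (simp add: power_mult_distrib)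
      then show ?thesis by (simp add: \<zeta>_cnj)
    qed
    then show ?thesis using \<zeta>(1) by blast
  qed
qed

lemma square_integrable_cnj: "square_integrable f \<Longrightarrow> square_integrable (\<lambda>z. cnj (f z))"
  by (auto simp: square_integrable_def)

lemma square_integrable_diff:
  "square_integrable f \<Longrightarrow> square_integrable g \<Longrightarrow> square_integrable (\<lambda>z. f z - g z)"
  using square_integrable_add[OF _ square_integrable_cmult[of g "-1"], of f] by simp

lemma fourier_L2_of_add:
  assumes "square_integrable f" "square_integrable g"
  shows "fourier (L2_of (\<lambda>z. f z + g z)) n = fourier (L2_of f) n + fourier (L2_of g) n"
  using plus_L2.abs_eq[of f g] assms by (simp add: L2_rel_def flip: fourier_add)

lemma fourier_L2_of_diff:
  assumes "square_integrable f" "square_integrable g"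
  shows "fourier (L2_of (\<lambda>z. f z - g z)) n = fourier (L2_of f) n - fourier (L2_of g) n"
  using fourier_L2_of_add[OF square_integrable_diff[OF assms] assms(2), of n] by simp

lemma fourier_L2_of_cnj:
  assumes "square_integrable f"
  shows "fourier (L2_of (\<lambda>z. cnj (f z))) n = cnj (fourier (L2_of f) (- n))"
proof -
  have "(LINT z|\<sigma>. cnj (f z) * z powi (- n)) = (LINT z|\<sigma>. cnj (f z * z powi n))"
    by (rule Bochner_Integration.integral_cong) (auto simp: cnj_powi_circle)
  then show ?thesis
    unfolding fourier_L2_of[OF square_integrable_cnj[OF assms]] fourier_L2_of[OF assms]
    by (simp only: Bochner_Integration.integral_cnj minus_minus)
qed

text \<open>
  The reflection \<open>z \<mapsto> \<zeta> cnj z\<close> preserves \<open>\<sigma>\<close>, since it turns the moments into multiples of their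
  conjugates and those of positive index are 0.
\<close>

lemma distr_circle_reflection:
  assumes "cmod \<zeta> = 1"
  shows "(\<lambda>z. \<zeta> * cnj z) \<in> \<sigma> \<rightarrow>\<^sub>M \<sigma>"
    and "distr \<sigma> \<sigma> (\<lambda>z. \<zeta> * cnj z) = \<sigma>"
proof -
  have "(\<lambda>z. \<zeta> * cnj z) \<in> borel_measurable \<sigma>"
    by (intro continuous_circle_measurable continuous_intros)
  then have "(\<lambda>z. \<zeta> * cnj z) \<in> \<sigma> \<rightarrow>\<^sub>M restrict_space borel (sphere 0 1)"
    using assms by (intro measurable_restrict_space2) (auto simp: norm_mult)
  then show meas: "(\<lambda>z. \<zeta> * cnj z) \<in> \<sigma> \<rightarrow>\<^sub>M \<sigma>"
    by (simp add: measurable_cong_sets[OF refl sets_circle_measure])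
  show "distr \<sigma> \<sigma> (\<lambda>z. \<zeta> * cnj z) = \<sigma>"
  proof (rule measure_eq_if_moments_eq)
    show "finite_measure (distr \<sigma> \<sigma> (\<lambda>z. \<zeta> * cnj z))"
      by (rule circle.finite_measure_distr[OF meas])
    show "finite_measure \<sigma>" by (rule circle.finite_measure_axioms)
    fix n :: nat
    have "integral\<^sup>L (distr \<sigma> \<sigma> (\<lambda>z. \<zeta> * cnj z)) (\<lambda>z. z ^ n)
        = (LINT z|\<sigma>. (\<zeta> * cnj z) ^ n)"
      by (rule integral_distr[OF meas]) (intro continuous_circle_measurable continuous_intros)
    also have "\<dots> = (LINT z|\<sigma>. \<zeta> ^ n * cnj (z ^ n))"
      by (simp add: power_mult_distrib)
    also have "\<dots> = \<zeta> ^ n * cnj ((LINT z|\<sigma>. z ^ n))"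
      by (simp only: integral_mult_right_zero Bochner_Integration.integral_cnj)
    also have "\<dots> = (LINT z|\<sigma>. z ^ n)"
      by (simp add: integral_circle_power)
    finally show "integral\<^sup>L (distr \<sigma> \<sigma> (\<lambda>z. \<zeta> * cnj z)) (\<lambda>z. z ^ n)
        = (LINT z|\<sigma>. z ^ n)" .
  qed simp_all
qed

lemma fourier_C_rot:
  assumes "cmod \<zeta> = 1"
  shows "fourier (C_rot \<zeta> f) n = \<zeta> powi (- n) * cnj (fourier f n)"
proof -
  note refl = distr_circle_reflection[OF assms]
  have [measurable]: "(\<lambda>z. fun_of f (\<zeta> * cnj z)) \<in> borel_measurable \<sigma>"
    by (rule measurable_compose[OF refl(1) fun_of_measurable])
  have "integrable (distr \<sigma> \<sigma> (\<lambda>z. \<zeta> * cnj z)) (\<lambda>z. (cmod (fun_of f z))\<^sup>2)"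
    unfolding refl(2) by (rule integrable_norm_fun_of_power2)
  then have "integrable \<sigma> (\<lambda>z. (cmod (fun_of f (\<zeta> * cnj z)))\<^sup>2)"
    by (subst (asm) integrable_distr_eq[OF refl(1)]) auto
  then have sq: "square_integrable (\<lambda>z. cnj (fun_of f (\<zeta> * cnj z)))"
    by (simp add: square_integrable_def)
  let ?h = "\<lambda>w. \<zeta> powi (- n) * cnj (fun_of f w * w powi (- n))"
  have "fourier (C_rot \<zeta> f) n = (LINT z|\<sigma>. cnj (fun_of f (\<zeta> * cnj z)) * z powi (- n))"
    unfolding C_rot_def by (rule fourier_L2_of[OF sq])
  also have "\<dots> = (LINT z|\<sigma>. ?h (\<zeta> * cnj z))"
  proof (rule Bochner_Integration.integral_cong)
    fix z assume "z \<in> space \<sigma>"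
    then have z: "z \<in> sphere 0 1" by simp
    have \<zeta>: "\<zeta> \<in> sphere 0 1" using assms by simp
    have "\<zeta> powi (- n) * cnj ((\<zeta> * cnj z) powi (- n)) = (\<zeta> powi (- n) * \<zeta> powi n) * z powi (- n)"
      using cnj_powi_circle[OF \<zeta>, of "- n"] by (simp add: power_int_mult_distrib mult.assoc)
    also have "\<dots> = z powi (- n)" using powi_mult_circle[OF \<zeta>, of "- n" n] by simp
    finally have "\<zeta> powi (- n) * cnj ((\<zeta> * cnj z) powi (- n)) = z powi (- n)" .
    then show "cnj (fun_of f (\<zeta> * cnj z)) * z powi (- n) = ?h (\<zeta> * cnj z)"
      unfolding complex_cnj_mult by (metis (no_types) mult.assoc mult.commute)
  qed simp
  also have "\<dots> = integral\<^sup>L (distr \<sigma> \<sigma> (\<lambda>z. \<zeta> * cnj z)) ?h"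
    by (rule integral_distr[OF refl(1), symmetric]) measurable
  also have "\<dots> = integral\<^sup>L \<sigma> ?h" unfolding refl(2) ..
  also have "\<dots> = \<zeta> powi (- n) * cnj (fourier f n)"
    by (simp only: integral_mult_right_zero Bochner_Integration.integral_cnj fourier_integral)
  finally show ?thesis .
qed

context inner_with_zero
begin

definition composition :: "L2 \<Rightarrow> L2" where
  "composition f = L2_of (\<lambda>z. fun_of f (Ucirc z))"

text \<open>
  Up to the factor \<open>\<parallel>k\<parallel>\<close> this operator is an isometry of \<open>L\<^sup>2\<close>, and it maps \<open>z\<^sup>n\<close> to \<open>u\<^sup>n k\<close>. It recovers
  a function of \<open>u\<close> from an expansion in the vectors \<open>u\<^sup>n k\<close>.
\<close>

definition composition_szego :: "L2 \<Rightarrow> L2" where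
  "composition_szego f = L2_of (\<lambda>z. fun_of f (Ucirc z) * fun_of (szego_kernel a) z)"

lemma fun_of_composition: "AE z in \<sigma>. fun_of (composition f) z = fun_of f (Ucirc z)"
  unfolding composition_def by (rule fun_of_L2_of[OF square_integrable_composition])

lemma fun_of_composition_szego:
  "AE z in \<sigma>. fun_of (composition_szego f) z = fun_of f (Ucirc z) * fun_of (szego_kernel a) z"
  unfolding composition_szego_def by (rule fun_of_L2_of[OF square_integrable_composition_szego])

lemma bounded_linear_composition_szego: "bounded_linear composition_szego"
proof (rule bounded_linear_intro[where K = "norm (szego_kernel a)"])
  let ?V = composition_szego
  show "?V (f + g) = ?V f + ?V g" for f g
  proof (rule L2_eqI)
    show "AE z in \<sigma>. fun_of (?V (f + g)) z = fun_of (?V f + ?V g) z"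
      using fun_of_composition_szego[of "f + g"] fun_of_composition_szego[of f] fun_of_composition_szego[of g]
        fun_of_add[of "?V f" "?V g"] AE_compose_Ucirc[OF fun_of_add[of f g]]
      by eventually_elim (simp add: distrib_right)
  qed
  show "?V (r *\<^sub>R f) = r *\<^sub>R ?V f" for r f
  proof (rule L2_eqI)
    show "AE z in \<sigma>. fun_of (?V (r *\<^sub>R f)) z = fun_of (r *\<^sub>R ?V f) z"
      using fun_of_composition_szego[of "r *\<^sub>R f"] fun_of_composition_szego[of f]
        fun_of_cscale[of r "?V f"] AE_compose_Ucirc[OF fun_of_cscale[of r f]]
      unfolding scaleR_L2_def by eventually_elim simp
  qed
  show "norm (?V f) \<le> norm f * norm (szego_kernel a)" for f
    by (simp add: composition_szego_def norm_composition_szego)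
qed

lemma composition_szego_cscale: "composition_szego (c *\<^sub>C f) = c *\<^sub>C composition_szego f"
proof (rule L2_eqI)
  show "AE z in \<sigma>. fun_of (composition_szego (c *\<^sub>C f)) z = fun_of (c *\<^sub>C composition_szego f) z"
    using fun_of_composition_szego[of "c *\<^sub>C f"] fun_of_composition_szego[of f]
      fun_of_cscale[of c "composition_szego f"] AE_compose_Ucirc[OF fun_of_cscale[of c f]]
    by eventually_elim simp
qed

lemma composition_szego_chi: "composition_szego (chi (int n)) = Upow n (szego_kernel a)"
proof (rule L2_eqI)
  show "AE z in \<sigma>. fun_of (composition_szego (chi (int n))) z = fun_of (Upow n (szego_kernel a)) z"
    using fun_of_composition_szego[of "chi (int n)"] AE_compose_Ucirc[OF fun_of_chi[of "int n"]]
      Upow_power_AE[of n "szego_kernel a"]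
    by eventually_elim simp
qed

lemma composition_szego_in_H2:
  assumes "f \<in> H2"
  shows "composition_szego f \<in> H2"
proof -
  have "((\<lambda>n::nat. cinner f (chi (int n)) *\<^sub>C composition_szego (chi (int n))) has_sum composition_szego f) UNIV"
    using has_sum_bounded_linear[OF bounded_linear_composition_szego orthonormal_expansion[OF orthonormal_basis_H2 assms]]
    by (simp add: composition_szego_cscale)
  then show ?thesis
    by (rule has_sum_in_closed_subspace[OF H2_subspace H2_closed, rotated])
       (simp add: composition_szego_chi Upow_in_H2 szego_in_H2[OF a_in_disc])
qed

text \<open>
  Dividing by the Szego kernel is multiplying by \<open>1 - cnj a z\<close>. In particular, if the coefficients
  of \<open>g\<close> vanish for negative indices, so do those of \<open>f\<close>; if they vanish for nonnegative indices,
  those of \<open>f\<close> vanish for positive indices.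
\<close>

lemma fourier_from_szego_multiple:
  assumes "AE z in \<sigma>. fun_of g z = fun_of f z * fun_of (szego_kernel a) z"
  shows "fourier f j = fourier g j - cnj a * fourier g (j - 1)"
proof -
  note int = integrable_mult_powi[OF square_integrable_fun_of, of g]
  have "fourier f j = (LINT z|\<sigma>. fun_of g z * z powi (- j) - cnj a * (fun_of g z * z powi (- (j - 1))))"
    unfolding fourier_integral
  proof (rule integral_cong_AE)
    have "AE z in \<sigma>. fun_of (szego_kernel a) z = 1 / (1 - cnj a * z)"
      unfolding szego_kernel_def by (rule fun_of_L2_of[OF square_integrable_szego[OF a_in_disc]])
    moreover have "AE z in \<sigma>. z \<in> sphere 0 1" by (rule AE_I2) simp
    ultimately show "AE z in \<sigma>. fun_of f z * z powi (- j)
        = fun_of g z * z powi (- j) - cnj a * (fun_of g z * z powi (- (j - 1)))"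
      using assms
    proof eventually_elim
      case (elim z)
      have "cmod (cnj a * z) < 1" using a_in_disc elim(2) by (simp add: norm_mult)
      then have nz: "1 - cnj a * z \<noteq> 0" by auto
      have f_eq: "fun_of f z = fun_of g z * (1 - cnj a * z)" using elim(1,3) nz by simp
      have z_eq: "z powi (- (j - 1)) = z * z powi (- j)"
        using powi_mult_circle[OF elim(2), of 1 "- j"] by (simp add: algebra_simps)
      show ?case unfolding f_eq z_eq by (simp add: algebra_simps)
    qed
  qed measurable
  also have "\<dots> = fourier g j - cnj a * fourier g (j - 1)"
    using int by (simp add: fourier_integral)
  finally show ?thesis .
qed

text \<open>
  The product \<open>(f \<circ> u) k\<close> with the Szego kernel is a limit of combinations of the \<open>u\<^sup>n k\<close>, and division
  by \<open>k\<close> does not leave \<open>H\<^sup>2\<close>.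
\<close>

lemma composition_in_H2:
  assumes "f \<in> H2"
  shows "composition f \<in> H2"
proof -
  have "AE z in \<sigma>. fun_of (composition_szego f) z = fun_of (composition f) z * fun_of (szego_kernel a) z"
    using fun_of_composition_szego[of f] fun_of_composition[of f] by eventually_elim simp
  from fourier_from_szego_multiple[OF this] show ?thesis
    using composition_szego_in_H2[OF assms] by (simp add: H2_eq_analytic analytic_L2_def)
qed

definition unit_szego :: L2 where
  "unit_szego = of_real (1 / norm (szego_kernel a)) *\<^sub>C szego_kernel a"

lemma szego_eq_unit: "szego_kernel a = of_real (norm (szego_kernel a)) *\<^sub>C unit_szego"
  using szego_nonzero by (simp add: unit_szego_def)

lemma norm_unit_szego: "norm unit_szego = 1"
  using szego_nonzero by (simp add: unit_szego_def norm_divide)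

lemma unit_szego_in_K: "unit_szego \<in> K"
  unfolding unit_szego_def by (rule L2.subspace_scale[OF K_subspace szego_in_K])

text \<open>
  The orthogonality hypothesis says that \<open>T\<^sub>\<phi> k\<close> is an expansion in the vectors \<open>u\<^sup>n k\<close> alone, hence
  \<open>T\<^sub>\<phi> k = (G \<circ> u) k\<close>. So \<open>(\<phi> - G \<circ> u) k\<close> is orthogonal to \<open>H\<^sup>2\<close>, and dividing by \<open>k\<close> shifts the
  vanishing of coefficients by one index.
\<close>

lemma symbol_minus_composition_coanalytic:
  assumes \<phi>: "essentially_bounded \<phi>" and E: "orthonormal_basis E K" and e: "unit_szego \<in> E"
    and orth: "\<And>n e'. e' \<in> E \<Longrightarrow> e' \<noteq> unit_szego \<Longrightarrow> cinner (mult_op \<phi> unit_szego) (Upow n e') = 0"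
  shows "\<exists>G\<in>H2. \<forall>j\<ge>1. fourier (L2_of (\<lambda>z. \<phi> z - fun_of G (Ucirc z))) j = 0"
proof -
  let ?e = unit_szego and ?k = "szego_kernel a"
  note B = orthonormal_basis_Upow[OF E]
  note EK = orthonormal_basisD(1)[OF E] and on = orthonormal_basisD(2)[OF E]
  have "orthonormal_family (\<lambda>n::nat. Upow n ?e) UNIV"
    by (simp add: orthonormal_family_def cinner_Upow_K unit_szego_in_K cinner_self_eq_norm norm_unit_szego)
  from riesz_fischer_coefficients[OF orthonormal_basis_H2 bessel_inequality[OF this, of _ "mult_op \<phi> ?e"]]
  obtain G where G: "G \<in> H2" and G_coeff: "\<And>n::nat. fourier G (int n) = cinner (mult_op \<phi> ?e) (Upow n ?e)"
    unfolding fourier_def by auto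
  have "toeplitz \<phi> ?k = composition_szego G"
  proof (rule orthonormal_basis_eqI[OF B toeplitz_in_H2 composition_szego_in_H2[OF G]])
    fix i :: "nat \<times> L2" assume "i \<in> UNIV \<times> E"
    then obtain n e' where i: "i = (n, e')" "e' \<in> E" by auto
    have in_H2: "Upow n e' \<in> H2" using i EK K_subset_H2 by (intro Upow_in_H2) auto
    have "cinner (toeplitz \<phi> ?k) (Upow n e') = of_real (norm ?k) * cinner (mult_op \<phi> ?e) (Upow n e')"
      unfolding cinner_toeplitz[OF in_H2]
      by (subst szego_eq_unit) (simp only: mult_op_cscale[OF \<phi>] cinner_cscale_left)
    also have "\<dots> = fourier G (int n) * (of_real (norm ?k) * cinner ?e e')"
      using orth[OF i(2), of n] on[OF e i(2)] by (cases "e' = ?e") (auto simp: G_coeff)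
    also have "of_real (norm ?k) * cinner ?e e' = cinner ?k e'"
      by (subst (2) szego_eq_unit) (simp only: cinner_cscale_left)
    also have "fourier G (int n) * cinner ?k e' = cinner (composition_szego G) (Upow n e')"
    proof -
      have "cinner (composition_szego G) (Upow n e')
          = (LINT z|\<sigma>. fun_of G (Ucirc z) * fun_of (Upow 0 ?k) z * cnj (fun_of (Upow n e') z))"
        unfolding cinner_integral
      proof (rule integral_cong_AE)
        show "AE z in \<sigma>. fun_of (composition_szego G) z * cnj (fun_of (Upow n e') z)
            = fun_of G (Ucirc z) * fun_of (Upow 0 ?k) z * cnj (fun_of (Upow n e') z)"
          using fun_of_composition_szego[of G] by eventually_elim simp
      qed measurable
      also have "\<dots> = fourier G (int n) * cinner ?k e'"
        using integral_composition_Upow[OF szego_in_K _ square_integrable_fun_of, of e' G 0 n] i EK by auto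
      finally show ?thesis by simp
    qed
    finally show "cinner (toeplitz \<phi> ?k) (case i of (m, e) \<Rightarrow> Upow m e) = cinner (composition_szego G) (case i of (m, e) \<Rightarrow> Upow m e)"
      by (simp add: i)
  qed
  then have coanalytic: "fourier (mult_op \<phi> ?k - composition_szego G) j = 0" if "j \<ge> 0" for j
    using cinner_toeplitz[OF chi_in_H2[of "nat j"], of \<phi> ?k] that
    by (simp add: fourier_def cinner_diff_left)
  have sq: "square_integrable (\<lambda>z. \<phi> z - fun_of G (Ucirc z))"
    by (intro square_integrable_diff square_integrable_composition essentially_bounded_imp_square_integrable \<phi>)
  have "AE z in \<sigma>. fun_of (mult_op \<phi> ?k - composition_szego G) z
      = fun_of (L2_of (\<lambda>z. \<phi> z - fun_of G (Ucirc z))) z * fun_of ?k z"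
    using fun_of_diff[of "mult_op \<phi> ?k" "composition_szego G"] fun_of_mult_op[OF \<phi>, of ?k]
      fun_of_composition_szego[of G] fun_of_L2_of[OF sq]
    by eventually_elim (simp add: left_diff_distrib)
  from fourier_from_szego_multiple[OF this]
  have "fourier (L2_of (\<lambda>z. \<phi> z - fun_of G (Ucirc z))) j = 0" if "j \<ge> 1" for j
    using that coanalytic[of j] coanalytic[of "j - 1"] by simp
  then show ?thesis using G by blast
qed

text \<open>
  Apply the preceding lemma to \<open>\<phi>\<close> and to \<open>cnj \<phi>\<close>: with the resulting \<open>G\<close> and \<open>F\<close>, the function
  \<open>\<phi> - G \<circ> u - cnj (F \<circ> u)\<close> has no Fourier coefficients of nonzero index.
\<close>

lemma symbol_is_composition:
  assumes \<phi>: "essentially_bounded \<phi>" and E: "orthonormal_basis E K" and e: "unit_szego \<in> E"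
    and orth: "\<And>n e'. e' \<in> E \<Longrightarrow> e' \<noteq> unit_szego \<Longrightarrow> cinner (mult_op \<phi> unit_szego) (Upow n e') = 0"
    and orth': "\<And>n e'. e' \<in> E \<Longrightarrow> e' \<noteq> unit_szego \<Longrightarrow> cinner (mult_op \<phi> (Upow n e')) unit_szego = 0"
  obtains h where "square_integrable h" "AE z in \<sigma>. \<phi> z = h (Ucirc z)"
proof -
  note sq_\<phi> = essentially_bounded_imp_square_integrable[OF \<phi>]
  note \<phi>' = essentially_bounded_cnj[OF \<phi>]
  obtain G where G: "G \<in> H2" and G_zero: "\<And>j. j \<ge> 1 \<Longrightarrow> fourier (L2_of (\<lambda>z. \<phi> z - fun_of G (Ucirc z))) j = 0"
    using symbol_minus_composition_coanalytic[OF \<phi> E e orth] by blast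
  have "cinner (mult_op (\<lambda>z. cnj (\<phi> z)) unit_szego) (Upow n e') = 0" if "e' \<in> E" "e' \<noteq> unit_szego" for n e'
    using orth'[OF that, of n] cinner_mult_op_adjoint[OF \<phi>, of "Upow n e'" unit_szego]
      cinner_commute[of "mult_op (\<lambda>z. cnj (\<phi> z)) unit_szego" "Upow n e'"] by simp
  from symbol_minus_composition_coanalytic[OF \<phi>' E e this]
  obtain F where F: "F \<in> H2" and F_zero: "\<And>j. j \<ge> 1 \<Longrightarrow> fourier (L2_of (\<lambda>z. cnj (\<phi> z) - fun_of F (Ucirc z))) j = 0"
    by blast
  have coeff0: "fourier (L2_of (\<lambda>z. fun_of f (Ucirc z))) j = 0" if "f \<in> H2" "j < 0" for f j
    using composition_in_H2[OF that(1)] that(2) by (simp add: composition_def H2_eq_analytic analytic_L2_def)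
  note sq_comp = square_integrable_composition
  define \<delta> where "\<delta> = (\<lambda>z. \<phi> z - fun_of G (Ucirc z) - cnj (fun_of F (Ucirc z)))"
  have sq_\<delta>: "square_integrable \<delta>"
    unfolding \<delta>_def by (intro square_integrable_diff square_integrable_cnj sq_\<phi> sq_comp)
  have \<delta>_coeff: "fourier (L2_of \<delta>) j = fourier (L2_of \<phi>) j - fourier (L2_of (\<lambda>z. fun_of G (Ucirc z))) j
      - cnj (fourier (L2_of (\<lambda>z. fun_of F (Ucirc z))) (- j))" for j
    unfolding \<delta>_def
    by (simp add: fourier_L2_of_diff fourier_L2_of_cnj square_integrable_diff square_integrable_cnj sq_\<phi> sq_comp)
  have "fourier (L2_of \<delta>) j = 0" if "j \<noteq> 0" for j
  proof (cases "j > 0")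
    case True
    then show ?thesis
      using G_zero[of j] coeff0[OF F, of "- j"] unfolding \<delta>_coeff
      by (simp add: fourier_L2_of_diff sq_\<phi> sq_comp)
  next
    case False
    then have "j < 0" using that by simp
    then show ?thesis
      using F_zero[of "- j"] coeff0[OF G, of j] unfolding \<delta>_coeff
      by (simp add: fourier_L2_of_diff fourier_L2_of_cnj square_integrable_cnj sq_\<phi> sq_comp)
         (metis complex_cnj_cnj)
  qed
  define d where "d = fourier (L2_of \<delta>) 0"
  have "L2_of \<delta> = d *\<^sub>C chi 0"
    by (rule fourier_inject) (use \<open>\<And>j. j \<noteq> 0 \<Longrightarrow> fourier (L2_of \<delta>) j = 0\<close> in \<open>auto simp: fourier_cscale fourier_chi d_def\<close>)
  then have "AE z in \<sigma>. \<delta> z = d"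
    using fun_of_L2_of[OF sq_\<delta>] fun_of_cscale[of d "chi 0"] fun_of_chi[of 0]
    by (auto elim!: eventually_elim2)
  then have "AE z in \<sigma>. \<phi> z = fun_of G (Ucirc z) + cnj (fun_of F (Ucirc z)) + d"
    by eventually_elim (simp add: \<delta>_def algebra_simps)
  moreover have "square_integrable (\<lambda>z. fun_of G z + cnj (fun_of F z) + d)"
    by (intro square_integrable_add square_integrable_cnj square_integrable_fun_of square_integrable_const)
  ultimately show ?thesis using that[of "\<lambda>z. fun_of G z + cnj (fun_of F z) + d"] by simp
qed

text \<open>
  Symmetry for every basis is applied to a basis and to this modification of it, which separates the
  two sides of the criterion by a sign.
\<close>

lemma orthonormal_basis_rotate:
  assumes E: "orthonormal_basis E S" and e: "e \<in> E"
  shows "orthonormal_basis (insert (\<i> *\<^sub>C e) (E - {e})) S"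
proof -
  let ?E = "insert (\<i> *\<^sub>C e) (E - {e})"
  note ES = orthonormal_basisD(1)[OF E] and on = orthonormal_basisD(2)[OF E]
  have S: "L2.subspace S" "closed S"
    and total: "\<And>f. f \<in> S \<Longrightarrow> (\<And>x. x \<in> E \<Longrightarrow> cinner f x = 0) \<Longrightarrow> f = 0"
    using E unfolding orthonormal_basis_iff orthonormal_basis_of_def orthonormal_family_def by auto
  have ie: "\<i> *\<^sub>C e \<notin> E - {e}"
  proof
    assume "\<i> *\<^sub>C e \<in> E - {e}"
    then have "cinner (\<i> *\<^sub>C e) e = 0" using on[of "\<i> *\<^sub>C e" e] e by auto
    then show False using on[OF e e] by (simp add: cinner_cscale_left)
  qed
  have "cinner x y = (if x = y then 1 else 0)" if "x \<in> ?E" "y \<in> ?E" for x y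
    using that on e ie on[OF e e] by (auto simp: cinner_cscale_left cinner_cscale_right)
  moreover have "f = 0" if "f \<in> S" "\<And>x. x \<in> ?E \<Longrightarrow> cinner f x = 0" for f
  proof (rule total[OF that(1)])
    fix x assume "x \<in> E"
    then show "cinner f x = 0"
      using that(2)[of x] that(2)[of "\<i> *\<^sub>C e"] by (cases "x = e") (auto simp: cinner_cscale_right)
  qed
  moreover have "?E \<subseteq> S" using ES e S by (auto intro: L2.subspace_scale)
  ultimately show ?thesis
    using S unfolding orthonormal_basis_iff orthonormal_basis_of_def orthonormal_family_def image_ident
    by blast
qed

text \<open>
  Once the symbol is \<open>h \<circ> u\<close>, the criterion for \<open>e\<close> alone relates the coefficients of \<open>h\<close> of opposite
  index, and \<open>f\<close> collects those of nonnegative index.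
\<close>

lemma C_symmetric_imp_decomposition:
  assumes \<phi>: "essentially_bounded \<phi>" and \<alpha>: "\<And>n. cmod (\<alpha> n) = 1"
    and sym: "C_symmetric \<alpha> u (toeplitz \<phi>)"
  shows "\<exists>\<zeta>\<in>sphere 0 1. \<exists>f\<in>H2. AE z in \<sigma>.
    \<phi> z = comp_boundary f u z + cnj (comp_boundary (C_rot \<zeta> f) u z)"
proof -
  let ?e = unit_szego
  obtain E where e: "?e \<in> E" and E: "orthonormal_basis E K"
    using orthonormal_basis_extending[OF K_subspace K_closed unit_szego_in_K norm_unit_szego] by blast
  let ?E = "insert (\<i> *\<^sub>C ?e) (E - {?e})"
  have E': "orthonormal_basis ?E K" by (rule orthonormal_basis_rotate[OF E e])
  have crit: "\<alpha> m * cnj (\<alpha> n) * cinner (mult_op \<phi> (Upow m x)) (Upow n y) = cinner (mult_op \<phi> (Upow n y)) (Upow m x)"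
    if "orthonormal_basis X K" "x \<in> X" "y \<in> X" for X x y m n
    using symmetric_wrt_C_basis_iff[where \<alpha> = \<alpha>, OF \<phi> that(1) \<alpha>] sym that unfolding C_symmetric_def by blast
  have zero: "cinner (mult_op \<phi> ?e) (Upow n e') = 0 \<and> cinner (mult_op \<phi> (Upow n e')) ?e = 0"
    if e': "e' \<in> E" "e' \<noteq> ?e" for n e'
  proof -
    let ?x = "cinner (mult_op \<phi> ?e) (Upow n e')" and ?y = "cinner (mult_op \<phi> (Upow n e')) ?e"
    have 1: "\<alpha> 0 * cnj (\<alpha> n) * ?x = ?y"
      using crit[OF E e e'(1), of 0 n] by simp
    \<comment> \<open>Replacing \<open>e\<close> by \<open>\<i> e\<close> multiplies one side of the
      criterion by \<open>\<i>\<close> and the other by \<open>-\<i>\<close>.\<close>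
    have 2: "\<alpha> 0 * cnj (\<alpha> n) * (\<i> * ?x) = - (\<i> * ?y)"
      using crit[OF E', of "\<i> *\<^sub>C ?e" e' 0 n] e' by (simp add: mult_op_cscale[OF \<phi>] cinner_cscale_left cinner_cscale_right)
    have "\<i> * ?y = \<alpha> 0 * cnj (\<alpha> n) * (\<i> * ?x)"
      unfolding 1[symmetric] by (rule mult.left_commute)
    then have "2 * (\<i> * ?y) = 0" unfolding 2 by simp
    then have "?y = 0" by simp
    moreover have "\<alpha> 0 * cnj (\<alpha> n) \<noteq> 0" using \<alpha>[of 0] \<alpha>[of n] by auto
    ultimately show ?thesis using 1 by simp
  qed
  obtain h where h: "square_integrable h" and \<phi>h: "AE z in \<sigma>. \<phi> z = h (Ucirc z)"
    by (rule symbol_is_composition[OF \<phi> E e]) (use zero in auto)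
  define c where "c = fourier (L2_of h)"
  have "\<alpha> m * cnj (\<alpha> n) * c (int n - int m) = c (int m - int n)" for m n
    using crit[OF E e e, of m n]
    unfolding cinner_mult_op_composition[OF unit_szego_in_K unit_szego_in_K \<phi> h \<phi>h]
    by (simp add: c_def cinner_self_eq_norm norm_unit_szego)
  from geometric_symmetry[where \<alpha> = \<alpha> and c = c, OF \<alpha> this]
  obtain \<zeta> where \<zeta>: "cmod \<zeta> = 1" and c_sym: "\<And>k::nat. c (- int k) = \<zeta> ^ k * c (int k)" by blast
  \<comment> \<open>Both \<open>f\<close> and its conjugate contribute to the coefficient of index
    0, hence the factor 1/2.\<close>
  define b where "b n = (if n = 0 then c 0 / 2 else c (int n))" for n :: nat
  have "(\<Sum>n\<in>A. (cmod (b n))\<^sup>2) \<le> (norm (L2_of h))\<^sup>2" if "finite A" for A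
  proof -
    have "(\<Sum>n\<in>A. (cmod (b n))\<^sup>2) \<le> (\<Sum>n\<in>A. (cmod (cinner (L2_of h) (chi (int n))))\<^sup>2)"
      by (intro sum_mono power_mono) (auto simp: b_def c_def fourier_def norm_divide)
    also have "\<dots> \<le> (norm (L2_of h))\<^sup>2"
      using orthonormal_basis_H2 that by (intro bessel_inequality) (auto simp: orthonormal_basis_of_def)
    finally show ?thesis .
  qed
  from riesz_fischer_coefficients[OF orthonormal_basis_H2 this]
  obtain f where f: "f \<in> H2" "\<And>n. fourier f (int n) = b n" unfolding fourier_def by auto
  have f_neg: "fourier f n = 0" if "n < 0" for n
    using f(1) that by (simp add: H2_eq_analytic analytic_L2_def)
  let ?g = "\<lambda>z. fun_of f z + cnj (fun_of (C_rot \<zeta> f) z)"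
  have sq_g: "square_integrable ?g"
    by (intro square_integrable_add square_integrable_cnj square_integrable_fun_of)
  have "L2_of h = L2_of ?g"
  proof (rule fourier_inject)
    fix n
    have \<zeta>_cnj: "cnj \<zeta> powi m = \<zeta> powi (- m)" for m using \<zeta> by (intro cnj_powi_circle) simp
    have g_coeff: "fourier (L2_of ?g) n = fourier f n + \<zeta> powi (- n) * fourier f (- n)" for n
      by (simp add: fourier_L2_of_add fourier_L2_of_cnj square_integrable_cnj square_integrable_fun_of
          fourier_C_rot[OF \<zeta>] \<zeta>_cnj)
    show "fourier (L2_of h) n = fourier (L2_of ?g) n"
    proof (cases n rule: int_cases3)
      case zero
      have "fourier f 0 = c 0 / 2" using f(2)[of 0] unfolding b_def by simp
      moreover have "2 * (c 0 / 2) = c 0" by simp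
      ultimately have "c 0 = 2 * fourier f 0" by (simp only:)
      then show ?thesis using zero by (simp add: g_coeff flip: c_def)
    next
      case (pos k)
      then show ?thesis using f(2)[of k] f_neg[of "- int k"] by (simp add: g_coeff b_def c_def)
    next
      case (neg k)
      then show ?thesis using f(2)[of k] f_neg[of "- int k"] c_sym[of k] by (simp add: g_coeff b_def c_def)
    qed
  qed
  then have "AE z in \<sigma>. h z = ?g z"
    using fun_of_L2_of[OF h] fun_of_L2_of[OF sq_g] by (auto elim!: eventually_elim2)
  from AE_compose_Ucirc[OF this]
  have "AE z in \<sigma>. \<phi> z = comp_boundary f u z + cnj (comp_boundary (C_rot \<zeta> f) u z)"
    using \<phi>h AE_Ucirc by eventually_elim (simp add: comp_boundary_def)
  then show ?thesis using \<zeta> f(1) by (intro bexI[of _ \<zeta>] bexI[of _ f]) auto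
qed

text \<open>
  With \<open>f\<^sub>n\<close> the Fourier coefficients of \<open>f\<close>, those of \<open>f + cnj (C\<^sub>\<zeta> f)\<close> are
  \<open>c\<^sub>n = f\<^sub>n + \<zeta>\<^bsup>-n\<^esup> f\<^bsub>-n\<^esub>\<close>, and visibly \<open>c\<^bsub>-n\<^esub> = \<zeta>\<^sup>n c\<^sub>n\<close>.
\<close>

lemma decomposition_imp_C_geometric_symmetric:
  assumes \<phi>: "essentially_bounded \<phi>" and \<zeta>: "cmod \<zeta> = 1"
    and dec: "AE z in \<sigma>. \<phi> z = comp_boundary f u z + cnj (comp_boundary (C_rot \<zeta> f) u z)"
  shows "C_geometric_symmetric \<zeta> u (toeplitz \<phi>)"
proof -
  let ?h = "\<lambda>z. fun_of f z + cnj (fun_of (C_rot \<zeta> f) z)"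
  have sq: "square_integrable ?h"
    by (intro square_integrable_add square_integrable_cnj square_integrable_fun_of)
  have \<phi>h: "AE z in \<sigma>. \<phi> z = ?h (Ucirc z)"
    using dec AE_Ucirc by eventually_elim (simp add: comp_boundary_def)
  define c where "c = fourier (L2_of ?h)"
  have \<zeta>_cnj: "cnj \<zeta> powi n = \<zeta> powi (- n)" for n using \<zeta> by (intro cnj_powi_circle) simp
  have \<zeta>_mult: "\<zeta> powi m * \<zeta> powi n = \<zeta> powi (m + n)" for m n using \<zeta> by (intro powi_mult_circle) simp
  have c: "c n = fourier f n + \<zeta> powi (- n) * fourier f (- n)" for n
    by (simp add: c_def fourier_L2_of_add fourier_L2_of_cnj square_integrable_cnj square_integrable_fun_of
        fourier_C_rot[OF \<zeta>] \<zeta>_cnj)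
  have c_sym: "\<zeta> powi n * c n = c (- n)" for n
    using \<zeta>_mult[of n "- n"] unfolding c distrib_left mult.assoc[symmetric] by simp
  have "symmetric_wrt (C_basis (\<lambda>m. cnj \<zeta> ^ m) u E) (toeplitz \<phi>)" if E: "orthonormal_basis E K" for E
  proof (subst symmetric_wrt_C_basis_iff[OF \<phi> E])
    show "cmod (cnj \<zeta> ^ n) = 1" for n using \<zeta> by (simp add: norm_power)
    note EK = orthonormal_basisD(1)[OF E] and on = orthonormal_basisD(2)[OF E]
    show "\<forall>m n. \<forall>e\<in>E. \<forall>e'\<in>E. cnj \<zeta> ^ m * cnj (cnj \<zeta> ^ n) * cinner (mult_op \<phi> (Upow m e)) (Upow n e') =
        cinner (mult_op \<phi> (Upow n e')) (Upow m e)"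
    proof (intro allI ballI)
      fix m n e e' assume e: "e \<in> E" "e' \<in> E"
      have inK: "e \<in> K" "e' \<in> K" using e EK by auto
      have "cnj \<zeta> ^ m * cnj (cnj \<zeta> ^ n) = \<zeta> powi (int n - int m)"
        using \<zeta>_cnj[of "int m"] \<zeta>_mult[of "- int m" "int n"] by simp
      then have "cnj \<zeta> ^ m * cnj (cnj \<zeta> ^ n) * c (int n - int m) = c (int m - int n)"
        using c_sym[of "int n - int m"] by simp
      moreover have "cinner e e' = cinner e' e" using on e by auto
      ultimately show "cnj \<zeta> ^ m * cnj (cnj \<zeta> ^ n) * cinner (mult_op \<phi> (Upow m e)) (Upow n e') =
          cinner (mult_op \<phi> (Upow n e')) (Upow m e)"
        unfolding cinner_mult_op_composition[OF inK \<phi> sq \<phi>h] cinner_mult_op_composition[OF inK(2,1) \<phi> sq \<phi>h]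
          c_def[symmetric] by (simp add: mult.assoc[symmetric])
    qed
  qed
  then show ?thesis by (simp add: C_geometric_symmetric_def C_symmetric_def)
qed

end

theorem theorem1p1:
  fixes \<phi> u :: "complex \<Rightarrow> complex"
  assumes "essentially_bounded \<phi>"
    and "inner_function u"
    and "\<exists>a\<in>ball 0 1. u a = 0"
  shows "((\<exists>\<alpha>. (\<forall>n. \<alpha> n \<in> sphere 0 1) \<and> C_symmetric \<alpha> u (toeplitz \<phi>)) \<longleftrightarrow>
          (\<exists>\<zeta>\<in>sphere 0 1. C_geometric_symmetric \<zeta> u (toeplitz \<phi>))) \<and>
         ((\<exists>\<zeta>\<in>sphere 0 1. C_geometric_symmetric \<zeta> u (toeplitz \<phi>)) \<longleftrightarrow>
          (\<exists>\<zeta>\<in>sphere 0 1. \<exists>f\<in>H2. AE z in circle_measure.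
             \<phi> z = comp_boundary f u z + cnj (comp_boundary (C_rot \<zeta> f) u z)))"
    (is "(?a \<longleftrightarrow> ?b) \<and> (?b \<longleftrightarrow> ?c)")
proof -
  obtain a where "a \<in> ball 0 1" "u a = 0" using assms(3) by blast
  then interpret inner_with_zero u a using assms(2) by unfold_locales
  have "?b \<Longrightarrow> ?a"
  proof -
    assume ?b
    then obtain \<zeta> where \<zeta>: "\<zeta> \<in> sphere 0 1" "C_symmetric (\<lambda>m. cnj \<zeta> ^ m) u (toeplitz \<phi>)"
      by (auto simp: C_geometric_symmetric_def)
    then show ?a by (intro exI[of _ "\<lambda>m. cnj \<zeta> ^ m"]) (simp add: norm_power)
  qed
  moreover have "?a \<Longrightarrow> ?c"
    using C_symmetric_imp_decomposition[OF assms(1)] by auto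
  moreover have "?c \<Longrightarrow> ?b"
    using decomposition_imp_C_geometric_symmetric[OF assms(1)] by (auto intro!: bexI)
  ultimately show ?thesis by blast
qed

end
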